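(* There exists a universal constant $K>0$ (independent of $n$, $h$, $A$, $B$ and of all the parameters below) such that the following holds. Let $n\ge 1$, $h>0$, $M,M'\ge 0$, and let $\rho=(\rho_j)_{j\ge1}$, $\delta=(\delta_j)_{j\ge1}$ be sequences of nonnegative real numbers with $h\rho_j\delta_j\le 1$ for all $j\le n$. Set $$M''=MM'\prod_{j\le n}(1+Kh\rho_j\delta_j).$$ (1) If $A\in S_6(M,\rho,\delta)$ and $B\in S_6(M',\rho,\delta)$, then the Weyl composition $C_h^{weyl}(A,B)$ is a bounded function on $\mathbb{R}^{2n}$ and $$\sup_{X\in\mathbb{R}^{2n}}|C_h^{weyl}(A,B)(X)|\le M''.$$ (2) If $m\ge 6$ is an integer, $A\in S_m(M,\rho,\delta)$ and $B\in S_m(M',\rho,\delta)$, then $C_h^{weyl}(A,B)\in S_{m-6}(M'',2\rho,2\delta)$.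
   Context: Symbol classes: for sequences $\rho=(\rho_j)_{j\ge1}$, $\delta=(\delta_j)_{j\ge1}$ of real numbers $\ge0$, $M\ge0$ and an integer $m\ge0$, $S_m(M,\rho,\delta)$ is the set of continuous functions $F$ on $\mathbb{R}^{2n}$ (points $X=(x,\xi)$, $x,\xi\in\mathbb{R}^n$) such that for every multi-index $(\alpha,\beta)\in\mathbb{N}^n\times\mathbb{N}^n$ with $\alpha_j\le m$ and $\beta_j\le m$ for all $j\le n$, the derivative $\partial_x^\alpha\partial_\xi^\beta F$ exists, is continuous and bounded, and $$\sup_{X\in\mathbb{R}^{2n}}|\partial_x^\alpha\partial_\xi^\beta F(X)|\le M\prod_{j\le n}\rho_j^{\alpha_j}\delta_j^{\beta_j}$$ (with $0^0=1$). Here $2\rho=(2\rho_j)_j$, $2\delta=(2\delta_j)_j$. Weyl composition: for $h>0$, $$C_h^{weyl}(A,B)(X)=(\pi h)^{-2n}\int_{\mathbb{R}^{4n}}A(X+Y)B(X+Z)e^{-\frac{2i}{h}\sigma(Y,Z)}\,dY\,dZ,$$ with $\sigma(X,Y)=y\cdot\xi-x\cdot\eta$ for $X=(x,\xi)$, $Y=(y,\eta)$ in $\mathbb{R}^{2n}$. The integral is understood as an oscillatory integral (e.g. the limit as $\epsilon\to0^+$ of the integrals with the extra factor $e^{-\epsilon(|Y|^2+|Z|^2)}$). It is the Weyl symbol of the product of the Weyl $h$-pseudodifferential operators with symbols $A$ and $B$. *)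

theory Defs
  imports "HOL-Analysis.Analysis"
begin

text \<open>
  The constant \<open>K\<close> of the theorem must not depend on the dimension, so \<open>n\<close> is a term and not
  a type: vectors of dimension \<open>n\<close> are extensional functions on \<open>{1..n}\<close>. On this set the
  product topology of \<^typ>\<open>nat \<Rightarrow> real\<close> is the Euclidean topology, and it is the space of the
  product measure \<^term>\<open>PiM {1..n} (\<lambda>_. lborel)\<close>. Values of symbols off the carrier are irrelevant.
\<close>

type_synonym phase_point = "(nat \<Rightarrow> real) \<times> (nat \<Rightarrow> real)"

definition config_space :: "nat \<Rightarrow> (nat \<Rightarrow> real) set" where
  "config_space n = {1..n} \<rightarrow>\<^sub>E UNIV"

definition phase :: "nat \<Rightarrow> phase_point set" where
  "phase n = config_space n \<times> config_space n"

definition phase_measure :: "nat \<Rightarrow> phase_point measure" where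
  "phase_measure n = PiM {1..n} (\<lambda>_. lborel) \<Otimes>\<^sub>M PiM {1..n} (\<lambda>_. lborel)"

lemma space_phase_measure: "space (phase_measure n) = phase n"
  by (simp add: phase_measure_def phase_def config_space_def space_pair_measure space_PiM)

text \<open>Pointwise addition on \<^typ>\<open>nat \<Rightarrow> real\<close> would leave the extensional functions.\<close>

definition phase_add :: "nat \<Rightarrow> phase_point \<Rightarrow> phase_point \<Rightarrow> phase_point" where
  "phase_add n X Y =
     ((\<lambda>j\<in>{1..n}. fst X j + fst Y j), (\<lambda>j\<in>{1..n}. snd X j + snd Y j))"

definition phase_norm_sq :: "nat \<Rightarrow> phase_point \<Rightarrow> real" where
  "phase_norm_sq n X = (\<Sum>j=1..n. (fst X j)\<^sup>2) + (\<Sum>j=1..n. (snd X j)\<^sup>2)"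

definition symplectic :: "nat \<Rightarrow> phase_point \<Rightarrow> phase_point \<Rightarrow> real" where
  "symplectic n X Y = (\<Sum>j=1..n. fst Y j * snd X j) - (\<Sum>j=1..n. fst X j * snd Y j)"

definition has_partial_x ::
  "nat \<Rightarrow> nat \<Rightarrow> (phase_point \<Rightarrow> complex) \<Rightarrow> (phase_point \<Rightarrow> complex) \<Rightarrow> bool" where
  "has_partial_x n j F G \<longleftrightarrow>
     (\<forall>x\<in>config_space n. \<forall>\<xi>\<in>config_space n.
        ((\<lambda>t. F (x(j := t), \<xi>)) has_vector_derivative G (x, \<xi>)) (at (x j)))"

definition has_partial_xi ::
  "nat \<Rightarrow> nat \<Rightarrow> (phase_point \<Rightarrow> complex) \<Rightarrow> (phase_point \<Rightarrow> complex) \<Rightarrow> bool" where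
  "has_partial_xi n j F G \<longleftrightarrow>
     (\<forall>x\<in>config_space n. \<forall>\<xi>\<in>config_space n.
        ((\<lambda>t. F (x, \<xi>(j := t))) has_vector_derivative G (x, \<xi>)) (at (\<xi> j)))"

definition multi_indices :: "nat \<Rightarrow> nat \<Rightarrow> (nat \<Rightarrow> nat) set" where
  "multi_indices n m = {1..n} \<rightarrow>\<^sub>E {..m}"

text \<open>
  \<open>D \<alpha> \<beta>\<close> is the mixed derivative of \<open>F\<close> of order \<open>(\<alpha>, \<beta>)\<close>, for all \<open>\<alpha>\<close> and \<open>\<beta>\<close> with entries
  at most \<open>m\<close>. These conditions determine \<open>D \<alpha> \<beta>\<close> on \<open>phase n\<close>, and the partial derivatives may
  be taken in any order; when the derivatives are continuous, as in the symbol classes below,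
  this follows from their existence in one fixed order by Schwarz's theorem.
\<close>

definition mixed_partials ::
  "nat \<Rightarrow> nat \<Rightarrow> (phase_point \<Rightarrow> complex) \<Rightarrow>
     ((nat \<Rightarrow> nat) \<Rightarrow> (nat \<Rightarrow> nat) \<Rightarrow> phase_point \<Rightarrow> complex) \<Rightarrow> bool" where
  "mixed_partials n m F D \<longleftrightarrow>
     (\<forall>X\<in>phase n. D (\<lambda>j\<in>{1..n}. 0) (\<lambda>j\<in>{1..n}. 0) X = F X) \<and>
     (\<forall>\<alpha>\<in>multi_indices n m. \<forall>\<beta>\<in>multi_indices n m. \<forall>j\<in>{1..n}.
        (\<alpha> j < m \<longrightarrow> has_partial_x n j (D \<alpha> \<beta>) (D (\<alpha>(j := Suc (\<alpha> j))) \<beta>)) \<and>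
        (\<beta> j < m \<longrightarrow> has_partial_xi n j (D \<alpha> \<beta>) (D \<alpha> (\<beta>(j := Suc (\<beta> j))))))"

definition symbol_class ::
  "nat \<Rightarrow> nat \<Rightarrow> real \<Rightarrow> (nat \<Rightarrow> real) \<Rightarrow> (nat \<Rightarrow> real) \<Rightarrow> (phase_point \<Rightarrow> complex) set" where
  "symbol_class n m M \<rho> \<delta> =
     {F. continuous_on (phase n) F \<and>
         (\<exists>D. mixed_partials n m F D \<and>
            (\<forall>\<alpha>\<in>multi_indices n m. \<forall>\<beta>\<in>multi_indices n m.
               continuous_on (phase n) (D \<alpha> \<beta>) \<and>
               bounded (D \<alpha> \<beta> ` phase n) \<and>
               (SUP X\<in>phase n. cmod (D \<alpha> \<beta> X))
                 \<le> M * (\<Prod>j=1..n. \<rho> j ^ \<alpha> j * \<delta> j ^ \<beta> j)))}"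

definition weyl_integrand ::
  "nat \<Rightarrow> real \<Rightarrow> (phase_point \<Rightarrow> complex) \<Rightarrow> (phase_point \<Rightarrow> complex) \<Rightarrow>
     real \<Rightarrow> phase_point \<Rightarrow> phase_point \<times> phase_point \<Rightarrow> complex" where
  "weyl_integrand n h A B \<epsilon> X = (\<lambda>(Y, Z).
     A (phase_add n X Y) * B (phase_add n X Z)
       * exp (- (2 * \<i> / complex_of_real h) * complex_of_real (symplectic n Y Z))
       * complex_of_real (exp (- \<epsilon> * (phase_norm_sq n Y + phase_norm_sq n Z))))"

definition weyl_regularized ::
  "nat \<Rightarrow> real \<Rightarrow> (phase_point \<Rightarrow> complex) \<Rightarrow> (phase_point \<Rightarrow> complex) \<Rightarrow>
     real \<Rightarrow> phase_point \<Rightarrow> complex" where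
  "weyl_regularized n h A B \<epsilon> X =
     complex_of_real (1 / (pi * h) ^ (2 * n)) *
       integral\<^sup>L (phase_measure n \<Otimes>\<^sub>M phase_measure n) (weyl_integrand n h A B \<epsilon> X)"

text \<open>
  The oscillatory integral is the limit of the regularized integrals as \<open>\<epsilon>\<close> tends to \<open>0\<close> from
  above. Since \<^const>\<open>Lim\<close> and the Bochner integral are total, well-definedness is the separate
  predicate \<open>weyl_defined\<close>.
\<close>

definition weyl_defined ::
  "nat \<Rightarrow> real \<Rightarrow> (phase_point \<Rightarrow> complex) \<Rightarrow> (phase_point \<Rightarrow> complex) \<Rightarrow> bool" where
  "weyl_defined n h A B \<longleftrightarrow>
     (\<forall>X\<in>phase n.
        (\<forall>\<epsilon>>0. integrable (phase_measure n \<Otimes>\<^sub>M phase_measure n) (weyl_integrand n h A B \<epsilon> X)) \<and>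
        (\<exists>l. ((\<lambda>\<epsilon>. weyl_regularized n h A B \<epsilon> X) \<longlongrightarrow> l) (at_right 0)))"

definition weyl_comp ::
  "nat \<Rightarrow> real \<Rightarrow> (phase_point \<Rightarrow> complex) \<Rightarrow> (phase_point \<Rightarrow> complex) \<Rightarrow>
     phase_point \<Rightarrow> complex" where
  "weyl_comp n h A B X = Lim (at_right 0) (\<lambda>\<epsilon>. weyl_regularized n h A B \<epsilon> X)"

end

theory Submission
  imports Defs "HOL-Probability.Probability"
begin

text \<open>
  In \<open>\<sigma>(Y, Z) = (\<Sum>j. z\<^sub>j \<eta>\<^sub>j - y\<^sub>j \<zeta>\<^sub>j)\<close>, with \<open>Y = (y, \<eta>)\<close> and \<open>Z = (z, \<zeta>)\<close>, every integration variable
  is coupled to exactly one other. The \<open>4 n\<close> variables therefore fall into \<open>2 n\<close> blocks of one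
  position \<open>a\<close> and one momentum \<open>b\<close>, and the oscillating factor is a product over the blocks. After
  rescaling the two variables, the integral over one block is
  \<open>T f = 1/\<pi> \<integral>\<integral> e^(2 \<i> a b) f(a, b) da db\<close>, a realization of \<open>(exp (\<i>/2 \<partial>\<^sub>a \<partial>\<^sub>b) f)(0, 0)\<close>. The
  rescaling can be chosen such that a derivative of order \<open>(l, m)\<close> in \<open>(a, b)\<close> is bounded by
  \<open>p ^ l q ^ m\<close> with \<open>p \<le> 1\<close>, \<open>q \<le> 1\<close> and \<open>p q = h \<rho>\<^sub>j \<delta>\<^sub>j\<close>; this is where \<open>h \<rho>\<^sub>j \<delta>\<^sub>j \<le> 1\<close> enters.

  For one block, Taylor's formula in \<open>b\<close> and an integration by parts in \<open>a\<close> give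
  \<open>T f = f(0, 0) + \<i>/2 \<integral>\<^sub>0\<^sup>1 T (\<partial>\<^sub>a \<partial>\<^sub>b f(\<cdot>, t \<cdot>)) dt\<close>, where the value at the origin is Fourier inversion
  for \<open>a \<mapsto> f(a, 0)\<close>. Two further integrations by parts in each variable turn the second summand
  into an absolutely convergent integral of the derivatives of \<open>f\<close> of orders 1 to 3 in \<open>a\<close> and in
  \<open>b\<close> (\<open>decaying_osc_expansion\<close>). Hence \<open>T\<close> is the evaluation at the origin plus an operator of size
  \<open>O(p q)\<close>. The Gaussian regularization is absorbed in the kernel by the Leibniz rule
  (\<open>damped_osc_expansion\<close>): the damped block integral has an exact expansion whose kernels are
  dominated by one integrable function, converge as the damping tends to 0, and lose in the limit
  all terms with no derivative in \<open>a\<close> or in \<open>b\<close>.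

  The expansion is then iterated. A block operator maps a family of functions that are the mixed
  derivatives of one function to such a family (\<open>jet_family_block_op\<close>). It uses up three orders in
  the coordinates of its own block only and, without damping, multiplies the bounds by
  \<open>1 + C h \<rho>\<^sub>j \<delta>\<^sub>j\<close>. By Fubini's theorem the regularized Weyl integral is a composition of block
  integrals (\<open>integral_box_eq_fold\<close>), thus of block operators, and by dominated convergence it tends
  to the composition of the undamped ones (\<open>tendsto_fold_integral_step\<close>). There are two blocks for
  each \<open>j\<close>, so the limit is bounded by \<open>M M' \<Prod>\<^sub>j (1 + C h \<rho>\<^sub>j \<delta>\<^sub>j)\<^sup>2\<close>, and \<open>(1 + C s)\<^sup>2 \<le> 1 + (2 C + C\<^sup>2) s\<close>
  for \<open>s\<close> between 0 and 1.

  Finally, the limit is the restriction to the diagonal of a jet family in all \<open>4 n\<close> coordinates. A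
  derivative in a coordinate of \<open>X\<close> is the sum of two partial derivatives of that family, one that
  acts on \<open>A\<close> and one that acts on \<open>B\<close> (\<open>diag_family_derivative\<close>), and every derivative costs a
  factor 2: this is the passage from \<open>\<rho>\<close>, \<open>\<delta>\<close> to \<open>2 \<rho>\<close>, \<open>2 \<delta>\<close>.
\<close>


section \<open>One-dimensional oscillatory integrals\<close>

definition cauchy_weight :: "real \<Rightarrow> real" where "cauchy_weight x = inverse (1 + x\<^sup>2)"

text \<open>
  Since \<open>(1 + d/da) e^(2 \<i> a b) = (1 + 2 \<i> b) e^(2 \<i> a b)\<close>, moving \<open>1 + d/da\<close> from the exponential to
  the amplitude gains this factor. Unlike division by \<open>2 \<i> b\<close>, it is harmless at \<open>b = 0\<close>.
\<close>
definition parts_factor :: "real \<Rightarrow> complex" where "parts_factor b = inverse (1 + 2 * \<i> * of_real b)"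

abbreviation osc :: "real \<Rightarrow> real \<Rightarrow> complex" where "osc a b \<equiv> cis (2 * a * b)"

lemma cauchy_weight_pos: "cauchy_weight x > 0" and cauchy_weight_le_1: "cauchy_weight x \<le> 1"
  unfolding cauchy_weight_def by (auto intro!: add_pos_nonneg simp: inverse_le_1_iff)

lemma cauchy_weight_nonneg [simp]: "cauchy_weight x \<ge> 0"
  using cauchy_weight_pos[of x] by simp

lemma cauchy_weight_0 [simp]: "cauchy_weight 0 = 1"
  by (simp add: cauchy_weight_def)

lemma continuous_cauchy_weight [continuous_intros]:
  "continuous_on S f \<Longrightarrow> continuous_on S (\<lambda>x. cauchy_weight (f x))"
  unfolding cauchy_weight_def by (intro continuous_intros) (auto simp: add_nonneg_eq_0_iff)

lemma integrable_cauchy_weight: "integrable lborel cauchy_weight"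
  using integrable_inverse_1_plus_square
  by (simp add: cauchy_weight_def[abs_def] set_integrable_def)

lemma tendsto_cauchy_weight: "(cauchy_weight \<longlongrightarrow> 0) at_top" "(cauchy_weight \<longlongrightarrow> 0) at_bot"
  unfolding cauchy_weight_def[abs_def] by real_asymp+

lemma one_plus_2i_nonzero: "1 + 2 * \<i> * complex_of_real b \<noteq> 0"
  by (auto simp: complex_eq_iff)

lemma norm_parts_factor_sq: "norm (parts_factor b) ^ 2 \<le> cauchy_weight b"
proof -
  have "norm (1 + 2 * \<i> * complex_of_real b) ^ 2 = 1 + 4 * b\<^sup>2"
    by (simp add: cmod_def power_mult_distrib)
  then have "norm (parts_factor b) ^ 2 = inverse (1 + 4 * b\<^sup>2)"
    by (simp add: parts_factor_def norm_inverse power_inverse)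
  also have "\<dots> \<le> cauchy_weight b"
    unfolding cauchy_weight_def by (intro le_imp_inverse_le) (auto intro!: add_pos_nonneg)
  finally show ?thesis .
qed

lemma norm_parts_factor_le_1: "norm (parts_factor b) \<le> 1"
proof -
  have "norm (parts_factor b) ^ 2 \<le> 1"
    using norm_parts_factor_sq[of b] cauchy_weight_le_1[of b] by linarith
  then show ?thesis
    by (simp add: power_le_one_iff abs_square_le_1)
qed

lemma continuous_parts_factor [continuous_intros]:
  "continuous_on S f \<Longrightarrow> continuous_on S (\<lambda>x. parts_factor (f x))"
  unfolding parts_factor_def by (intro continuous_intros) (auto simp: one_plus_2i_nonzero)

lemma parts_factor_deriv: "(parts_factor has_vector_derivative - 2 * \<i> * parts_factor b ^ 2) (at b)"
proof -
  have "((\<lambda>z. inverse (1 + 2 * \<i> * z)) has_field_derivative - 2 * \<i> * parts_factor b ^ 2) (at (of_real b))"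
    using one_plus_2i_nonzero[of b]
    by (auto intro!: derivative_eq_intros simp: parts_factor_def power2_eq_square)
  from has_vector_derivative_real_field[OF this] show ?thesis
    by (simp add: parts_factor_def[abs_def])
qed

lemma continuous_osc [continuous_intros]:
  "continuous_on S f \<Longrightarrow> continuous_on S (\<lambda>x. cis (f x))"
  by (simp add: cis_conv_exp) (intro continuous_intros)

lemma measurable_continuous_lborel:
  "continuous_on UNIV f \<Longrightarrow> f \<in> borel_measurable lborel"
  by (simp add: borel_measurable_continuous_onI)

lemma integrable_cauchy_bound:
  fixes u :: "real \<Rightarrow> complex"
  assumes "continuous_on UNIV u" "\<And>x. norm (u x) \<le> C * cauchy_weight x"
  shows "integrable lborel u"
proof (rule Bochner_Integration.integrable_bound)
  show "integrable lborel (\<lambda>x. C * cauchy_weight x)"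
    using integrable_cauchy_weight by simp
  show "u \<in> borel_measurable lborel"
    using assms(1) by (rule measurable_continuous_lborel)
  show "AE x in lborel. norm (u x) \<le> norm (C * cauchy_weight x)"
    using order_trans[OF assms(2) abs_ge_self] by simp
qed

text \<open>
  The bound on \<open>F\<close> makes both boundary terms of the fundamental theorem of calculus vanish.
\<close>
lemma integral_derivative_eq_0:
  fixes F f :: "real \<Rightarrow> complex"
  assumes F: "\<And>x. (F has_vector_derivative f x) (at x)"
    and f: "continuous_on UNIV f" "integrable lborel f"
    and bound: "\<And>x. norm (F x) \<le> C * cauchy_weight x"
  shows "integral\<^sup>L lborel f = 0"
proof -
  have top: "(F \<longlongrightarrow> 0) at_top"
    by (rule Lim_null_comparison[OF always_eventually[OF allI[OF bound]]])
       (use tendsto_mult_left[OF tendsto_cauchy_weight(1), of C] in simp)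
  have bot: "(F \<longlongrightarrow> 0) at_bot"
    by (rule Lim_null_comparison[OF always_eventually[OF allI[OF bound]]])
       (use tendsto_mult_left[OF tendsto_cauchy_weight(2), of C] in simp)
  have "(LBINT x=-\<infinity>..\<infinity>. f x) = 0 - 0"
  proof (rule interval_integral_FTC_integrable)
    show "isCont f x" for x
      using f(1) by (simp add: continuous_on_eq_continuous_at)
    show "set_integrable lborel (einterval (- \<infinity>) \<infinity>) f"
      using f(2) by (simp add: set_integrable_def)
    show "((F \<circ> real_of_ereal) \<longlongrightarrow> 0) (at_right (- \<infinity>))"
      using bot by (simp add: ereal_tendsto_simps)
    show "((F \<circ> real_of_ereal) \<longlongrightarrow> 0) (at_left \<infinity>)"
      using top by (simp add: ereal_tendsto_simps)
  qed (use F in auto)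
  then show ?thesis
    by (simp add: interval_integral_to_infinity_eq interval_lebesgue_integral_def
        set_lebesgue_integral_def)
qed

lemma osc_deriv: "((\<lambda>a. osc a b) has_vector_derivative 2 * \<i> * of_real b * osc a b) (at a)"
  unfolding has_vector_derivative_complex_iff
  by (auto intro!: derivative_eq_intros simp: algebra_simps)

lemma osc_integral_derivative:
  fixes u u' :: "real \<Rightarrow> complex"
  assumes u: "\<And>x. (u has_vector_derivative u' x) (at x)"
    and cont: "continuous_on UNIV u'"
    and bound: "\<And>x. norm (u x) \<le> C * cauchy_weight x" "\<And>x. norm (u' x) \<le> C * cauchy_weight x"
  shows "2 * \<i> * of_real b * (\<integral>a. osc a b * u a \<partial>lborel) = - (\<integral>a. osc a b * u' a \<partial>lborel)"
proof -
  have cu: "continuous_on UNIV u"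
    using u by (meson continuous_at_imp_continuous_on has_vector_derivative_continuous)
  have int: "integrable lborel (\<lambda>a. osc a b * u a)" "integrable lborel (\<lambda>a. osc a b * u' a)"
    by (auto intro!: integrable_cauchy_bound[where C=C] continuous_intros cu cont bound simp: norm_mult)
  have "(\<integral>a. 2 * \<i> * of_real b * (osc a b * u a) + osc a b * u' a \<partial>lborel) = 0"
  proof (rule integral_derivative_eq_0[where F="\<lambda>a. osc a b * u a" and C=C])
    show "((\<lambda>a. osc a b * u a) has_vector_derivative
        2 * \<i> * of_real b * (osc x b * u x) + osc x b * u' x) (at x)" for x
      by (rule derivative_eq_intros osc_deriv u refl | simp add: algebra_simps)+
    show "continuous_on UNIV (\<lambda>a. 2 * \<i> * of_real b * (osc a b * u a) + osc a b * u' a)"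
      by (intro continuous_intros cu cont)
    show "integrable lborel (\<lambda>a. 2 * \<i> * of_real b * (osc a b * u a) + osc a b * u' a)"
      using int by (intro Bochner_Integration.integrable_add integrable_mult_right)
    show "norm (osc x b * u x) \<le> C * cauchy_weight x" for x
      using bound(1) by (simp add: norm_mult)
  qed
  also have "(\<integral>a. 2 * \<i> * of_real b * (osc a b * u a) + osc a b * u' a \<partial>lborel) =
      2 * \<i> * of_real b * (\<integral>a. osc a b * u a \<partial>lborel) + (\<integral>a. osc a b * u' a \<partial>lborel)"
    using int by (subst Bochner_Integration.integral_add) auto
  finally show ?thesis
    by (simp add: eq_neg_iff_add_eq_0)
qed

lemma osc_integral_by_parts:
  fixes u u' :: "real \<Rightarrow> complex"
  assumes u: "\<And>x. (u has_vector_derivative u' x) (at x)"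
    and cont: "continuous_on UNIV u'"
    and bound: "\<And>x. norm (u x) \<le> C * cauchy_weight x" "\<And>x. norm (u' x) \<le> C * cauchy_weight x"
  shows "(\<integral>a. osc a b * u a \<partial>lborel) = parts_factor b * (\<integral>a. osc a b * (u a - u' a) \<partial>lborel)"
proof -
  have cu: "continuous_on UNIV u"
    using u by (meson continuous_at_imp_continuous_on has_vector_derivative_continuous)
  have int: "integrable lborel (\<lambda>a. osc a b * u a)" "integrable lborel (\<lambda>a. osc a b * u' a)"
    by (auto intro!: integrable_cauchy_bound[where C=C] continuous_intros cu cont bound simp: norm_mult)
  have "(\<integral>a. osc a b * (u a - u' a) \<partial>lborel) = 
     (1 + 2 * \<i> * of_real b) * (\<integral>a. osc a b * u a \<partial>lborel)"
    using int osc_integral_derivative[OF assms, of b] by (simp add: algebra_simps)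
  then show ?thesis
    using one_plus_2i_nonzero[of b] by (simp add: parts_factor_def field_simps)
qed

text \<open>
  Two steps, because the square of \<open>parts_factor\<close> is the first power that is integrable.
\<close>
lemma osc_integral_by_parts2:
  fixes u u' u'' :: "real \<Rightarrow> complex"
  assumes u: "\<And>x. (u has_vector_derivative u' x) (at x)" 
    and u': "\<And>x. (u' has_vector_derivative u'' x) (at x)"
    and cont: "continuous_on UNIV u''"
    and bound: "\<And>x. norm (u x) \<le> C * cauchy_weight x" "\<And>x. norm (u' x) \<le> C * cauchy_weight x"
       "\<And>x. norm (u'' x) \<le> C * cauchy_weight x"
  shows "(\<integral>a. osc a b * u a \<partial>lborel) =
    parts_factor b ^ 2 * (\<integral>a. osc a b * (u a - 2 * u' a + u'' a) \<partial>lborel)"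
proof -
  have cu': "continuous_on UNIV u'"
    using u' by (meson continuous_at_imp_continuous_on has_vector_derivative_continuous)
  have "(\<integral>a. osc a b * (u a - u' a) \<partial>lborel) =
    parts_factor b * (\<integral>a. osc a b * ((u a - u' a) - (u' a - u'' a)) \<partial>lborel)"
  proof (rule osc_integral_by_parts[where C="2 * C"])
    show "((\<lambda>a. u a - u' a) has_vector_derivative u' x - u'' x) (at x)" for x
      by (intro derivative_intros u u')
    show "norm (u x - u' x) \<le> 2 * C * cauchy_weight x" "norm (u' x - u'' x) \<le> 2 * C * cauchy_weight x" for x
      using norm_triangle_ineq4[of "u x" "u' x"] norm_triangle_ineq4[of "u' x" "u'' x"] bound[of x]
      by auto
  qed (intro continuous_intros cont cu')
  with osc_integral_by_parts[OF u cu' bound(1,2), of b] show ?thesis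
    by (simp add: power2_eq_square algebra_simps)
qed

lemma norm_osc_integral_le:
  fixes u :: "real \<Rightarrow> complex"
  assumes "continuous_on UNIV u" "\<And>x. norm (u x) \<le> C * cauchy_weight x"
  shows "norm (\<integral>a. osc a b * u a \<partial>lborel) \<le> C * integral\<^sup>L lborel cauchy_weight"
proof -
  have "norm (\<integral>a. osc a b * u a \<partial>lborel) \<le> (\<integral>a. C * cauchy_weight a \<partial>lborel)"
  proof (rule Bochner_Integration.integral_norm_bound_integral)
    show "integrable lborel (\<lambda>a. osc a b * u a)"
      using assms by (intro integrable_cauchy_bound[where C=C] continuous_intros) (auto simp: norm_mult)
  qed (use integrable_cauchy_weight assms in \<open>auto simp: norm_mult\<close>)
  then show ?thesis by simp
qed

text \<open>
  This is the characteristic function of the standard normal distribution after rescaling.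
\<close>
lemma gaussian_osc_integral:
  assumes "s > 0"
  shows "integrable lborel (\<lambda>b. osc a b * of_real (exp (- s * b\<^sup>2)))"
   and "(\<integral>b. osc a b * of_real (exp (- s * b\<^sup>2)) \<partial>lborel) = of_real (sqrt (pi / s) * exp (- a\<^sup>2 / s))"
proof -
  define r where "r = sqrt (2 * s)"
  have r: "r > 0" "r\<^sup>2 = 2 * s" using assms by (auto simp: r_def)
  define G where "G = (\<lambda>x. complex_of_real (std_normal_density x) * iexp (2 * a / r * x))"
  have "integrable lborel std_normal_density"
    using integrable_std_normal_moment[of 0] by simp
  then have intG: "integrable lborel G"
    unfolding G_def
    by (rule Bochner_Integration.integrable_bound) (auto simp: norm_mult)
  have "char std_normal_distribution (2 * a / r) = integral\<^sup>L lborel G"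
    unfolding char_def G_def
    by (subst integral_density) (auto simp: scaleR_conv_of_real)
  then have G: "integral\<^sup>L lborel G = of_real (exp (- ((2 * a / r)\<^sup>2) / 2))"
    by (simp add: char_std_normal_distribution)
  have eq: "osc a b * of_real (exp (- s * b\<^sup>2)) = of_real (sqrt (2 * pi)) * G (0 + r * b)" for b
    using r by (simp add: G_def normal_density_def cis_conv_exp power_mult_distrib field_simps)
  show "integrable lborel (\<lambda>b. osc a b * of_real (exp (- s * b\<^sup>2)))"
    unfolding eq using lborel_integrable_real_affine[OF intG, of r 0] r by simp
  have "(\<integral>b. osc a b * of_real (exp (- s * b\<^sup>2)) \<partial>lborel) = 
     of_real (sqrt (2 * pi)) * (\<integral>b. G (0 + r * b) \<partial>lborel)"
    unfolding eq by simp
  also have "(\<integral>b. G (0 + r * b) \<partial>lborel) = integral\<^sup>L lborel G / r"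
    using lborel_integral_real_affine[of r G 0] r by (simp add: scaleR_conv_of_real field_simps)
  also have "of_real (sqrt (2 * pi)) * (integral\<^sup>L lborel G / r) = of_real (sqrt (pi / s) * exp (- a\<^sup>2 / s))"
    unfolding G r_def using assms
    by (simp add: power_divide power_mult_distrib real_sqrt_divide real_sqrt_mult field_simps)
  finally show "(\<integral>b. osc a b * of_real (exp (- s * b\<^sup>2)) \<partial>lborel) = of_real (sqrt (pi / s) * exp (- a\<^sup>2 / s))" .
qed

section \<open>Fourier inversion and absolutely convergent integrals\<close>

lemma osc_commute: "osc a b = osc b a"
  by (simp add: mult_ac)

lemma measurable_cis [measurable]:
  "f \<in> borel_measurable M \<Longrightarrow> (\<lambda>x. cis (f x)) \<in> borel_measurable M"
  by (rule measurable_compose[OF _ borel_measurable_continuous_onI[where f=cis]])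
     (auto intro: continuous_osc continuous_on_id)

lemma measurable_parts_factor [measurable]: "parts_factor \<in> borel_measurable borel"
  by (rule borel_measurable_continuous_onI) (intro continuous_intros)

lemma integrable_product_bound:
  fixes f :: "'a::euclidean_space \<times> 'b::euclidean_space \<Rightarrow> complex"
  assumes f: "f \<in> borel_measurable borel"
    and g: "integrable lborel g" and h: "integrable lborel h"
    and bound: "\<And>a b. norm (f (a, b)) \<le> g a * h b"
  shows "integrable lborel f"
proof -
  have "integrable (lborel \<Otimes>\<^sub>M lborel) (\<lambda>(a, b). g a * h b :: real)"
  proof (rule lborel_pair.Fubini_integrable)
    show "(\<lambda>(a, b). g a * h b) \<in> borel_measurable (lborel \<Otimes>\<^sub>M lborel)"
      using g h by measurable
    show "integrable lborel (\<lambda>a. \<integral>b. norm (case (a, b) of (a, b) \<Rightarrow> g a * h b) \<partial>lborel)"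
      using g by (simp add: abs_mult)
  qed (use h in simp)
  then have "integrable lborel (\<lambda>(a, b). g a * h b)"
    by (simp add: lborel_prod)
  then show ?thesis
  proof (rule Bochner_Integration.integrable_bound)
    show "AE x in lborel. norm (f x) \<le> norm (case x of (a, b) \<Rightarrow> g a * h b)"
      using order_trans[OF bound abs_ge_self] by (auto simp: split_beta)
  qed (use f in simp)
qed

text \<open>
  If the integral over \<open>b\<close> is damped by \<open>exp (- s b\<^sup>2)\<close>, it can be evaluated before the one over \<open>a\<close>,
  which leaves the mean of \<open>u\<close> against a Gaussian of width \<open>sqrt s\<close> and total mass \<open>\<pi>\<close>. The damping
  can be removed because two integrations by parts bound the inner integral by an integrable
  function of \<open>b\<close>.
\<close>
lemma fourier_inversion_osc:
  fixes u u' u'' :: "real \<Rightarrow> complex"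
  assumes u: "\<And>x. (u has_vector_derivative u' x) (at x)" 
    and u': "\<And>x. (u' has_vector_derivative u'' x) (at x)"
    and cont: "continuous_on UNIV u''"
    and bound: "\<And>x. norm (u x) \<le> C * cauchy_weight x" "\<And>x. norm (u' x) \<le> C * cauchy_weight x"
       "\<And>x. norm (u'' x) \<le> C * cauchy_weight x"
  shows "integrable lborel (\<lambda>b. \<integral>a. osc a b * u a \<partial>lborel)"
    and "(\<integral>b. (\<integral>a. osc a b * u a \<partial>lborel) \<partial>lborel) = of_real pi * u 0"
proof -
  have cu': "continuous_on UNIV u'" and cu: "continuous_on UNIV u"
    using u u' by (meson continuous_at_imp_continuous_on has_vector_derivative_continuous)+
  note [measurable] = borel_measurable_continuous_onI[OF cu]
  define U where "U = (\<lambda>b. \<integral>a. osc a b * u a \<partial>lborel)"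
  have [measurable]: "U \<in> borel_measurable borel"
    unfolding U_def by measurable
  have C: "C \<ge> 0"
    using order_trans[OF norm_ge_zero bound(1)[of 0]] by simp
  have "norm (u x - 2 * u' x + u'' x) \<le> (4 * C) * cauchy_weight x" for x
    using norm_triangle_ineq[of "u x - 2 * u' x" "u'' x"] norm_triangle_ineq4[of "u x" "2 * u' x"]
      bound[of x] by (simp add: norm_mult)
  note V = norm_osc_integral_le[OF _ this]
  have boundU: "norm (U b) \<le> (4 * C * integral\<^sup>L lborel cauchy_weight) * cauchy_weight b" for b
  proof -
    have "norm (U b) \<le> cauchy_weight b * ((4 * C) * integral\<^sup>L lborel cauchy_weight)"
      unfolding U_def osc_integral_by_parts2[OF assms] norm_mult norm_power
      by (intro mult_mono norm_parts_factor_sq V continuous_intros cu cu' cont) auto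
    then show ?thesis by (simp add: mult_ac)
  qed
  show intU: "integrable lborel (\<lambda>b. \<integral>a. osc a b * u a \<partial>lborel)"
  proof (rule Bochner_Integration.integrable_bound)
    show "integrable lborel (\<lambda>b. (4 * C * integral\<^sup>L lborel cauchy_weight) * cauchy_weight b)"
      using integrable_cauchy_weight by simp
    show "(\<lambda>b. \<integral>a. osc a b * u a \<partial>lborel) \<in> borel_measurable lborel"
      by measurable
    show "AE b in lborel. norm (\<integral>a. osc a b * u a \<partial>lborel)
        \<le> norm (4 * C * integral\<^sup>L lborel cauchy_weight * cauchy_weight b)"
      using order_trans[OF boundU abs_ge_self] by (simp add: U_def)
  qed
  \<comment> \<open>a sequence of squares, for the substitution \<open>a = e x\<close> with \<open>s n = e\<^sup>2\<close> below\<close>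
  define s where "s = (\<lambda>n. inverse (real (Suc n)) ^ 2)"
  have s: "s n > 0" for n by (simp add: s_def)
  have s0: "s \<longlonglongrightarrow> 0"
    unfolding s_def using tendsto_power[OF LIMSEQ_inverse_real_of_nat, of 2] by simp
  define J where "J = (\<lambda>n. \<integral>b. of_real (exp (- s n * b\<^sup>2)) * U b \<partial>lborel)"
  have "J \<longlonglongrightarrow> integral\<^sup>L lborel U"
    unfolding J_def
  proof (rule integral_dominated_convergence[where w="\<lambda>b. norm (U b)"])
    show "integrable lborel (\<lambda>b. norm (U b))"
      using intU by (simp add: U_def)
    show "AE b in lborel. (\<lambda>n. of_real (exp (- s n * b\<^sup>2)) * U b) \<longlonglongrightarrow> U b"
    proof (rule always_eventually, rule allI)
      fix b :: real
      have "(\<lambda>n. exp (- s n * b\<^sup>2)) \<longlonglongrightarrow> exp (- 0 * b\<^sup>2)"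
        by (intro tendsto_intros) (rule s0)
      then have "(\<lambda>n. complex_of_real (exp (- s n * b\<^sup>2)) * U b) \<longlonglongrightarrow> of_real (exp (- 0 * b\<^sup>2)) * U b"
        by (intro tendsto_mult tendsto_of_real tendsto_const)
      then show "(\<lambda>n. of_real (exp (- s n * b\<^sup>2)) * U b) \<longlonglongrightarrow> U b" by simp
    qed
    show "AE b in lborel. norm (of_real (exp (- s n * b\<^sup>2)) * U b) \<le> norm (U b)" for n
      using s[of n] by (intro always_eventually allI) (simp add: norm_mult mult_left_le_one_le)
  qed auto
  moreover have "J \<longlonglongrightarrow> of_real pi * u 0"
  proof -
    have Jn: "J n = (\<integral>x. u (inverse (real (Suc n)) * x) * of_real (sqrt pi * exp (- x\<^sup>2)) \<partial>lborel)" for n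
    proof -
      define e where "e = inverse (real (Suc n))"
      have e: "e > 0" "s n = e\<^sup>2" by (auto simp: e_def s_def)
      have "J n = (\<integral>b. (\<integral>a. of_real (exp (- s n * b\<^sup>2)) * (osc a b * u a) \<partial>lborel) \<partial>lborel)"
        by (simp add: J_def U_def)
      also have "\<dots> = (\<integral>a. (\<integral>b. of_real (exp (- s n * b\<^sup>2)) * (osc a b * u a) \<partial>lborel) \<partial>lborel)"
      proof (rule lborel_pair.Fubini_integral)
        have "integrable lborel (\<lambda>b. norm (osc 0 b * of_real (exp (- s n * b\<^sup>2))))"
          using gaussian_osc_integral(1)[OF s[of n], of 0] by (rule integrable_norm)
        then have "integrable lborel (\<lambda>b. exp (- s n * b\<^sup>2))"
          by (simp add: norm_mult)
        then have "integrable lborel (\<lambda>(a, b). of_real (exp (- s n * b\<^sup>2)) * (osc a b * u a))"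
        proof (intro integrable_product_bound[where g="\<lambda>a. C * cauchy_weight a" and h="\<lambda>b. exp (- s n * b\<^sup>2)"])
          show "(\<lambda>(a, b). of_real (exp (- s n * b\<^sup>2)) * (osc a b * u a)) \<in> borel_measurable borel"
            unfolding case_prod_unfold borel_prod[symmetric] by measurable
        qed (use integrable_cauchy_weight bound(1) in \<open>auto simp: norm_mult\<close>)
        then show "integrable (lborel \<Otimes>\<^sub>M lborel)
            (\<lambda>(a, b). of_real (exp (- s n * b\<^sup>2)) * (osc a b * u a))"
          by (simp add: lborel_prod)
      qed
      also have "\<dots> = (\<integral>a. u a * (\<integral>b. osc a b * of_real (exp (- s n * b\<^sup>2)) \<partial>lborel) \<partial>lborel)"
        by (simp add: mult_ac)
      also have "\<dots> = (\<integral>a. u a * of_real (sqrt (pi / s n) * exp (- a\<^sup>2 / s n)) \<partial>lborel)"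
        unfolding gaussian_osc_integral(2)[OF s] ..
      also have "\<dots> = e *\<^sub>R (\<integral>x. u (0 + e * x) * of_real (sqrt (pi / s n) * exp (- (0 + e * x)\<^sup>2 / s n)) \<partial>lborel)"
        using e by (subst lborel_integral_real_affine[where c=e and t=0]) auto
      also have "\<dots> = (\<integral>x. of_real e * (u (0 + e * x) * of_real (sqrt (pi / s n) * exp (- (0 + e * x)\<^sup>2 / s n))) \<partial>lborel)"
        by (simp add: scaleR_conv_of_real)
      also have "\<dots> = (\<integral>x. u (e * x) * of_real (sqrt pi * exp (- x\<^sup>2)) \<partial>lborel)"
        using e by (intro Bochner_Integration.integral_cong) (auto simp: real_sqrt_divide power_mult_distrib)
      finally show ?thesis by (simp add: e_def)
    qed
    have int1: "integrable lborel (\<lambda>x. exp (- x\<^sup>2) :: real)"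
      using integrable_norm[OF gaussian_osc_integral(1)[of 1 0]] by (simp add: norm_mult)
    have val1: "(\<integral>x. complex_of_real (exp (- x\<^sup>2)) \<partial>lborel) = of_real (sqrt pi)"
      using gaussian_osc_integral(2)[of 1 0] by simp
    have "(\<lambda>n. \<integral>x. u (inverse (real (Suc n)) * x) * of_real (sqrt pi * exp (- x\<^sup>2)) \<partial>lborel)
       \<longlonglongrightarrow> (\<integral>x. u 0 * of_real (sqrt pi * exp (- x\<^sup>2)) \<partial>lborel)"
    proof (rule integral_dominated_convergence[where w="\<lambda>x. C * (sqrt pi * exp (- x\<^sup>2))"])
      show "integrable lborel (\<lambda>x. C * (sqrt pi * exp (- x\<^sup>2)))"
        using int1 by simp
      show "AE x in lborel. (\<lambda>n. u (inverse (real (Suc n)) * x) * of_real (sqrt pi * exp (- x\<^sup>2)))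
         \<longlonglongrightarrow> u 0 * of_real (sqrt pi * exp (- x\<^sup>2))"
      proof (rule always_eventually, rule allI)
        fix x :: real
        have "(\<lambda>n. inverse (real (Suc n)) * x) \<longlonglongrightarrow> 0 * x"
          by (intro tendsto_intros LIMSEQ_inverse_real_of_nat)
        then have "(\<lambda>n. u (inverse (real (Suc n)) * x)) \<longlonglongrightarrow> u 0"
          using cu by (auto simp: continuous_on_eq_continuous_at intro: isCont_tendsto_compose)
        then show "(\<lambda>n. u (inverse (real (Suc n)) * x) * of_real (sqrt pi * exp (- x\<^sup>2)))
         \<longlonglongrightarrow> u 0 * of_real (sqrt pi * exp (- x\<^sup>2))"
          by (intro tendsto_intros)
      qed
      have "norm (u y) \<le> C" for y
        using order_trans[OF bound(1) mult_left_le[OF cauchy_weight_le_1 C]] .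
      then show "AE x in lborel. norm (u (inverse (real (Suc n)) * x) * of_real (sqrt pi * exp (- x\<^sup>2)))
          \<le> C * (sqrt pi * exp (- x\<^sup>2))" for n
        by (auto simp: norm_mult intro!: mult_right_mono)
    qed auto
    also have "(\<integral>x. u 0 * of_real (sqrt pi * exp (- x\<^sup>2)) \<partial>lborel) = 
      u 0 * of_real (sqrt pi) * (\<integral>x. complex_of_real (exp (- x\<^sup>2)) \<partial>lborel)"
      by simp
    also have "\<dots> = of_real pi * u 0"
      unfolding val1 by (simp flip: of_real_mult)
    finally show ?thesis
      unfolding Jn .
  qed
  ultimately show "(\<integral>b. (\<integral>a. osc a b * u a \<partial>lborel) \<partial>lborel) = of_real pi * u 0"
    unfolding U_def by (rule LIMSEQ_unique)
qed

text \<open>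
  The function that dominates all kernels: \<open>a\<close> and \<open>b\<close> are the variables of a block, \<open>t\<close> is the
  parameter of Taylor's formula.
\<close>
definition slab_weight :: "real \<times> real \<times> real \<Rightarrow> real" where
  "slab_weight = (\<lambda>(a, b, t). cauchy_weight a * (cauchy_weight b * indicator {0..1} t))"

lemma slab_weight_nonneg [simp]: "slab_weight w \<ge> 0"
  by (auto simp: slab_weight_def split: prod.split)

lemma integrable_indicator_01: "integrable lborel (indicator {0..1::real} :: real \<Rightarrow> real)"
  by (simp add: integrable_indicator_iff)

lemma integrable_mult_pair:
  fixes g :: "'a::euclidean_space \<Rightarrow> real" and h :: "'b::euclidean_space \<Rightarrow> real"
  assumes "integrable lborel g" "integrable lborel h"
  shows "integrable lborel (\<lambda>(a, b). g a * h b)"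
proof -
  have "(\<lambda>(a, b). g a * h b) \<in> borel_measurable (lborel \<Otimes>\<^sub>M lborel)"
    using assms by measurable
  then have [measurable]: "(\<lambda>(a, b). g a * h b) \<in> borel_measurable borel"
    by (simp add: lborel_prod)
  have "(\<lambda>w. complex_of_real (case w of (a, b) \<Rightarrow> g a * h b)) \<in> borel_measurable borel"
    by measurable
  then have "(\<lambda>(a, b). complex_of_real (g a * h b)) \<in> borel_measurable borel"
    by (simp only: case_prod_unfold)
  then have "integrable lborel (\<lambda>(a, b). complex_of_real (g a * h b))"
    by (rule integrable_product_bound[where g="\<lambda>a. norm (g a)" and h="\<lambda>b. norm (h b)"])
       (use assms in \<open>auto simp: norm_mult\<close>)
  then have "integrable lborel (\<lambda>w. Re (case w of (a, b) \<Rightarrow> complex_of_real (g a * h b)))"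
    by (rule integrable_Re)
  then show ?thesis by (simp add: case_prod_unfold)
qed

lemma integrable_slab_weight: "integrable lborel slab_weight"
proof -
  have "integrable lborel (\<lambda>(a, p). cauchy_weight a * (case p of (b, t) \<Rightarrow> cauchy_weight b * indicator {0..1} (t::real)))"
    by (intro integrable_mult_pair integrable_cauchy_weight integrable_indicator_01)
  moreover have "slab_weight = (\<lambda>(a, p). cauchy_weight a * (case p of (b, t) \<Rightarrow> cauchy_weight b * indicator {0..1} t))"
    by (auto simp: slab_weight_def)
  ultimately show ?thesis by simp
qed

lemma integrable_slab_bound:
  fixes f :: "real \<times> real \<times> real \<Rightarrow> complex"
  assumes "f \<in> borel_measurable borel" "\<And>w. norm (f w) \<le> C * slab_weight w"
  shows "integrable lborel f"
proof (rule Bochner_Integration.integrable_bound)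
  show "integrable lborel (\<lambda>w. C * slab_weight w)"
    using integrable_slab_weight by simp
  show "AE w in lborel. norm (f w) \<le> norm (C * slab_weight w)"
    using order_trans[OF assms(2) abs_ge_self] by simp
qed (use assms(1) in simp)

text \<open>
  The two orders of integration that are needed: \<open>a\<close> innermost, where the first integration by
  parts takes place, and \<open>b\<close> innermost for the second one.
\<close>
lemma slab_fubini:
  fixes f :: "real \<times> real \<times> real \<Rightarrow> complex"
  assumes f: "f \<in> borel_measurable borel" and bound: "\<And>w. norm (f w) \<le> C * slab_weight w"
  shows "integrable lborel (\<lambda>b. \<integral>t. (\<integral>a. f (a, b, t) \<partial>lborel) \<partial>lborel)" (is ?I)
    and "integral\<^sup>L lborel f = (\<integral>b. (\<integral>t. (\<integral>a. f (a, b, t) \<partial>lborel) \<partial>lborel) \<partial>lborel)" (is ?A)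
    and "integral\<^sup>L lborel f = (\<integral>a. (\<integral>t. (\<integral>b. f (a, b, t) \<partial>lborel) \<partial>lborel) \<partial>lborel)" (is ?B)
proof -
  have int: "integrable (lborel \<Otimes>\<^sub>M lborel) f"
    using integrable_slab_bound[OF assms] by (simp add: lborel_prod)
  then have int': "integrable (lborel \<Otimes>\<^sub>M lborel) (case_prod (\<lambda>a p. f (a, p)))"
    by (simp add: case_prod_unfold)
  have int2: "integrable (lborel \<Otimes>\<^sub>M lborel) (\<lambda>p. \<integral>a. f (a, p) \<partial>lborel)"
    using lborel_pair.integrable_snd[OF int'] by (simp add: lborel_prod)
  then have int2': "integrable (lborel \<Otimes>\<^sub>M lborel) (case_prod (\<lambda>b t. \<integral>a. f (a, b, t) \<partial>lborel))"
    by (simp add: lborel_prod case_prod_unfold)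
  show ?I
    using lborel_pair.integrable_fst[OF int2'] .
  have "integral\<^sup>L lborel f = (\<integral>p. (\<integral>a. f (a, p) \<partial>lborel) \<partial>lborel)"
    using lborel_pair.integral_snd[OF int'] by (simp add: lborel_prod)
  also have "\<dots> = (\<integral>b. (\<integral>t. (\<integral>a. f (a, b, t) \<partial>lborel) \<partial>lborel) \<partial>lborel)"
    using lborel_pair.integral_fst[OF int2'] by (simp add: lborel_prod case_prod_unfold)
  finally show ?A .
  have "integral\<^sup>L lborel f = (\<integral>a. (\<integral>p. f (a, p) \<partial>lborel) \<partial>lborel)"
    using lborel_pair.integral_fst[OF int'] by (simp add: lborel_prod)
  also have "(\<lambda>a. \<integral>p. f (a, p) \<partial>lborel) = (\<lambda>a. \<integral>t. (\<integral>b. f (a, b, t) \<partial>lborel) \<partial>lborel)"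
  proof
    fix a
    have "integrable lborel (\<lambda>(b, t). f (a, b, t))"
    proof (rule integrable_product_bound[where g="\<lambda>b. C * cauchy_weight a * cauchy_weight b" and h="indicator {0..1}"])
      have "(\<lambda>p. f (a, p)) \<in> borel_measurable borel"
        using f by measurable
      then show "(\<lambda>(b, t). f (a, b, t)) \<in> borel_measurable borel"
        by (simp add: case_prod_unfold)
      show "norm (case (b, t) of (b, t) \<Rightarrow> f (a, b, t)) \<le> C * cauchy_weight a * cauchy_weight b * indicator {0..1} t" for b t
        using bound[of "(a, b, t)"] by (simp add: slab_weight_def mult_ac)
    qed (use integrable_cauchy_weight integrable_indicator_01 in auto)
    then have "integrable (lborel \<Otimes>\<^sub>M lborel) (case_prod (\<lambda>b t. f (a, b, t)))"
      by (simp add: lborel_prod)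
    from lborel_pair.integral_snd[OF this]
    show "(\<integral>p. f (a, p) \<partial>lborel) = (\<integral>t. (\<integral>b. f (a, b, t) \<partial>lborel) \<partial>lborel)"
      by (simp add: lborel_prod case_prod_unfold)
  qed
  finally show ?B .
qed

section \<open>Expansion of one block integral for decaying functions\<close>

text \<open>
  \<open>F i k\<close> is the derivative of \<open>F 0 0\<close> of order \<open>i\<close> in the first and \<open>k\<close> in the second variable.
  Decay in both variables makes the iterated integrals below absolutely convergent.
\<close>
locale decaying_family =
  fixes F :: "nat \<Rightarrow> nat \<Rightarrow> real \<Rightarrow> real \<Rightarrow> complex" and C :: real
  assumes cont: "i \<le> 3 \<Longrightarrow> k \<le> 3 \<Longrightarrow> continuous_on UNIV (\<lambda>(a, b). F i k a b)"
    and deriv_fst: "i < 3 \<Longrightarrow> k \<le> 3 \<Longrightarrow>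
      ((\<lambda>a. F i k a b) has_vector_derivative F (Suc i) k a b) (at a)"
    and deriv_snd: "i \<le> 3 \<Longrightarrow> k < 3 \<Longrightarrow>
      ((\<lambda>b. F i k a b) has_vector_derivative F i (Suc k) a b) (at b)"
    and bound: "i \<le> 3 \<Longrightarrow> k \<le> 3 \<Longrightarrow> norm (F i k a b) \<le> C * (cauchy_weight a * cauchy_weight b)"
begin

lemma C_nonneg: "C \<ge> 0"
  using order_trans[OF norm_ge_zero bound[of 0 0 0 0]] by simp

lemma continuous_compose:
  assumes "i \<le> 3" "k \<le> 3" "continuous_on S f" "continuous_on S g"
  shows "continuous_on S (\<lambda>x. F i k (f x) (g x))"
  using continuous_on_compose2[OF cont[OF assms(1,2)] continuous_on_Pair[OF assms(3,4)]] by simp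

lemma bound_fst: "i \<le> 3 \<Longrightarrow> k \<le> 3 \<Longrightarrow> norm (F i k a b) \<le> C * cauchy_weight a"
  using order_trans[OF bound mult_left_mono[OF mult_left_le[OF cauchy_weight_le_1]]] C_nonneg by simp

lemma bound_const: "i \<le> 3 \<Longrightarrow> k \<le> 3 \<Longrightarrow> norm (F i k a b) \<le> C"
  using order_trans[OF bound_fst mult_left_le[OF cauchy_weight_le_1]] C_nonneg by simp

lemma measurable_compose_family:
  fixes f g :: "'a::topological_space \<Rightarrow> real"
  assumes "i \<le> 3" "k \<le> 3" "continuous_on UNIV f" "continuous_on UNIV g"
  shows "(\<lambda>x. F i k (f x) (g x)) \<in> borel_measurable borel"
  by (intro borel_measurable_continuous_onI continuous_compose assms)

text \<open>
  Taylor's formula gives \<open>F(a, b) - F(a, 0) = \<integral>\<^sub>0\<^sup>1 b \<partial>\<^sub>b F(a, t b) dt\<close>, and the factor \<open>b\<close> is absorbed by an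
  integration by parts in \<open>a\<close>, because \<open>b e^(2 \<i> a b)\<close> is the derivative of \<open>e^(2 \<i> a b) / (2 \<i>)\<close>.
\<close>
lemma slice_identity:
  "(\<integral>a. osc a b * F 0 0 a b \<partial>lborel) = (\<integral>a. osc a b * F 0 0 a 0 \<partial>lborel) +
     \<i> / 2 * (\<integral>t. (\<integral>a. indicator {0..1} t * (osc a b * F 1 1 a (t * b)) \<partial>lborel) \<partial>lborel)"
proof -
  have int: "integrable lborel (\<lambda>a. osc a b * F 0 0 a y)" for y
    by (rule integrable_cauchy_bound[where C=C])
       (auto intro!: continuous_intros continuous_compose bound_fst simp: norm_mult)
  have ftc: "F 0 0 a b - F 0 0 a 0 = (\<integral>t. indicator {0..1} t *\<^sub>R (b *\<^sub>R F 0 1 a (t * b)) \<partial>lborel)" for a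
  proof -
    have "(\<integral>t. indicator {0..1} t *\<^sub>R (b *\<^sub>R F 0 1 a (t * b)) \<partial>lborel) = F 0 0 a (1 * b) - F 0 0 a (0 * b)"
    proof (rule integral_FTC_Icc)
      fix t :: real
      have "((\<lambda>y. F 0 0 a y) has_vector_derivative F 0 1 a (t * b)) (at (t * b))"
        using deriv_snd[of 0 0 a "t * b"] by simp
      then have "(((\<lambda>y. F 0 0 a y) \<circ> (\<lambda>t. t * b)) has_vector_derivative b *\<^sub>R F 0 1 a (t * b)) (at t)"
        by (intro vector_diff_chain_at) (auto intro!: derivative_eq_intros)
      then show "((\<lambda>t. F 0 0 a (t * b)) has_vector_derivative b *\<^sub>R F 0 1 a (t * b)) (at t within {0..1})"
        by (auto simp: comp_def intro: has_vector_derivative_at_within)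
    next
      show "continuous_on {0..1} (\<lambda>t. b *\<^sub>R F 0 1 a (t * b))"
        by (intro continuous_intros continuous_compose) auto
    qed simp
    then show ?thesis by simp
  qed
  have "(\<integral>a. osc a b * F 0 0 a b \<partial>lborel) - (\<integral>a. osc a b * F 0 0 a 0 \<partial>lborel) =
     (\<integral>a. osc a b * (F 0 0 a b - F 0 0 a 0) \<partial>lborel)"
    using int by (simp add: right_diff_distrib)
  also have "\<dots> = (\<integral>a. (\<integral>t. osc a b * (indicator {0..1} t *\<^sub>R (b *\<^sub>R F 0 1 a (t * b))) \<partial>lborel) \<partial>lborel)"
    by (simp only: ftc integral_mult_right_zero)
  also have "\<dots> = (\<integral>t. (\<integral>a. osc a b * (indicator {0..1} t *\<^sub>R (b *\<^sub>R F 0 1 a (t * b))) \<partial>lborel) \<partial>lborel)"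
  proof (rule lborel_pair.Fubini_integral)
    have "integrable lborel (\<lambda>(t, a). osc a b * (indicator {0..1} t *\<^sub>R (b *\<^sub>R F 0 1 a (t * b))))"
    proof (rule integrable_product_bound[where g="indicator {0..1}" and h="\<lambda>a. \<bar>b\<bar> * C * cauchy_weight a"])
      have "(\<lambda>p::real \<times> real. F 0 1 (snd p) (fst p * b)) \<in> borel_measurable borel"
        by (intro measurable_compose_family continuous_intros) auto
      note [measurable] = this[folded borel_prod]
      show "(\<lambda>(t, a). osc a b * (indicator {0..1} t *\<^sub>R (b *\<^sub>R F 0 1 a (t * b)))) \<in> borel_measurable borel"
        unfolding case_prod_unfold borel_prod[symmetric] by measurable
      show "norm (case (t, a) of (t, a) \<Rightarrow> osc a b * (indicator {0..1} t *\<^sub>R (b *\<^sub>R F 0 1 a (t * b))))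
         \<le> indicator {0..1} t * (\<bar>b\<bar> * C * cauchy_weight a)" for t a
        using bound_fst[of 0 1 a "t * b"] 
        by (auto simp: norm_mult indicator_def mult.assoc intro!: mult_left_mono)
    qed (use integrable_cauchy_weight integrable_indicator_01 in auto)
    then show "integrable (lborel \<Otimes>\<^sub>M lborel) (\<lambda>(t, a). osc a b * (indicator {0..1} t *\<^sub>R (b *\<^sub>R F 0 1 a (t * b))))"
      by (simp add: lborel_prod)
  qed
  also have "\<dots> = (\<integral>t. \<i> / 2 * (\<integral>a. indicator {0..1} t * (osc a b * F 1 1 a (t * b)) \<partial>lborel) \<partial>lborel)"
  proof (rule Bochner_Integration.integral_cong)
    fix t :: real
    have "2 * \<i> * of_real b * (\<integral>a. osc a b * F 0 1 a (t * b) \<partial>lborel) = 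
       - (\<integral>a. osc a b * F 1 1 a (t * b) \<partial>lborel)"
      using deriv_fst[of 0 1] bound_fst[of 0 1] bound_fst[of 1 1]
      by (intro osc_integral_derivative[where C=C] continuous_compose continuous_intros) auto
    then have "- \<i> / 2 * (2 * \<i> * of_real b * (\<integral>a. osc a b * F 0 1 a (t * b) \<partial>lborel)) =
       - \<i> / 2 * - (\<integral>a. osc a b * F 1 1 a (t * b) \<partial>lborel)"
      by (rule arg_cong)
    then have "of_real b * (\<integral>a. osc a b * F 0 1 a (t * b) \<partial>lborel) = 
       \<i> / 2 * (\<integral>a. osc a b * F 1 1 a (t * b) \<partial>lborel)"
      by (simp add: mult.assoc[symmetric])
    then have "of_real (indicator {0..1} t) * (of_real b * (\<integral>a. osc a b * F 0 1 a (t * b) \<partial>lborel)) = 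
       of_real (indicator {0..1} t) * (\<i> / 2 * (\<integral>a. osc a b * F 1 1 a (t * b) \<partial>lborel))"
      by (rule arg_cong)
    moreover have "(\<integral>a. osc a b * (indicator {0..1} t *\<^sub>R (b *\<^sub>R F 0 1 a (t * b))) \<partial>lborel) =
      (\<integral>a. of_real (indicator {0..1} t) * (of_real b * (osc a b * F 0 1 a (t * b))) \<partial>lborel)"
      by (simp only: scaleR_conv_of_real mult.left_commute[of "osc _ _"])
    moreover have "(\<integral>a. indicator {0..1} t * (osc a b * F 1 1 a (t * b)) \<partial>lborel) =
      of_real (indicator {0..1} t) * (\<integral>a. osc a b * F 1 1 a (t * b) \<partial>lborel)"
      by (simp add: indicator_def)
    ultimately show "(\<integral>a. osc a b * (indicator {0..1} t *\<^sub>R (b *\<^sub>R F 0 1 a (t * b))) \<partial>lborel) = 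
      \<i> / 2 * (\<integral>a. indicator {0..1} t * (osc a b * F 1 1 a (t * b)) \<partial>lborel)"
      by (simp only: integral_mult_right_zero mult.left_commute)
  qed simp
  finally show ?thesis
    by (simp only: integral_mult_right_zero diff_eq_eq add.commute)
qed

end

text \<open>
  The coefficient of \<open>F i\<close> in \<open>(1 - \<partial>\<^sub>a)\<^sup>2 F 1\<close>, for \<open>i\<close> from 1 to 3.
\<close>
definition fst_coeff :: "nat \<Rightarrow> complex" where
  "fst_coeff i = (if i = 2 then - 2 else 1)"

text \<open>
  For \<open>k\<close> from 1 to 3, the coefficient of \<open>g k (t b)\<close> in \<open>(1 - \<partial>\<^sub>b)\<^sup>2 (parts_factor b ^ 2 * g 1 (t b))\<close>,
  where \<open>g (k + 1)\<close> is the derivative of \<open>g k\<close>.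
\<close>
definition snd_coeff :: "nat \<Rightarrow> real \<Rightarrow> real \<Rightarrow> complex" where
  "snd_coeff k b t = (if k = 1 then parts_factor b ^ 2 + 8 * \<i> * parts_factor b ^ 3 - 24 * parts_factor b ^ 4
     else if k = 2 then of_real t * (- 2 * parts_factor b ^ 2 - 8 * \<i> * parts_factor b ^ 3)
     else of_real t ^ 2 * parts_factor b ^ 2)"

text \<open>
  The kernel against which \<open>F i k (a, t b)\<close> is integrated in the remainder. The integration by parts
  in \<open>b\<close> produces \<open>parts_factor a ^ 2\<close>, the one in \<open>a\<close> the powers of \<open>parts_factor b\<close> inside
  \<open>snd_coeff\<close>.
\<close>
definition remainder_kernel :: "nat \<Rightarrow> nat \<Rightarrow> real \<times> real \<times> real \<Rightarrow> complex" where
  "remainder_kernel i k = (\<lambda>(a, b, t). indicator {0..1} t * (\<i> / (2 * of_real pi) * osc a b * parts_factor a ^ 2 * fst_coeff i * snd_coeff k b t))"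

lemma norm_parts_factor_power: "norm (parts_factor b ^ Suc (Suc n)) \<le> cauchy_weight b"
proof -
  have "norm (parts_factor b ^ Suc (Suc n)) = norm (parts_factor b) ^ 2 * norm (parts_factor b) ^ n"
    by (simp add: norm_power norm_mult power2_eq_square)
  also have "\<dots> \<le> cauchy_weight b * 1"
    by (intro mult_mono norm_parts_factor_sq power_le_one norm_parts_factor_le_1) auto
  finally show ?thesis by simp
qed

lemma norm_snd_coeff:
  assumes "0 \<le> t" "t \<le> 1"
  shows "norm (snd_coeff k b t) \<le> 33 * cauchy_weight b"
proof -
  \<comment> \<open>the constant is \<open>33 = 1 + 8 + 24\<close>\<close>
  have z: "norm (parts_factor b ^ 2) \<le> cauchy_weight b" "norm (parts_factor b ^ 3) \<le> cauchy_weight b" "norm (parts_factor b ^ 4) \<le> cauchy_weight b"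
    using norm_parts_factor_power[of b 0] norm_parts_factor_power[of b 1] norm_parts_factor_power[of b 2]
    by (simp_all add: numeral_eq_Suc)
  have t: "norm (complex_of_real t * z) \<le> norm z" for z
    using assms by (simp add: norm_mult mult_left_le_one_le)
  have a1: "norm (parts_factor b ^ 2 + 8 * \<i> * parts_factor b ^ 3 - 24 * parts_factor b ^ 4) \<le> 33 * cauchy_weight b"
    using norm_triangle_ineq4[of "parts_factor b ^ 2 + 8 * \<i> * parts_factor b ^ 3" "24 * parts_factor b ^ 4"]
      norm_triangle_ineq[of "parts_factor b ^ 2" "8 * \<i> * parts_factor b ^ 3"] z
    by (simp add: norm_mult)
  have a2: "norm (- 2 * parts_factor b ^ 2 - 8 * \<i> * parts_factor b ^ 3) \<le> 33 * cauchy_weight b"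
    using norm_triangle_ineq4[of "- 2 * parts_factor b ^ 2" "8 * \<i> * parts_factor b ^ 3"] z
      cauchy_weight_nonneg[of b]
    unfolding norm_mult by (simp del: cauchy_weight_nonneg)
  have a3: "norm (complex_of_real t * (of_real t * parts_factor b ^ 2)) \<le> 33 * cauchy_weight b"
    using order_trans[OF t t, of "parts_factor b ^ 2"] z(1) cauchy_weight_nonneg[of b] by linarith
  show ?thesis
    using a1 order_trans[OF t a2] a3
    by (auto simp: snd_coeff_def power2_eq_square mult.assoc)
qed

lemma norm_remainder_kernel: "norm (remainder_kernel i k w) \<le> 33 * slab_weight w"
proof -
  obtain a b t where w: "w = (a, b, t)" by (cases w) auto
  show ?thesis
  proof (cases "t \<in> {0..1}")
    case True
    have "norm (remainder_kernel i k w) = (1 / (2 * pi)) * norm (fst_coeff i) * (norm (parts_factor a ^ 2) * norm (snd_coeff k b t))"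
      using True by (simp add: remainder_kernel_def w norm_mult norm_divide)
    also have "\<dots> \<le> 1 * (cauchy_weight a * (33 * cauchy_weight b))"
    proof (intro mult_mono)
      have "norm (fst_coeff i) \<le> 2 * pi"
        using pi_gt3 by (auto simp: fst_coeff_def)
      then show "1 / (2 * pi) * norm (fst_coeff i) \<le> 1"
        by (simp add: field_simps)
      show "norm (parts_factor a ^ 2) \<le> cauchy_weight a"
        using norm_parts_factor_sq by (simp add: norm_power)
    qed (use norm_snd_coeff True in auto)
    finally show ?thesis
      using True by (simp add: slab_weight_def w)
  qed (simp add: remainder_kernel_def w slab_weight_def)
qed

lemma measurable_remainder_kernel [measurable]: "remainder_kernel i k \<in> borel_measurable borel"
  unfolding remainder_kernel_def fst_coeff_def snd_coeff_def case_prod_unfold borel_prod[symmetric] by measurable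

lemma sum_1_to_3: "(\<Sum>i\<in>{1..3::nat}. f i) = f 1 + f 2 + (f 3 :: complex)"
  by (simp add: numeral_eq_Suc)

context decaying_family
begin

text \<open>
  \<open>G k = (1 - \<partial>\<^sub>a)\<^sup>2 F 1 k\<close>, what the integration by parts in \<open>a\<close> makes of \<open>F 1 k\<close>.
\<close>
definition G :: "nat \<Rightarrow> real \<Rightarrow> real \<Rightarrow> complex" where
  "G k a b = F 1 k a b - 2 * F 2 k a b + F 3 k a b"

lemma G_eq: "G k a b = (\<Sum>i\<in>{1..3}. fst_coeff i * F i k a b)"
  unfolding sum_1_to_3 by (simp add: fst_coeff_def G_def)

lemma norm_G_le: assumes "k \<le> 3" shows "norm (G k a b) \<le> 4 * C * cauchy_weight a"
  using norm_triangle_ineq[of "F 1 k a b - 2 * F 2 k a b" "F 3 k a b"]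
     norm_triangle_ineq4[of "F 1 k a b" "2 * F 2 k a b"]
     bound_fst[of 1 k a b] bound_fst[of 2 k a b] bound_fst[of 3 k a b] assms
  by (simp add: G_def norm_mult)

lemma norm_G_const: assumes "k \<le> 3" shows "norm (G k a b) \<le> 4 * C"
  using order_trans[OF norm_G_le mult_left_le[OF cauchy_weight_le_1]] C_nonneg assms by simp

lemma continuous_G:
  assumes "k \<le> 3" "continuous_on S f" "continuous_on S g"
  shows "continuous_on S (\<lambda>x. G k (f x) (g x))"
  unfolding G_def by (intro continuous_intros continuous_compose assms) auto

lemma fst_parts:
  "(\<integral>a. osc a b * F 1 1 a y \<partial>lborel) = parts_factor b ^ 2 * (\<integral>a. osc a b * G 1 a y \<partial>lborel)"
  unfolding G_def
  using deriv_fst[of 1 1] deriv_fst[of 2 1] bound_fst[of 1 1] bound_fst[of 2 1] bound_fst[of 3 1]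
  by (intro osc_integral_by_parts2[where C=C] continuous_compose continuous_intros)
     (auto simp: numeral_eq_Suc)

lemma deriv_G:
  assumes "k < 3"
  shows "((\<lambda>b. G k a (t * b)) has_vector_derivative of_real t * G (Suc k) a (t * b)) (at b)"
proof -
  have "((\<lambda>y. G k a y) has_vector_derivative G (Suc k) a (t * b)) (at (t * b))"
    unfolding G_def using assms
    by (intro derivative_intros has_vector_derivative_mult_right deriv_snd) auto
  then have "((\<lambda>y. G k a y) \<circ> (\<lambda>b. t * b) has_vector_derivative t *\<^sub>R G (Suc k) a (t * b)) (at b)"
    by (intro vector_diff_chain_at) (auto intro!: derivative_eq_intros)
  then show ?thesis
    by (simp add: comp_def scaleR_conv_of_real)
qed

lemma parts_factor_power_deriv: "((\<lambda>b. parts_factor b ^ Suc n) has_vector_derivative - 2 * \<i> * of_nat (Suc n) * parts_factor b ^ (n + 2)) (at b)"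
proof (induction n)
  case 0
  show ?case using parts_factor_deriv[of b] by (simp add: power2_eq_square)
next
  case (Suc n)
  have "((\<lambda>b. parts_factor b * parts_factor b ^ Suc n) has_vector_derivative 
     parts_factor b * (- 2 * \<i> * of_nat (Suc n) * parts_factor b ^ (n + 2)) + (- 2 * \<i> * parts_factor b ^ 2) * parts_factor b ^ Suc n) (at b)"
    by (rule has_vector_derivative_mult[OF parts_factor_deriv Suc])
  then show ?case by (simp add: algebra_simps power2_eq_square)
qed

text \<open>
  The decay of \<open>G\<close> in its second argument \<open>t b\<close> is lost as \<open>t\<close> tends to 0. The decay in \<open>b\<close> that
  permits an integration by parts uniformly in \<open>t\<close> is that of the factor \<open>parts_factor b ^ 2\<close>, which
  comes from the integration by parts in \<open>a\<close>.
\<close>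
lemma snd_parts:
  assumes t: "0 \<le> t" "t \<le> 1"
  shows "(\<integral>b. osc a b * (parts_factor b ^ 2 * G 1 a (t * b)) \<partial>lborel) =
    parts_factor a ^ 2 * (\<integral>b. osc a b * (\<Sum>k\<in>{1..3}. snd_coeff k b t * G k a (t * b)) \<partial>lborel)"
proof -
  \<comment> \<open>the amplitude and its first two derivatives, each at most \<open>33 * 4 C = 132 C\<close> times the weight\<close>
  define y where "y = (\<lambda>b. parts_factor b ^ 2 * G 1 a (t * b))"
  define y' where "y' = (\<lambda>b. - 4 * \<i> * parts_factor b ^ 3 * G 1 a (t * b) + parts_factor b ^ 2 * (of_real t * G 2 a (t * b)))"
  define y'' where "y'' = (\<lambda>b. - 24 * parts_factor b ^ 4 * G 1 a (t * b) - 8 * \<i> * parts_factor b ^ 3 * (of_real t * G 2 a (t * b))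
     + parts_factor b ^ 2 * (of_real t * (of_real t * G 3 a (t * b))))"
  have d2: "((\<lambda>b. parts_factor b ^ 2) has_vector_derivative - 4 * \<i> * parts_factor b ^ 3) (at b)" for b
    using parts_factor_power_deriv[of 1 b] by (simp add: numeral_eq_Suc)
  have d3: "((\<lambda>b. - 4 * \<i> * parts_factor b ^ 3) has_vector_derivative - 24 * parts_factor b ^ 4) (at b)" for b
    using has_vector_derivative_mult_right[OF parts_factor_power_deriv[of 2 b], of "- 4 * \<i>"]
    by (simp add: numeral_eq_Suc mult.assoc)
  have g1: "((\<lambda>b. G 1 a (t * b)) has_vector_derivative of_real t * G 2 a (t * b)) (at b)" for b
    using deriv_G[of 1 a t b] by (simp add: numeral_eq_Suc)
  have g2: "((\<lambda>b. of_real t * G 2 a (t * b)) has_vector_derivative of_real t * (of_real t * G 3 a (t * b))) (at b)" for b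
    using has_vector_derivative_mult_right[OF deriv_G[of 2 a t b], of "of_real t"] by (simp add: numeral_eq_Suc)
  have y: "(y has_vector_derivative y' b) (at b)" for b
    unfolding y_def y'_def
    using has_vector_derivative_mult[OF d2 g1, of b] by (simp add: algebra_simps)
  have y': "(y' has_vector_derivative y'' b) (at b)" for b
    unfolding y'_def y''_def
    using has_vector_derivative_add[OF has_vector_derivative_mult[OF d3 g1] has_vector_derivative_mult[OF d2 g2], of b]
    by (simp add: algebra_simps)
  have cy'': "continuous_on UNIV y''"
    unfolding y''_def by (intro continuous_intros continuous_G) auto
  have z: "norm (parts_factor b ^ 2) \<le> cauchy_weight b" "norm (parts_factor b ^ 3) \<le> cauchy_weight b" "norm (parts_factor b ^ 4) \<le> cauchy_weight b" for b
    using norm_parts_factor_power[of b 0] norm_parts_factor_power[of b 1] norm_parts_factor_power[of b 2]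
    by (simp_all add: numeral_eq_Suc)
  have tm: "norm (complex_of_real t * x) \<le> norm x" for x
    using t by (simp add: norm_mult mult_left_le_one_le)
  have g: "norm (G 1 a (t * b)) \<le> 4 * C" "norm (of_real t * G 2 a (t * b)) \<le> 4 * C"
    "norm (of_real t * (of_real t * G 3 a (t * b))) \<le> 4 * C" for b
    using norm_G_const[of 1] order_trans[OF tm norm_G_const[of 2]] 
      order_trans[OF tm order_trans[OF tm norm_G_const[of 3]]] by auto
  have pb: "norm (u * v) \<le> cauchy_weight b * (4 * C)" if "norm u \<le> cauchy_weight b" "norm v \<le> 4 * C" for u v :: complex and b
    unfolding norm_mult using that by (intro mult_mono) auto
  have p: "norm (parts_factor b ^ 2 * G 1 a (t * b)) \<le> cauchy_weight b * (4 * C)"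
     "norm (parts_factor b ^ 2 * (of_real t * G 2 a (t * b))) \<le> cauchy_weight b * (4 * C)"
     "norm (parts_factor b ^ 2 * (of_real t * (of_real t * G 3 a (t * b)))) \<le> cauchy_weight b * (4 * C)"
     "norm (parts_factor b ^ 3 * G 1 a (t * b)) \<le> cauchy_weight b * (4 * C)"
     "norm (parts_factor b ^ 3 * (of_real t * G 2 a (t * b))) \<le> cauchy_weight b * (4 * C)"
     "norm (parts_factor b ^ 4 * G 1 a (t * b)) \<le> cauchy_weight b * (4 * C)" for b
    by (intro pb z g)+
  have Cw: "0 \<le> C * cauchy_weight b" for b
    using C_nonneg by simp
  have "norm (y b) \<le> (132 * C) * cauchy_weight b" for b
    using p(1)[of b] Cw[of b] unfolding y_def by (simp only: mult_ac)
  moreover have "norm (y' b) \<le> (132 * C) * cauchy_weight b" for b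
    using norm_triangle_ineq[of "- 4 * \<i> * (parts_factor b ^ 3 * G 1 a (t * b))" "parts_factor b ^ 2 * (of_real t * G 2 a (t * b))"]
      p[of b] Cw[of b]
    unfolding y'_def norm_mult[of "- 4 * \<i>"] by (simp add: mult.assoc mult.commute[of "cauchy_weight b"])
  moreover have "norm (y'' b) \<le> (132 * C) * cauchy_weight b" for b
    using norm_triangle_ineq[of "- 24 * (parts_factor b ^ 4 * G 1 a (t * b)) - 8 * \<i> * (parts_factor b ^ 3 * (of_real t * G 2 a (t * b)))"
        "parts_factor b ^ 2 * (of_real t * (of_real t * G 3 a (t * b)))"]
      norm_triangle_ineq4[of "- 24 * (parts_factor b ^ 4 * G 1 a (t * b))" "8 * \<i> * (parts_factor b ^ 3 * (of_real t * G 2 a (t * b)))"]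
      p[of b] Cw[of b]
    unfolding y''_def norm_mult[of "- 24"] norm_mult[of "8 * \<i>"] by (simp add: mult.assoc mult.commute[of "cauchy_weight b"])
  ultimately have "(\<integral>b. osc b a * y b \<partial>lborel) =
    parts_factor a ^ 2 * (\<integral>b. osc b a * (y b - 2 * y' b + y'' b) \<partial>lborel)"
    by (intro osc_integral_by_parts2[where C="132 * C"] y y' cy'')
  moreover have "y b - 2 * y' b + y'' b = (\<Sum>k\<in>{1..3}. snd_coeff k b t * G k a (t * b))" for b
    unfolding sum_1_to_3 by (simp add: snd_coeff_def y_def y'_def y''_def algebra_simps power2_eq_square)
  ultimately show ?thesis
    by (simp add: osc_commute[of a] y_def)
qed

text \<open>
  The slice identity splits the integral. Its first part is Fourier inversion for \<open>F(\<cdot>, 0)\<close>. In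
  the second part the integration by parts in \<open>a\<close> comes first: only after it is the integral over
  \<open>(a, b, t)\<close> absolutely convergent, so that the order of integration can be changed and the
  integration by parts in \<open>b\<close> done for fixed \<open>a\<close> and \<open>t\<close>.
\<close>
theorem decaying_osc_expansion:
  "integrable lborel (\<lambda>(a, b). osc a b * F 0 0 a b)"
  "(\<integral>w. (case w of (a, b) \<Rightarrow> osc a b * F 0 0 a b) \<partial>lborel) / of_real pi = F 0 0 0 0 +
     (\<Sum>i\<in>{1..3}. \<Sum>k\<in>{1..3}. \<integral>w. remainder_kernel i k w * F i k (fst w) (snd (snd w) * fst (snd w)) \<partial>lborel)"
proof -
  have mF: "(\<lambda>p::real \<times> real. F i k (fst p) (snd p)) \<in> borel_measurable borel" if "i \<le> 3" "k \<le> 3" for i k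
    using that by (intro measurable_compose_family continuous_intros)
  have mF3: "(\<lambda>p::real \<times> real \<times> real. F i k (fst p) (snd (snd p) * fst (snd p))) \<in> borel_measurable borel" if "i \<le> 3" "k \<le> 3" for i k
    using that by (intro measurable_compose_family continuous_intros)
  have mG3: "(\<lambda>p::real \<times> real \<times> real. G k (fst p) (snd (snd p) * fst (snd p))) \<in> borel_measurable borel" if "k \<le> 3" for k
    using that by (intro borel_measurable_continuous_onI continuous_G continuous_intros)
  have mF00: "(\<lambda>p::real \<times> real. F 0 0 (fst p) (snd p)) \<in> borel_measurable borel"
    by (rule mF) auto
  have mG1: "(\<lambda>p::real \<times> real \<times> real. G 1 (fst p) (snd (snd p) * fst (snd p))) \<in> borel_measurable borel"
    by (rule mG3) auto
  note [measurable] = mF00[folded borel_prod] mG1[folded borel_prod]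
  show int: "integrable lborel (\<lambda>(a, b). osc a b * F 0 0 a b)"
  proof (rule integrable_product_bound[where g="\<lambda>a. C * cauchy_weight a" and h=cauchy_weight])
    show "(\<lambda>(a, b). osc a b * F 0 0 a b) \<in> borel_measurable borel"
      unfolding case_prod_unfold borel_prod[symmetric] by measurable
  qed (use integrable_cauchy_weight bound in \<open>auto simp: norm_mult mult_ac\<close>)
  define f where "f = (\<lambda>(a, b, t). indicator {0..1} t * (osc a b * (parts_factor b ^ 2 * G 1 a (t * b))))"
  have mf: "f \<in> borel_measurable borel"
    unfolding f_def case_prod_unfold borel_prod[symmetric] by measurable
  have bf: "norm (f w) \<le> (4 * C) * slab_weight w" for w
  proof -
    obtain a b t where w: "w = (a, b, t)" by (cases w) auto
    have "norm (parts_factor b ^ 2 * G 1 a (t * b)) \<le> cauchy_weight b * (4 * C * cauchy_weight a)"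
      unfolding norm_mult norm_power by (intro mult_mono norm_parts_factor_sq norm_G_le) auto
    then show ?thesis
      by (auto simp: f_def w slab_weight_def norm_mult indicator_def mult_ac)
  qed
  have inv: "integrable lborel (\<lambda>b. \<integral>a. osc a b * F 0 0 a 0 \<partial>lborel)"
      "(\<integral>b. (\<integral>a. osc a b * F 0 0 a 0 \<partial>lborel) \<partial>lborel) = of_real pi * F 0 0 0 0"
  proof -
    have "((\<lambda>a. F 0 0 a 0) has_vector_derivative F 1 0 a 0) (at a)"
      "((\<lambda>a. F 1 0 a 0) has_vector_derivative F 2 0 a 0) (at a)" for a
      using deriv_fst[of 0 0 0 a] deriv_fst[of 1 0 0 a] by (simp_all add: numeral_eq_Suc)
    moreover have "continuous_on UNIV (\<lambda>a. F 2 0 a 0)"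
      by (intro continuous_compose continuous_intros) auto
    moreover have "norm (F 0 0 a 0) \<le> C * cauchy_weight a" "norm (F 1 0 a 0) \<le> C * cauchy_weight a"
      "norm (F 2 0 a 0) \<le> C * cauchy_weight a" for a
      by (intro bound_fst; simp)+
    ultimately show "integrable lborel (\<lambda>b. \<integral>a. osc a b * F 0 0 a 0 \<partial>lborel)"
      "(\<integral>b. (\<integral>a. osc a b * F 0 0 a 0 \<partial>lborel) \<partial>lborel) = of_real pi * F 0 0 0 0"
      by (fact fourier_inversion_osc)+
  qed
  have "(\<integral>w. (case w of (a, b) \<Rightarrow> osc a b * F 0 0 a b) \<partial>lborel) = 
      (\<integral>b. (\<integral>a. osc a b * F 0 0 a b \<partial>lborel) \<partial>lborel)"
    using int lborel_pair.integral_snd[of "\<lambda>a b. osc a b * F 0 0 a b"] by (simp add: lborel_prod)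
  also have "\<dots> = (\<integral>b. (\<integral>a. osc a b * F 0 0 a 0 \<partial>lborel) +
       \<i> / 2 * (\<integral>t. (\<integral>a. f (a, b, t) \<partial>lborel) \<partial>lborel) \<partial>lborel)"
  proof -
    have "(\<integral>a. indicator {0..1} t * (osc a b * F 1 1 a (t * b)) \<partial>lborel) = (\<integral>a. f (a, b, t) \<partial>lborel)" for b t
    proof -
      have "(\<integral>a. f (a, b, t) \<partial>lborel) = (\<integral>a. indicator {0..1} t * (parts_factor b ^ 2 * (osc a b * G 1 a (t * b))) \<partial>lborel)"
        by (simp only: f_def prod.case mult.left_commute[of "osc _ _"])
      then show ?thesis
        by (simp only: integral_mult_right_zero fst_parts)
    qed
    then show ?thesis
      by (simp only: slice_identity)
  qed
  also have "\<dots> = (\<integral>b. (\<integral>a. osc a b * F 0 0 a 0 \<partial>lborel) \<partial>lborel) +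
     \<i> / 2 * (\<integral>b. (\<integral>t. (\<integral>a. f (a, b, t) \<partial>lborel) \<partial>lborel) \<partial>lborel)"
    using inv(1) slab_fubini(1)[OF mf bf]
    by (subst Bochner_Integration.integral_add) auto
  also have "\<dots> = of_real pi * F 0 0 0 0 + \<i> / 2 * integral\<^sup>L lborel f"
    using inv(2) slab_fubini(2)[OF mf bf] by simp
  also have "\<i> / 2 * integral\<^sup>L lborel f = of_real pi * 
     (\<Sum>i\<in>{1..3}. \<Sum>k\<in>{1..3}. \<integral>w. remainder_kernel i k w * F i k (fst w) (snd (snd w) * fst (snd w)) \<partial>lborel)"
  proof -
    define g where "g = (\<lambda>w. \<Sum>i\<in>{1..3}. \<Sum>k\<in>{1..3}. remainder_kernel i k w * F i k (fst w) (snd (snd w) * fst (snd w)))"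
    have bt: "norm (remainder_kernel i k w * F i k (fst w) (snd (snd w) * fst (snd w))) \<le> (33 * C) * slab_weight w"
      if "i \<le> 3" "k \<le> 3" for i k w
    proof -
      have "norm (remainder_kernel i k w * F i k (fst w) (snd (snd w) * fst (snd w))) \<le> 33 * slab_weight w * C"
        unfolding norm_mult using that by (intro mult_mono norm_remainder_kernel bound_const) auto
      then show ?thesis by (simp add: mult_ac)
    qed
    have mt: "(\<lambda>w. remainder_kernel i k w * F i k (fst w) (snd (snd w) * fst (snd w))) \<in> borel_measurable borel"
      if "i \<le> 3" "k \<le> 3" for i k
      using mF3[OF that] by measurable
    have it: "integrable lborel (\<lambda>w. remainder_kernel i k w * F i k (fst w) (snd (snd w) * fst (snd w)))"
      if "i \<in> {1..3}" "k \<in> {1..3}" for i k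
      using that by (intro integrable_slab_bound[OF mt bt]) auto
    have mg: "g \<in> borel_measurable borel"
      unfolding g_def by (intro borel_measurable_sum mt) auto
    have bg: "norm (g w) \<le> (297 * C) * slab_weight w" for w
    proof -
      have "norm (g w) \<le> (\<Sum>i\<in>{1..3::nat}. \<Sum>k\<in>{1..3::nat}. (33 * C) * slab_weight w)"
        unfolding g_def by (intro sum_norm_le bt) auto
      then show ?thesis by simp
    qed
    have sg: "integral\<^sup>L lborel g = (\<Sum>i\<in>{1..3}. \<Sum>k\<in>{1..3}. \<integral>w. remainder_kernel i k w * F i k (fst w) (snd (snd w) * fst (snd w)) \<partial>lborel)"
      unfolding g_def
      by (subst Bochner_Integration.integral_sum,
          (intro Bochner_Integration.integrable_sum it; assumption),
          intro sum.cong refl Bochner_Integration.integral_sum it; assumption)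
    have "\<i> / 2 * (\<integral>b. f (a, b, t) \<partial>lborel) = of_real pi * (\<integral>b. g (a, b, t) \<partial>lborel)" for a t
    proof (cases "t \<in> {0..1}")
      case True
      have "g (a, b, t) = \<i> / (2 * of_real pi) * parts_factor a ^ 2 * (osc a b * (\<Sum>k\<in>{1..3}. snd_coeff k b t * G k a (t * b)))" for b
      proof -
        have "(\<Sum>k\<in>{1..3}. snd_coeff k b t * G k a (t * b)) = (\<Sum>i\<in>{1..3}. \<Sum>k\<in>{1..3}. snd_coeff k b t * (fst_coeff i * F i k a (t * b)))"
          unfolding G_eq sum_distrib_left by (rule sum.swap)
        then show ?thesis
          using True by (simp add: g_def remainder_kernel_def sum_distrib_left mult_ac)
      qed
      then have "of_real pi * (\<integral>b. g (a, b, t) \<partial>lborel) = of_real pi * (\<i> / (2 * of_real pi) * 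
          (parts_factor a ^ 2 * (\<integral>b. osc a b * (\<Sum>k\<in>{1..3}. snd_coeff k b t * G k a (t * b)) \<partial>lborel)))"
        by (simp add: mult.assoc)
      also have "\<dots> = \<i> / 2 * (\<integral>b. osc a b * (parts_factor b ^ 2 * G 1 a (t * b)) \<partial>lborel)"
        using True by (subst snd_parts) auto
      finally show ?thesis using True by (simp add: f_def)
    next
      case False
      then show ?thesis by (simp add: f_def g_def remainder_kernel_def)
    qed
    then have "(\<integral>a. (\<integral>t. \<i> / 2 * (\<integral>b. f (a, b, t) \<partial>lborel) \<partial>lborel) \<partial>lborel) = 
       (\<integral>a. (\<integral>t. of_real pi * (\<integral>b. g (a, b, t) \<partial>lborel) \<partial>lborel) \<partial>lborel)"
      by simp
    then show ?thesis
      using slab_fubini(3)[OF mf bf] slab_fubini(3)[OF mg bg] sg by simp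
  qed
  finally show "(\<integral>w. (case w of (a, b) \<Rightarrow> osc a b * F 0 0 a b) \<partial>lborel) / of_real pi = F 0 0 0 0 +
     (\<Sum>i\<in>{1..3}. \<Sum>k\<in>{1..3}. \<integral>w. remainder_kernel i k w * F i k (fst w) (snd (snd w) * fst (snd w)) \<partial>lborel)"
    by (simp add: field_simps)
qed

end

section \<open>Gaussian damping of bounded functions\<close>

text \<open>
  For \<open>j \<le> 3\<close> the derivative of order \<open>j\<close> of \<open>exp (- s x\<^sup>2)\<close>; larger values of \<open>j\<close> repeat the third
  derivative.
\<close>
definition gauss_deriv :: "real \<Rightarrow> nat \<Rightarrow> real \<Rightarrow> real" where
  "gauss_deriv s j x = exp (- s * x\<^sup>2) *
     (if j = 0 then 1 else if j = 1 then - 2 * s * x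
      else if j = 2 then 4 * s\<^sup>2 * x\<^sup>2 - 2 * s else 12 * s\<^sup>2 * x - 8 * s ^ 3 * x ^ 3)"

lemma gauss_deriv_simps:
  "gauss_deriv s 0 x = exp (- s * x\<^sup>2)"
  "gauss_deriv 0 j x = (if j = 0 then 1 else 0)"
  by (auto simp: gauss_deriv_def)

lemma gauss_deriv_Suc:
  assumes "j < 3"
  shows "(gauss_deriv s j has_real_derivative gauss_deriv s (Suc j) x) (at x)"
proof -
  consider "j = 0" | "j = 1" | "j = 2" using assms by linarith
  then show ?thesis
    by cases (auto simp: gauss_deriv_def[abs_def] numeral_eq_Suc algebra_simps
        intro!: derivative_eq_intros)
qed

lemma continuous_gauss_deriv [continuous_intros]:
  "continuous_on S f \<Longrightarrow> continuous_on S (\<lambda>x. gauss_deriv s j (f x))"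
  unfolding gauss_deriv_def
  by (cases "j = 0"; cases "j = 1"; cases "j = 2") (auto intro!: continuous_intros)

lemma tendsto_gauss_deriv [tendsto_intros]:
  "(f \<longlongrightarrow> s) X \<Longrightarrow> ((\<lambda>n. gauss_deriv (f n) j x) \<longlongrightarrow> gauss_deriv s j x) X"
  unfolding gauss_deriv_def by (auto intro!: tendsto_eq_intros)

lemma exp_square_ge_power:
  assumes "k \<le> 3" shows "\<bar>y\<bar> ^ k * exp (- (y\<^sup>2)) \<le> (1::real)"
proof -
  have "1 + y\<^sup>2 + (y\<^sup>2)\<^sup>2 / 2 \<le> exp (y\<^sup>2)"
    by (rule exp_lower_Taylor_quadratic) simp
  moreover have "\<bar>y\<bar> ^ k \<le> 1 + y\<^sup>2 + (y\<^sup>2)\<^sup>2 / 2"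
  proof -
    have a: "2 * \<bar>y\<bar> \<le> 1 + y\<^sup>2"
      using zero_le_power2[of "\<bar>y\<bar> - 1"] by (simp add: power2_diff)
    have b: "\<bar>y\<bar> ^ 3 \<le> (1 + y\<^sup>2) / 2 * y\<^sup>2"
      using mult_right_mono[OF a, of "y\<^sup>2"] by (simp add: power2_eq_square power3_eq_cube abs_mult_self_eq field_simps)
    consider "k = 0" | "k = 1" | "k = 2" | "k = 3" using assms by linarith
    then show ?thesis
    proof cases
      case 4
      have "(1 + y\<^sup>2) / 2 * y\<^sup>2 = y\<^sup>2 / 2 + (y\<^sup>2)\<^sup>2 / 2"
        by (simp add: field_simps power2_eq_square)
      from b[unfolded this] show ?thesis
        unfolding 4 using zero_le_power2[of y] by linarith
    next
      case 2
      then show ?thesis using a zero_le_power2[of y] zero_le_power2[of "y\<^sup>2"]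
        by (simp only: power_one_right)
    next
      case 3
      then show ?thesis using zero_le_power2[of "y\<^sup>2"]
        by (simp only: power2_abs)
    qed simp
  qed
  ultimately show ?thesis by (simp add: exp_minus field_simps)
qed

text \<open>
  With \<open>y = sqrt s * x\<close> every term is a power of \<open>sqrt s \<le> 1\<close> times some \<open>y ^ k * exp (- y\<^sup>2)\<close> with
  \<open>k \<le> 3\<close>, so the bound is uniform in \<open>s\<close>.
\<close>
lemma gauss_deriv_le:
  assumes s: "0 \<le> s" "s \<le> 1"
  shows "\<bar>gauss_deriv s j x\<bar> \<le> 20"
proof -
  define r where "r = sqrt s"
  have r: "0 \<le> r" "r \<le> 1" "s = r\<^sup>2" using s by (auto simp: r_def)
  define y where "y = r * x"
  define e where "e = exp (- (y\<^sup>2))"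
  have e: "e > 0" by (simp add: e_def)
  have E: "e \<le> 1" "\<bar>y\<bar> * e \<le> 1" "y\<^sup>2 * e \<le> 1" "\<bar>y\<bar> ^ 3 * e \<le> 1"
    using exp_square_ge_power[of 0 y] exp_square_ge_power[of 1 y] exp_square_ge_power[of 2 y] exp_square_ge_power[of 3 y]
    by (auto simp: e_def)
  have m: "\<bar>r ^ k * z\<bar> \<le> \<bar>z\<bar>" for z k
    using r by (simp add: abs_mult mult_left_le_one_le power_le_one)
  have exp: "exp (- s * x\<^sup>2) = e"
    by (simp add: e_def y_def r power_mult_distrib)
  consider "j = 0" | "j = 1" | "j = 2" | "j \<ge> 3" by linarith
  then show ?thesis
  proof cases
    case 1
    then show ?thesis using E e unfolding gauss_deriv_def exp by simp
  next
    case 2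
    then have "gauss_deriv s j x = - 2 * (r ^ 1 * (y * e))"
      unfolding gauss_deriv_def exp by (simp add: r y_def power2_eq_square)
    moreover have "\<bar>r ^ 1 * (y * e)\<bar> \<le> 1"
      using m[of 1 "y * e"] E(2) e by (simp add: abs_mult)
    ultimately show ?thesis by linarith
  next
    case 3
    then have "gauss_deriv s j x = 4 * (r ^ 2 * (y\<^sup>2 * e)) - 2 * (r ^ 2 * e)"
      unfolding gauss_deriv_def exp by (simp add: r y_def power2_eq_square algebra_simps)
    moreover have "\<bar>r ^ 2 * (y\<^sup>2 * e)\<bar> \<le> 1" "\<bar>r ^ 2 * e\<bar> \<le> 1"
      using order_trans[OF m, of "y\<^sup>2 * e" 1 2] order_trans[OF m, of e 1 2] E(1,3) e by auto
    ultimately show ?thesis by linarith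
  next
    case 4
    then have "gauss_deriv s j x = 12 * (r ^ 3 * (y * e)) - 8 * (r ^ 3 * (y ^ 3 * e))"
      unfolding gauss_deriv_def exp by (simp add: r y_def power2_eq_square power3_eq_cube algebra_simps)
    moreover have "\<bar>r ^ 3 * (y * e)\<bar> \<le> 1" "\<bar>r ^ 3 * (y ^ 3 * e)\<bar> \<le> 1"
      using m[of 3 "y * e"] m[of 3 "y ^ 3 * e"] E(2,4) e by (simp_all add: abs_mult power_abs)
    ultimately show ?thesis by linarith
  qed
qed

lemma bounded_if_vanishing:
  fixes f :: "real \<Rightarrow> real"
  assumes cont: "continuous_on UNIV f" and lim: "(f \<longlongrightarrow> 0) at_top" "(f \<longlongrightarrow> 0) at_bot"
  obtains B where "\<And>x. \<bar>f x\<bar> \<le> B"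
proof -
  have "\<forall>\<^sub>F x in at_top. \<bar>f x\<bar> < 1" "\<forall>\<^sub>F x in at_bot. \<bar>f x\<bar> < 1"
    using tendstoD[OF lim(1), of 1] tendstoD[OF lim(2), of 1] by (auto simp: dist_real_def)
  then obtain u v where uv: "\<And>x. x \<ge> u \<Longrightarrow> \<bar>f x\<bar> < 1" "\<And>x. x \<le> v \<Longrightarrow> \<bar>f x\<bar> < 1"
    by (auto simp: eventually_at_top_linorder eventually_at_bot_linorder)
  have "bounded (f ` {v..u})"
    using cont by (intro compact_imp_bounded compact_continuous_image) (auto intro: continuous_on_subset)
  then obtain B where B: "\<forall>x\<in>{v..u}. \<bar>f x\<bar> \<le> B"
    by (auto simp: bounded_iff)
  have "\<bar>f x\<bar> \<le> max B 1" for x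
  proof (cases "x \<in> {v..u}")
    case True
    then show ?thesis using B by (auto simp: le_max_iff_disj)
  next
    case False
    then show ?thesis using uv[of x] by (cases "x \<ge> u") (auto simp: le_max_iff_disj intro: less_imp_le)
  qed
  then show ?thesis using that by blast
qed

lemma gauss_deriv_decay:
  assumes s: "s > 0"
  obtains B where "B \<ge> 0" "\<And>j x. \<bar>gauss_deriv s j x\<bar> \<le> B * cauchy_weight x"
proof -
  have "\<exists>B. \<forall>x. \<bar>gauss_deriv s j x\<bar> \<le> B * cauchy_weight x" for j
  proof -
    let ?f = "\<lambda>x. gauss_deriv s j x * (1 + x\<^sup>2)"
    consider "j = 0" | "j = 1" | "j = 2" | "j \<ge> 3" by linarith
    then have "(?f \<longlongrightarrow> 0) at_top" "(?f \<longlongrightarrow> 0) at_bot"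
      unfolding gauss_deriv_def using s by (cases; simp; real_asymp)+
    moreover have "continuous_on UNIV ?f"
      by (intro continuous_intros)
    ultimately obtain B where "\<And>x. \<bar>?f x\<bar> \<le> B"
      using bounded_if_vanishing[of ?f] by blast
    then have B: "\<bar>gauss_deriv s j x\<bar> * \<bar>1 + x\<^sup>2\<bar> \<le> B" for x
      by (simp only: abs_mult)
    have "\<bar>gauss_deriv s j x\<bar> \<le> B * cauchy_weight x" for x
    proof -
      have "0 < 1 + x\<^sup>2" by (simp add: add_pos_nonneg)
      with B[of x] show ?thesis
        by (simp add: cauchy_weight_def divide_inverse[symmetric] pos_le_divide_eq)
    qed
    then show ?thesis by blast
  qed
  then obtain B where B: "\<And>j x. \<bar>gauss_deriv s j x\<bar> \<le> B j * cauchy_weight x" by metis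
  have pos: "B j \<ge> 0" for j
    using order_trans[OF abs_ge_zero B[of j 0]] by simp
  have "\<bar>gauss_deriv s j x\<bar> \<le> (B 0 + B 1 + B 2 + B 3) * cauchy_weight x" for j x
  proof -
    consider "j = 0" | "j = 1" | "j = 2" | "j \<ge> 3" by linarith
    then have "\<exists>i\<in>{0,1,2,3}. gauss_deriv s j x = gauss_deriv s i x"
      by cases (auto simp: gauss_deriv_def)
    then obtain i where i: "i \<in> {0,1,2,3}" "gauss_deriv s j x = gauss_deriv s i x" by blast
    have "B i \<le> B 0 + B 1 + B 2 + B 3"
      using i(1) pos[of 0] pos[of 1] pos[of 2] pos[of 3] by auto
    then show ?thesis
      using order_trans[OF B[of i x] mult_right_mono] i(2) by simp
  qed
  then show ?thesis
    using that[of "B 0 + B 1 + B 2 + B 3"] pos by (simp add: add_nonneg_nonneg)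
qed

lemma sum_atMost_3: "(\<Sum>l\<le>3::nat. f l) = f 0 + f 1 + f 2 + (f 3 :: complex)"
  by (simp add: numeral_eq_Suc)

text \<open>
  The sum runs up to 3 for every order \<open>i\<close>: the terms with \<open>l > i\<close> vanish with their binomial
  coefficient. This common range is what allows sums over \<open>i\<close> and over \<open>l\<close> to be exchanged.
\<close>
lemma gauss_leibniz:
  fixes u :: "nat \<Rightarrow> real \<Rightarrow> complex"
  assumes u: "\<And>l x. l < 3 \<Longrightarrow> (u l has_vector_derivative u (Suc l) x) (at x)" and "i < 3"
  shows "((\<lambda>x. \<Sum>l\<le>3. of_nat (i choose l) * of_real (gauss_deriv s (i - l) x) * u l x)
     has_vector_derivative (\<Sum>l\<le>3. of_nat (Suc i choose l) * of_real (gauss_deriv s (Suc i - l) x) * u l x)) (at x)"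
proof -
  have g: "((\<lambda>x. complex_of_real (gauss_deriv s j x)) has_vector_derivative of_real (gauss_deriv s (Suc j) x)) (at x)"
    if "j < 3" for j
    by (rule has_vector_derivative_of_real[OF gauss_deriv_Suc[OF that]])
  have u': "(u 0 has_vector_derivative u 1 x) (at x)" "(u 1 has_vector_derivative u 2 x) (at x)"
    "(u 2 has_vector_derivative u 3 x) (at x)"
    using u[of 0] u[of 1] u[of 2] by (simp_all add: numeral_eq_Suc)
  have g': "((\<lambda>x. complex_of_real (gauss_deriv s 0 x)) has_vector_derivative of_real (gauss_deriv s 1 x)) (at x)"
     "((\<lambda>x. complex_of_real (gauss_deriv s 1 x)) has_vector_derivative of_real (gauss_deriv s 2 x)) (at x)"
     "((\<lambda>x. complex_of_real (gauss_deriv s 2 x)) has_vector_derivative of_real (gauss_deriv s 3 x)) (at x)"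
    using g[of 0] g[of 1] g[of 2] by (simp_all add: numeral_eq_Suc)
  have binom: "(0 choose 2) = 0" "(0 choose 3) = 0" "(Suc 0 choose 2) = 0" "(Suc 0 choose 3) = 0"
    "(2 choose Suc 0) = 2" "(3 choose Suc 0) = 3" "(3 choose 2) = 3" "(2 choose 3) = 0"
    by (simp_all add: numeral_eq_Suc)
  consider "i = 0" | "i = 1" | "i = 2" using \<open>i < 3\<close> by linarith
  then show ?thesis
  proof cases
    case 1
    show ?thesis unfolding 1 sum_atMost_3
      using has_vector_derivative_mult[OF g'(1) u'(1)]
      by (simp add: algebra_simps binom)
  next
    case 2
    show ?thesis unfolding 2 sum_atMost_3
      using has_vector_derivative_add[OF has_vector_derivative_mult[OF g'(2) u'(1)]
          has_vector_derivative_mult[OF g'(1) u'(2)]]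
      by (simp add: binom algebra_simps numeral_2_eq_2[symmetric])
  next
    case 3
    show ?thesis unfolding 3 sum_atMost_3
      using has_vector_derivative_add[OF has_vector_derivative_add[OF has_vector_derivative_mult[OF g'(3) u'(1)]
          has_vector_derivative_mult_right[OF has_vector_derivative_mult[OF g'(2) u'(2)], of 2]]
          has_vector_derivative_mult[OF g'(1) u'(3)]]
      by (simp add: binom algebra_simps numeral_2_eq_2[symmetric] numeral_3_eq_3[symmetric])
  qed
qed

locale bounded_family =
  fixes f :: "nat \<Rightarrow> nat \<Rightarrow> real \<Rightarrow> real \<Rightarrow> complex" and N :: real
  assumes cont: "i \<le> 3 \<Longrightarrow> k \<le> 3 \<Longrightarrow> continuous_on UNIV (\<lambda>(a, b). f i k a b)"
    and deriv_fst: "i < 3 \<Longrightarrow> k \<le> 3 \<Longrightarrow>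
      ((\<lambda>a. f i k a b) has_vector_derivative f (Suc i) k a b) (at a)"
    and deriv_snd: "i \<le> 3 \<Longrightarrow> k < 3 \<Longrightarrow>
      ((\<lambda>b. f i k a b) has_vector_derivative f i (Suc k) a b) (at b)"
    and bound: "i \<le> 3 \<Longrightarrow> k \<le> 3 \<Longrightarrow> norm (f i k a b) \<le> N"

definition leibniz_coeff :: "real \<Rightarrow> nat \<Rightarrow> nat \<Rightarrow> real \<Rightarrow> complex" where
  "leibniz_coeff s i l x = of_nat (i choose l) * of_real (gauss_deriv s (i - l) x)"

lemma binomial_le_8: "i \<le> 3 \<Longrightarrow> (i choose l) \<le> 8"
proof -
  assume i: "i \<le> 3"
  have "(i choose l) \<le> 2 ^ i" by (rule binomial_le_pow2)
  also have "\<dots> \<le> 2 ^ (3::nat)" using i by (intro power_increasing) auto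
  finally show ?thesis by simp
qed

lemma norm_leibniz_coeff:
  assumes "0 \<le> s" "s \<le> 1" "i \<le> 3"
  shows "norm (leibniz_coeff s i l x) \<le> 160"
proof -
  have "norm (leibniz_coeff s i l x) \<le> 8 * 20"
    unfolding leibniz_coeff_def norm_mult
    using gauss_deriv_le[OF assms(1,2), of "i - l" x] binomial_le_8[OF assms(3), of l]
    by (intro mult_mono) auto
  then show ?thesis by simp
qed

text \<open>
  The part of the remainder of a damped function in which \<open>l\<close> derivatives in \<open>a\<close> and \<open>m\<close> derivatives
  in \<open>b\<close> fall on the function and the others on the Gaussian factors.
\<close>
definition damped_kernel :: "real \<Rightarrow> real \<Rightarrow> nat \<Rightarrow> nat \<Rightarrow> real \<times> real \<times> real \<Rightarrow> complex" where
  "damped_kernel s r l m = (\<lambda>(a, b, t). \<Sum>i\<in>{1..3}. \<Sum>k\<in>{1..3}.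
     leibniz_coeff s i l a * leibniz_coeff r k m (t * b) * remainder_kernel i k (a, b, t))"

lemma leibniz_coeff_0: "leibniz_coeff 0 i l x = (if i = l then 1 else 0)"
  by (auto simp: leibniz_coeff_def gauss_deriv_simps binomial_eq_0)

text \<open>
  Without damping all derivatives fall on the function, and the remainder contains at least one in
  each variable. This is why a block contributes \<open>1 + O(h \<rho>\<^sub>j \<delta>\<^sub>j)\<close> and not merely a constant.
\<close>
lemma damped_kernel_0_eq_0:
  assumes "l = 0 \<or> m = 0" shows "damped_kernel 0 0 l m w = 0"
  using assms by (auto simp: damped_kernel_def leibniz_coeff_0 case_prod_unfold intro!: sum.neutral)

lemma measurable_leibniz_coeff [measurable]: "leibniz_coeff s i l \<in> borel_measurable borel"
  unfolding leibniz_coeff_def[abs_def] by (intro borel_measurable_continuous_onI continuous_intros)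

lemma measurable_damped_kernel [measurable]: "damped_kernel s r l m \<in> borel_measurable borel"
proof -
  note [measurable] = measurable_remainder_kernel[folded borel_prod]
  show ?thesis
    unfolding damped_kernel_def case_prod_unfold prod.collapse borel_prod[symmetric] by measurable
qed

lemma norm_damped_kernel:
  assumes "0 \<le> s" "s \<le> 1" "0 \<le> r" "r \<le> 1"
  shows "norm (damped_kernel s r l m w) \<le> 7603200 * slab_weight w"
proof -
  \<comment> \<open>the constant is \<open>7603200 = 9 * 160 * 160 * 33\<close>\<close>
  have "norm (damped_kernel s r l m w) \<le> (\<Sum>i\<in>{1..3::nat}. \<Sum>k\<in>{1..3::nat}. 160 * 160 * (33 * slab_weight w))"
    unfolding damped_kernel_def case_prod_unfold
  proof (intro sum_norm_le, simp only: norm_mult prod.collapse, intro mult_mono norm_remainder_kernel norm_leibniz_coeff assms)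
  qed auto
  then show ?thesis by simp
qed

lemma tendsto_damped_kernel:
  assumes "s \<longlonglongrightarrow> 0" "r \<longlonglongrightarrow> 0"
  shows "(\<lambda>n. damped_kernel (s n) (r n) l m w) \<longlonglongrightarrow> damped_kernel 0 0 l m w"
  unfolding damped_kernel_def leibniz_coeff_def case_prod_unfold
  by (intro tendsto_intros assms)

context bounded_family
begin

definition damped :: "real \<Rightarrow> real \<Rightarrow> nat \<Rightarrow> nat \<Rightarrow> real \<Rightarrow> real \<Rightarrow> complex" where
  "damped s r i k a b = (\<Sum>l\<le>3. leibniz_coeff s i l a * (\<Sum>m\<le>3. leibniz_coeff r k m b * f l m a b))"

lemma damped_decaying:
  assumes "s > 0" "r > 0"
  shows "\<exists>C. decaying_family (damped s r) C"
proof -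
  obtain B where B: "B \<ge> 0" "\<And>j x. \<bar>gauss_deriv s j x\<bar> \<le> B * cauchy_weight x"
    using gauss_deriv_decay[OF assms(1)] by blast
  obtain D where D: "D \<ge> 0" "\<And>j x. \<bar>gauss_deriv r j x\<bar> \<le> D * cauchy_weight x"
    using gauss_deriv_decay[OF assms(2)] by blast
  have N: "N \<ge> 0" using order_trans[OF norm_ge_zero bound[of 0 0 0 0]] by simp
  \<comment> \<open>16 terms, each with two binomial coefficients that are at most 8\<close>
  have "decaying_family (damped s r) (1024 * B * D * N)"
  proof
    fix i k :: nat assume ik: "i \<le> 3" "k \<le> 3"
    have c: "continuous_on UNIV (\<lambda>p. f l m (fst p) (snd p))" if "l \<le> 3" "m \<le> 3" for l m
      using cont[OF that] by (simp add: case_prod_unfold)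
    show "continuous_on UNIV (\<lambda>(a, b). damped s r i k a b)"
      unfolding damped_def leibniz_coeff_def case_prod_unfold
      by (intro continuous_intros c) auto
    fix a b :: real
    have "norm (damped s r i k a b) \<le> (\<Sum>l\<le>3::nat. (8 * (B * cauchy_weight a)) * (\<Sum>m\<le>3::nat. (8 * (D * cauchy_weight b)) * N))"
      unfolding damped_def leibniz_coeff_def
      using binomial_le_8[OF ik(1)] binomial_le_8[OF ik(2)] B D N
      by (intro sum_norm_le order_trans[OF eq_refl[OF norm_mult] mult_mono] mult_nonneg_nonneg sum_nonneg)
         (auto simp: norm_mult intro!: mult_mono bound)
    then show "norm (damped s r i k a b) \<le> (1024 * B * D * N) * (cauchy_weight a * cauchy_weight b)"
      by (simp add: mult_ac)
  next
    fix i k :: nat and a b :: real assume ik: "i < 3" "k \<le> 3"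
    show "((\<lambda>a. damped s r i k a b) has_vector_derivative damped s r (Suc i) k a b) (at a)"
      unfolding damped_def leibniz_coeff_def using ik
      by (intro gauss_leibniz derivative_intros has_vector_derivative_sum has_vector_derivative_mult_right deriv_fst) auto
  next
    fix i k :: nat and a b :: real assume ik: "i \<le> 3" "k < 3"
    show "((\<lambda>b. damped s r i k a b) has_vector_derivative damped s r i (Suc k) a b) (at b)"
      unfolding damped_def leibniz_coeff_def using ik
      by (intro has_vector_derivative_sum has_vector_derivative_mult_right gauss_leibniz deriv_snd) auto
  qed
  then show ?thesis by blast
qed


text \<open>
  The expansion of the damped function, sorted by the derivatives of the function itself. The
  damping parameters now occur in the kernels only, which have an integrable bound uniform in them.
\<close>
theorem damped_osc_expansion:
  assumes s: "0 < s" "s \<le> 1" and r: "0 < r" "r \<le> 1"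
  shows "integrable lborel (\<lambda>(a, b). osc a b * of_real (exp (- s * a\<^sup>2) * exp (- r * b\<^sup>2)) * f 0 0 a b)"
   and "(\<integral>w. (case w of (a, b) \<Rightarrow> osc a b * of_real (exp (- s * a\<^sup>2) * exp (- r * b\<^sup>2)) * f 0 0 a b) \<partial>lborel) / of_real pi
     = f 0 0 0 0 +
     (\<Sum>l\<le>3. \<Sum>m\<le>3. \<integral>w. damped_kernel s r l m w * f l m (fst w) (snd (snd w) * fst (snd w)) \<partial>lborel)"
proof -
  obtain C where "decaying_family (damped s r) C"
    using damped_decaying s r by blast
  then interpret F: decaying_family "damped s r" C .
  have 00: "damped s r 0 0 a b = of_real (exp (- s * a\<^sup>2) * exp (- r * b\<^sup>2)) * f 0 0 a b" for a b
    unfolding damped_def leibniz_coeff_def sum_atMost_3 by (simp add: gauss_deriv_simps binomial_eq_0 mult_ac)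
  show "integrable lborel (\<lambda>(a, b). osc a b * of_real (exp (- s * a\<^sup>2) * exp (- r * b\<^sup>2)) * f 0 0 a b)"
    using F.decaying_osc_expansion(1) unfolding 00 by (simp only: mult.assoc)
  let ?p = "\<lambda>w :: real \<times> real \<times> real. snd (snd w) * fst (snd w)"
  let ?f = "\<lambda>l m w. f l m (fst w) (?p w)"
  let ?c = "\<lambda>i k l m w. leibniz_coeff s i l (fst w) * leibniz_coeff r k m (?p w) * remainder_kernel i k w"
  have int: "integrable lborel (\<lambda>w. ?c i k l m w * ?f l m w)" 
    if "i \<in> {1..3}" "k \<in> {1..3}" "l \<in> {..3}" "m \<in> {..3}" for i k l m
  proof (rule integrable_slab_bound[where C="160 * 160 * 33 * N"])
    have "(\<lambda>w::real \<times> real \<times> real. (case_prod (f l m) (fst w, ?p w))) \<in> borel_measurable borel"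
      using that by (intro borel_measurable_continuous_onI continuous_on_compose2[OF cont] continuous_intros) auto
    note [measurable] = this[simplified, folded borel_prod] measurable_remainder_kernel[folded borel_prod]
    show "(\<lambda>w. ?c i k l m w * ?f l m w) \<in> borel_measurable borel"
      unfolding borel_prod[symmetric] by measurable
    show "norm (?c i k l m w * ?f l m w) \<le> (160 * 160 * 33 * N) * slab_weight w" for w
    proof -
      have "norm (?c i k l m w * ?f l m w) \<le> 160 * 160 * (33 * slab_weight w) * N"
        unfolding norm_mult using that s r
        by (intro mult_mono norm_leibniz_coeff norm_remainder_kernel bound mult_nonneg_nonneg) auto
      then show ?thesis by (simp add: mult_ac)
    qed
  qed
  have "(\<Sum>i\<in>{1..3}. \<Sum>k\<in>{1..3}. \<integral>w. remainder_kernel i k w * damped s r i k (fst w) (?p w) \<partial>lborel) = 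
     (\<Sum>i\<in>{1..3}. \<Sum>k\<in>{1..3}. \<Sum>l\<le>3. \<Sum>m\<le>3. \<integral>w. ?c i k l m w * ?f l m w \<partial>lborel)"
  proof (intro sum.cong refl)
    fix i k :: nat assume ik: "i \<in> {1..3}" "k \<in> {1..3}"
    have "(\<integral>w. remainder_kernel i k w * damped s r i k (fst w) (?p w) \<partial>lborel) = 
      (\<integral>w. (\<Sum>l\<le>3. \<Sum>m\<le>3. ?c i k l m w * ?f l m w) \<partial>lborel)"
      by (simp add: damped_def sum_distrib_left mult_ac)
    also have "\<dots> = (\<Sum>l\<le>3. \<integral>w. (\<Sum>m\<le>3. ?c i k l m w * ?f l m w) \<partial>lborel)"
      by (intro Bochner_Integration.integral_sum Bochner_Integration.integrable_sum int ik)
    also have "\<dots> = (\<Sum>l\<le>3. \<Sum>m\<le>3. \<integral>w. ?c i k l m w * ?f l m w \<partial>lborel)"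
      by (intro sum.cong refl Bochner_Integration.integral_sum int ik)
    finally show "(\<integral>w. remainder_kernel i k w * damped s r i k (fst w) (?p w) \<partial>lborel) = \<dots>" .
  qed
  also have "\<dots> = (\<Sum>l\<le>3. \<Sum>m\<le>3. \<Sum>i\<in>{1..3}. \<Sum>k\<in>{1..3}. \<integral>w. ?c i k l m w * ?f l m w \<partial>lborel)"
  proof -
    have "(\<Sum>i\<in>{1..3}. \<Sum>k\<in>{1..3}. \<Sum>l\<le>3. \<Sum>m\<le>3. X i k l m) = 
      (\<Sum>l\<le>3. \<Sum>m\<le>3. \<Sum>i\<in>{1..3}. \<Sum>k\<in>{1..3}. X i k l m)" for X :: "nat \<Rightarrow> nat \<Rightarrow> nat \<Rightarrow> nat \<Rightarrow> complex"
      unfolding sum.swap[of _ "{..3}" "{1..3}"] ..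
    then show ?thesis .
  qed
  also have "\<dots> = (\<Sum>l\<le>3. \<Sum>m\<le>3. \<integral>w. damped_kernel s r l m w * ?f l m w \<partial>lborel)"
  proof (intro sum.cong refl)
    fix l m :: nat assume lm: "l \<in> {..3}" "m \<in> {..3}"
    have "(\<integral>w. damped_kernel s r l m w * ?f l m w \<partial>lborel) = 
       (\<integral>w. (\<Sum>i\<in>{1..3}. \<Sum>k\<in>{1..3}. ?c i k l m w * ?f l m w) \<partial>lborel)"
      by (simp add: damped_kernel_def case_prod_unfold sum_distrib_right)
    also have "\<dots> = (\<Sum>i\<in>{1..3}. \<integral>w. (\<Sum>k\<in>{1..3}. ?c i k l m w * ?f l m w) \<partial>lborel)"
      by (intro Bochner_Integration.integral_sum Bochner_Integration.integrable_sum int lm)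
    also have "\<dots> = (\<Sum>i\<in>{1..3}. \<Sum>k\<in>{1..3}. \<integral>w. ?c i k l m w * ?f l m w \<partial>lborel)"
      by (intro sum.cong refl Bochner_Integration.integral_sum int lm)
    finally show "(\<Sum>i\<in>{1..3}. \<Sum>k\<in>{1..3}. \<integral>w. ?c i k l m w * ?f l m w \<partial>lborel) = 
      (\<integral>w. damped_kernel s r l m w * ?f l m w \<partial>lborel)" ..
  qed
  finally show "(\<integral>w. (case w of (a, b) \<Rightarrow> osc a b * of_real (exp (- s * a\<^sup>2) * exp (- r * b\<^sup>2)) * f 0 0 a b) \<partial>lborel) / of_real pi
     = f 0 0 0 0 +
     (\<Sum>l\<le>3. \<Sum>m\<le>3. \<integral>w. damped_kernel s r l m w * ?f l m w \<partial>lborel)"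
    using F.decaying_osc_expansion(2)
    unfolding 00 by (simp only: mult.assoc 00) (simp add: gauss_deriv_simps)
qed

end

section \<open>Jets and block operators\<close>

text \<open>
  The coordinates are indexed by a block and a flag, where \<open>False\<close> stands for the position and
  \<open>True\<close> for the momentum of the block. In a jet \<open>H\<close>, the function \<open>H k\<close> is meant to be the mixed
  derivative of order \<open>k\<close> of \<open>H 0\<close>. To carry all derivatives along as separate functions makes it
  possible to apply an integral operator to each of them before it is known that the result is
  differentiable.
\<close>

type_synonym 'b jet = "('b \<times> bool \<Rightarrow> nat) \<Rightarrow> ('b \<times> bool \<Rightarrow> real) \<Rightarrow> complex"

text \<open>
  Used for points as well as for multi-indices.
\<close>
definition bump :: "'b \<Rightarrow> 'a \<Rightarrow> 'a \<Rightarrow> ('b \<times> bool \<Rightarrow> 'a) \<Rightarrow> 'b \<times> bool \<Rightarrow> 'a::monoid_add" where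
  "bump j p q w = (\<lambda>i. w i + (if i = (j, False) then p else if i = (j, True) then q else 0))"

lemma bump_0 [simp]: "bump j 0 0 w = w"
  by (auto simp: bump_def)

lemma bump_fun_upd:
  "bump j p q (w(i := t)) = (bump j p q w)(i := t + (if i = (j, False) then p else if i = (j, True) then q else 0))"
  by (auto simp: bump_def)

lemma bump_Suc_upd:
  "(bump j l m k)(i := Suc (bump j l m k i)) = bump j l m (k(i := Suc (k i)))"
  by (auto simp: bump_def)

lemma bump_Suc_fst: "(bump j l m k)((j, False) := Suc (bump j l m k (j, False))) = bump j (Suc l) m k"
  and bump_Suc_snd: "(bump j l m k)((j, True) := Suc (bump j l m k (j, True))) = bump j l (Suc m) k"
  by (auto simp: bump_def)

lemma continuous_bump [continuous_intros]:
  fixes w :: "'a::topological_space \<Rightarrow> 'b \<times> bool \<Rightarrow> real"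
  assumes "continuous_on S p" "continuous_on S q" "continuous_on S w"
  shows "continuous_on S (\<lambda>x. bump j (p x) (q x) (w x))"
proof (rule continuous_on_coordinatewise_then_product)
  fix i
  have "continuous_on S (\<lambda>x. w x i)"
    using assms(3) by (rule continuous_on_product_then_coordinatewise)
  then show "continuous_on S (\<lambda>x. bump j (p x) (q x) (w x) i)"
    using assms(1,2) unfolding bump_def
    by (cases "i = (j, False)"; cases "i = (j, True)") (auto intro!: continuous_intros)
qed

lemma prod_bump:
  fixes wt :: "'b \<times> bool \<Rightarrow> real"
  assumes "finite K" "(j, False) \<in> K" "(j, True) \<in> K"
  shows "(\<Prod>i\<in>K. wt i ^ bump j l m k i) = wt (j, False) ^ l * wt (j, True) ^ m * (\<Prod>i\<in>K. wt i ^ k i)"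
proof -
  have "(\<Prod>i\<in>K. wt i ^ bump j l m k i) =
     (\<Prod>i\<in>K. wt i ^ k i * ((if i = (j, False) then wt i ^ l else 1) * (if i = (j, True) then wt i ^ m else 1)))"
    by (intro prod.cong) (auto simp: bump_def power_add)
  also have "\<dots> = (\<Prod>i\<in>K. wt i ^ k i) * (wt (j, False) ^ l * wt (j, True) ^ m)"
    using assms by (simp add: prod.distrib prod.delta)
  finally show ?thesis by simp
qed

text \<open>
  The condition on the derivatives says that \<open>H k\<close> is the derivative of \<open>H 0\<close> of order \<open>k\<close>, for the
  orders up to \<open>ord\<close> in the coordinates \<open>K\<close>. The bounds are those of the symbol classes: each
  derivative in the coordinate \<open>i\<close> costs a factor \<open>wt i\<close>.
\<close>
definition jet_family :: "('b \<times> bool) set \<Rightarrow> ('b \<times> bool \<Rightarrow> real) \<Rightarrow> ('b \<times> bool \<Rightarrow> nat) \<Rightarrow> real \<Rightarrow>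
    'b jet \<Rightarrow> bool" where
  "jet_family K wt ord N H \<longleftrightarrow> (\<forall>k\<le>ord. continuous_on UNIV (H k) \<and>
     (\<forall>w. norm (H k w) \<le> N * (\<Prod>i\<in>K. wt i ^ k i)) \<and>
     (\<forall>i\<in>K. k i < ord i \<longrightarrow>
        (\<forall>w. ((\<lambda>t. H k (w(i := t))) has_vector_derivative H (k(i := Suc (k i))) w) (at (w i)))))"

lemma jet_familyD:
  assumes "jet_family K wt ord N H" "k \<le> ord"
  shows "continuous_on UNIV (H k)" "norm (H k w) \<le> N * (\<Prod>i\<in>K. wt i ^ k i)"
    "i \<in> K \<Longrightarrow> k i < ord i \<Longrightarrow>
      ((\<lambda>t. H k (w(i := t))) has_vector_derivative H (k(i := Suc (k i))) w) (at (w i))"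
  using assms unfolding jet_family_def by auto

text \<open>
  A block operator uses three derivatives in each coordinate of its block.
\<close>
definition lower :: "'b \<Rightarrow> ('b \<times> bool \<Rightarrow> nat) \<Rightarrow> 'b \<times> bool \<Rightarrow> nat" where
  "lower j ord = (\<lambda>i. if fst i = j then ord i - 3 else ord i)"

lemma bump_le_of_lower:
  assumes "k \<le> lower j ord" "3 \<le> ord (j, False)" "3 \<le> ord (j, True)" "l \<le> 3" "m \<le> 3"
  shows "bump j l m k \<le> ord"
proof (rule le_funI)
  fix i
  have "k i \<le> lower j ord i" using assms(1) by (rule le_funD)
  then show "bump j l m k i \<le> ord i"
    using assms(2-) by (auto simp: bump_def lower_def split: if_splits)
qed

lemma lower_le: "lower j ord \<le> ord"
  by (auto simp: lower_def le_fun_def)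

text \<open>
  The right-hand side of the expansion of one block, at every point \<open>w\<close> and for every order \<open>k\<close>. The
  variables of the block are rescaled by \<open>lam\<close> and \<open>mu\<close>.
\<close>
definition block_op :: "real \<Rightarrow> real \<Rightarrow> (nat \<Rightarrow> nat \<Rightarrow> real \<times> real \<times> real \<Rightarrow> complex) \<Rightarrow> 'b \<Rightarrow>
    'b jet \<Rightarrow>
    'b jet" where
  "block_op lam mu kap j H k w = H k w + (\<Sum>l\<le>3. \<Sum>m\<le>3. of_real (lam ^ l * mu ^ m) *
     (\<integral>v. kap l m v * H (bump j l m k) (bump j (lam * fst v) (mu * (snd (snd v) * fst (snd v))) w) \<partial>lborel))"

lemma integral_slab_le:
  fixes f :: "real \<times> real \<times> real \<Rightarrow> complex"
  assumes "f \<in> borel_measurable borel" "\<And>v. norm (f v) \<le> C * slab_weight v"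
  shows "norm (integral\<^sup>L lborel f) \<le> C * integral\<^sup>L lborel slab_weight"
proof -
  have "norm (integral\<^sup>L lborel f) \<le> (\<integral>v. C * slab_weight v \<partial>lborel)"
    using integrable_slab_bound[OF assms] integrable_slab_weight assms(2)
    by (intro Bochner_Integration.integral_norm_bound_integral) auto
  then show ?thesis by simp
qed

lemma tendsto_slab_integral:
  fixes f :: "nat \<Rightarrow> real \<times> real \<times> real \<Rightarrow> complex"
  assumes "\<And>n. f n \<in> borel_measurable borel" "\<And>n v. norm (f n v) \<le> C * slab_weight v"
    "\<And>v. (\<lambda>n. f n v) \<longlonglongrightarrow> g v"
  shows "(\<lambda>n. integral\<^sup>L lborel (f n)) \<longlonglongrightarrow> integral\<^sup>L lborel g"
proof (rule integral_dominated_convergence[where w="\<lambda>v. C * slab_weight v"])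
  show "g \<in> borel_measurable lborel"
    using borel_measurable_LIMSEQ_metric[of f lborel g] assms by simp
qed (use assms integrable_slab_weight in auto)

text \<open>
  By the mean value inequality the remainder of the difference quotient is bounded by \<open>2 B\<close>, so
  dominated convergence applies.
\<close>
lemma has_vector_derivative_slab_integral:
  fixes g g' :: "real \<times> real \<times> real \<Rightarrow> real \<Rightarrow> complex" and kap :: "real \<times> real \<times> real \<Rightarrow> complex"
  assumes kap: "kap \<in> borel_measurable borel" "\<And>v. norm (kap v) \<le> C * slab_weight v"
    and deriv: "\<And>v t. (g v has_vector_derivative g' v t) (at t)"
    and meas: "\<And>t. (\<lambda>v. g v t) \<in> borel_measurable borel" "\<And>t. (\<lambda>v. g' v t) \<in> borel_measurable borel"
    and bound: "\<And>v t. norm (g v t) \<le> B" "\<And>v t. norm (g' v t) \<le> B"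
  shows "((\<lambda>t. \<integral>v. kap v * g v t \<partial>lborel) has_vector_derivative (\<integral>v. kap v * g' v x \<partial>lborel)) (at x)"
proof -
  have C: "0 \<le> C * slab_weight v" for v
    using order_trans[OF norm_ge_zero kap(2)] .
  have B: "B \<ge> 0" using order_trans[OF norm_ge_zero bound(1)[of "(0,0,0)" 0]] .
  have bd: "norm (kap v * z) \<le> (C * D) * slab_weight v" if "norm z \<le> D" for v z D
  proof -
    have "norm (kap v * z) \<le> (C * slab_weight v) * D"
      unfolding norm_mult by (intro mult_mono kap(2) that C) auto
    then show ?thesis by (simp add: mult_ac)
  qed
  note [measurable] = kap(1) meas
  have int: "integrable lborel (\<lambda>v. kap v * g v t)" "integrable lborel (\<lambda>v. kap v * g' v t)" for t
    by (rule integrable_slab_bound[where C="C * B"]; use bd bound in auto)+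
  define R where "R = (\<lambda>v y. (1 / norm (y - x)) *\<^sub>R (g v y - (g v x + (y - x) *\<^sub>R g' v x)))"
  have lipschitz: "norm (g v y - g v x) \<le> norm (y - x) * B" for v y
  proof -
    have "norm (g v y - g v x) \<le> B * norm (y - x)"
    proof (rule differentiable_bound[of UNIV "g v" "\<lambda>t h. h *\<^sub>R g' v t"])
      show "(g v has_derivative (\<lambda>h. h *\<^sub>R g' v t)) (at t within UNIV)" for t
        using deriv by (simp add: has_vector_derivative_def)
      show "onorm (\<lambda>h. h *\<^sub>R g' v t) \<le> B" for t
        using bound(2)[of v t] by (intro onorm_le) (simp add: mult.commute[of B] mult_left_mono)
    qed auto
    then show ?thesis by (simp add: mult.commute)
  qed
  have R_le: "norm (R v y) \<le> 2 * B" for v y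
  proof (cases "y = x")
    case False
    have "norm (g v y - (g v x + (y - x) *\<^sub>R g' v x)) \<le> norm (g v y - g v x) + norm ((y - x) *\<^sub>R g' v x)"
      using norm_triangle_ineq4[of "g v y - g v x" "(y - x) *\<^sub>R g' v x"] by (simp add: algebra_simps)
    also have "\<dots> \<le> norm (y - x) * B + norm (y - x) * B"
      using lipschitz[of v y] mult_left_mono[OF bound(2)[of v x], of "norm (y - x)"]
      by (intro add_mono) auto
    finally have le: "norm (g v y - (g v x + (y - x) *\<^sub>R g' v x)) \<le> norm (y - x) * (2 * B)"
      by (simp add: mult_ac)
    have "norm (R v y) \<le> \<bar>1 / norm (y - x)\<bar> * (norm (y - x) * (2 * B))"
      unfolding R_def norm_scaleR by (rule mult_left_mono[OF le abs_ge_zero])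
    then show ?thesis using False by simp
  qed (simp add: R_def B)
  have R_lim: "(R v \<longlongrightarrow> 0) (at x)" for v
    using deriv[of v x] unfolding R_def has_vector_derivative_def has_derivative_within by blast
  have "((\<lambda>y. \<integral>v. kap v * R v y \<partial>lborel) \<longlongrightarrow> 0) (at x)"
    unfolding tendsto_at_iff_sequentially
  proof (intro allI impI)
    fix X :: "nat \<Rightarrow> real" assume X: "\<forall>i. X i \<in> UNIV - {x}" "X \<longlonglongrightarrow> x"
    have "(\<lambda>n. \<integral>v. kap v * R v (X n) \<partial>lborel) \<longlonglongrightarrow> (\<integral>v. kap v * 0 \<partial>lborel)"
    proof (rule tendsto_slab_integral[where C="C * (2 * B)"])
      show "(\<lambda>n. kap v * R v (X n)) \<longlonglongrightarrow> kap v * 0" for v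
        using R_lim[of v] X unfolding tendsto_at_iff_sequentially comp_def
        by (intro tendsto_mult tendsto_const) blast
      show "(\<lambda>v. kap v * R v (X n)) \<in> borel_measurable borel" for n
        unfolding R_def by measurable
    qed (rule bd[OF R_le])
    then show "((\<lambda>y. \<integral>v. kap v * R v y \<partial>lborel) \<circ> X) \<longlonglongrightarrow> 0"
      by (simp add: comp_def)
  qed
  moreover have "(\<integral>v. kap v * R v y \<partial>lborel) = (1 / norm (y - x)) *\<^sub>R
     ((\<integral>v. kap v * g v y \<partial>lborel) - ((\<integral>v. kap v * g v x \<partial>lborel) + (y - x) *\<^sub>R (\<integral>v. kap v * g' v x \<partial>lborel)))" for y
  proof -
    have "kap v * R v y = (1 / norm (y - x)) *\<^sub>R (kap v * g v y - (kap v * g v x + (y - x) *\<^sub>R (kap v * g' v x)))" for v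
      by (simp add: R_def algebra_simps)
    then show ?thesis
      using int by simp
  qed
  ultimately show ?thesis
    unfolding has_vector_derivative_def has_derivative_within
    by (auto intro!: bounded_linear_scaleR_left)
qed

lemma continuous_on_slab_integral:
  fixes g :: "real \<times> real \<times> real \<Rightarrow> 'a::{first_countable_topology, t2_space} \<Rightarrow> complex"
  assumes kap: "kap \<in> borel_measurable borel" "\<And>v. norm (kap v) \<le> C * slab_weight v"
    and cont: "\<And>v. continuous_on UNIV (g v)"
    and meas: "\<And>x. (\<lambda>v. g v x) \<in> borel_measurable borel"
    and bound: "\<And>v x. norm (g v x) \<le> B"
  shows "continuous_on UNIV (\<lambda>x. \<integral>v. kap v * g v x \<partial>lborel)"
proof (rule continuous_on_sequentiallyI)
  fix u :: "nat \<Rightarrow> 'a" and a assume u: "u \<longlonglongrightarrow> a"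
  have C: "0 \<le> C * slab_weight v" for v
    using order_trans[OF norm_ge_zero kap(2)] .
  note [measurable] = kap(1) meas
  show "(\<lambda>n. \<integral>v. kap v * g v (u n) \<partial>lborel) \<longlonglongrightarrow> (\<integral>v. kap v * g v a \<partial>lborel)"
  proof (rule tendsto_slab_integral[where C="C * B"])
    show "norm (kap v * g v (u n)) \<le> C * B * slab_weight v" for n v
      using mult_mono[OF kap(2) bound C norm_ge_zero, of v v "u n"] by (simp add: norm_mult mult_ac)
    show "(\<lambda>n. kap v * g v (u n)) \<longlonglongrightarrow> kap v * g v a" for v
      using continuous_on_tendsto_compose[OF cont u] by (intro tendsto_intros) auto
  qed auto
qed

abbreviation "slab_mass \<equiv> integral\<^sup>L lborel slab_weight"

text \<open>
  The factor by which a block operator increases the bounds, if its kernel of order \<open>(l, m)\<close> is at most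
  \<open>c l m\<close> times the weight and a derivative in the rescaled variables costs \<open>p\<close> and \<open>q\<close>.
\<close>
definition block_factor :: "(nat \<Rightarrow> nat \<Rightarrow> real) \<Rightarrow> real \<Rightarrow> real \<Rightarrow> real" where
  "block_factor c p q = 1 + (\<Sum>l\<le>3. \<Sum>m\<le>3. c l m * slab_mass * p ^ l * q ^ m)"

text \<open>
  The kernels do not depend on \<open>w\<close>, hence differentiation in \<open>w\<close> passes to \<open>H\<close> under the integral. In
  the bound, \<open>prod_bump\<close> separates the cost of the derivatives that the operator adds from the cost of
  the order \<open>k\<close>.
\<close>
lemma jet_family_block_op:
  fixes H :: "'b::countable jet"
  assumes H: "jet_family K wt ord N H" and K: "finite K" "(j, False) \<in> K" "(j, True) \<in> K"
    and ord: "3 \<le> ord (j, False)" "3 \<le> ord (j, True)"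
    and kap: "\<And>l m. kap l m \<in> borel_measurable borel" "\<And>l m v. norm (kap l m v) \<le> c l m * slab_weight v"
  shows "jet_family K wt (lower j ord)
    (N * block_factor c (\<bar>lam\<bar> * wt (j, False)) (\<bar>mu\<bar> * wt (j, True))) (block_op lam mu kap j H)"
  unfolding jet_family_def
proof (intro allI impI conjI ballI)
  fix k assume k: "k \<le> lower j ord"
  have k': "k \<le> ord" using k lower_le by (rule order_trans)
  have b: "bump j l m k \<le> ord" if "l \<in> {..3}" "m \<in> {..3}" for l m
    using bump_le_of_lower[OF k ord] that by auto
  let ?s = "\<lambda>v::real \<times> real \<times> real. bump j (lam * fst v) (mu * (snd (snd v) * fst (snd v)))"
  note HD = jet_familyD[OF H]
  have meas: "(\<lambda>v. H k0 (?s v w)) \<in> borel_measurable borel" if "k0 \<le> ord" for k0 w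
    by (intro borel_measurable_continuous_onI continuous_on_compose2[OF HD(1)[OF that]] continuous_intros) auto
  have cont: "continuous_on UNIV (\<lambda>w. H k0 (?s v w))" if "k0 \<le> ord" for k0 v
    by (intro continuous_on_compose2[OF HD(1)[OF that]] continuous_intros) auto
  have "continuous_on UNIV (\<lambda>w. \<integral>v. kap l m v * H (bump j l m k) (?s v w) \<partial>lborel)"
    if "l \<in> {..3}" "m \<in> {..3}" for l m
    by (rule continuous_on_slab_integral[OF kap cont[OF b[OF that]] meas[OF b[OF that]] HD(2)[OF b[OF that]]])
  then show "continuous_on UNIV (block_op lam mu kap j H k)"
    unfolding block_op_def by (intro continuous_intros HD k')
  show "norm (block_op lam mu kap j H k w) \<le> N * block_factor c (\<bar>lam\<bar> * wt (j, False)) (\<bar>mu\<bar> * wt (j, True)) * (\<Prod>i\<in>K. wt i ^ k i)" for w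
  proof -
    let ?P = "\<Prod>i\<in>K. wt i ^ k i"
    have "norm (block_op lam mu kap j H k w) \<le> N * ?P +
      (\<Sum>l\<le>3. \<Sum>m\<le>3. \<bar>lam ^ l * mu ^ m\<bar> * (c l m * (N * (wt (j, False) ^ l * wt (j, True) ^ m * ?P)) * slab_mass))"
      unfolding block_op_def
    proof (intro order_trans[OF norm_triangle_ineq] add_mono HD k' sum_norm_le)
      fix l m :: nat assume lm: "l \<in> {..3}" "m \<in> {..3}"
      have "norm (\<integral>v. kap l m v * H (bump j l m k) (?s v w) \<partial>lborel) \<le>
         (c l m * (N * (\<Prod>i\<in>K. wt i ^ bump j l m k i))) * slab_mass"
      proof (rule integral_slab_le)
        show "(\<lambda>v. kap l m v * H (bump j l m k) (?s v w)) \<in> borel_measurable borel"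
          using kap(1) meas[OF b[OF lm]] by measurable
        fix v
        have "norm (kap l m v * H (bump j l m k) (?s v w)) \<le> (c l m * slab_weight v) * (N * (\<Prod>i\<in>K. wt i ^ bump j l m k i))"
          unfolding norm_mult using order_trans[OF norm_ge_zero kap(2)[of l m v]]
          by (intro mult_mono kap HD b lm) auto
        then show "norm (kap l m v * H (bump j l m k) (?s v w)) \<le> (c l m * (N * (\<Prod>i\<in>K. wt i ^ bump j l m k i))) * slab_weight v"
          by (simp add: mult_ac)
      qed
      then have "norm (\<integral>v. kap l m v * H (bump j l m k) (?s v w) \<partial>lborel) \<le>
         (c l m * (N * (wt (j, False) ^ l * wt (j, True) ^ m * ?P))) * slab_mass"
        unfolding prod_bump[OF K] .
      then show "norm (of_real (lam ^ l * mu ^ m) * (\<integral>v. kap l m v * H (bump j l m k) (?s v w) \<partial>lborel))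
         \<le> \<bar>lam ^ l * mu ^ m\<bar> * (c l m * (N * (wt (j, False) ^ l * wt (j, True) ^ m * ?P)) * slab_mass)"
        unfolding norm_mult norm_of_real by (intro mult_left_mono) auto
    qed
    also have "\<dots> = N * block_factor c (\<bar>lam\<bar> * wt (j, False)) (\<bar>mu\<bar> * wt (j, True)) * ?P"
      by (simp add: block_factor_def sum_distrib_left sum_distrib_right algebra_simps abs_mult power_abs power_mult_distrib)
    finally show ?thesis .
  qed
  fix i w assume i: "i \<in> K" "k i < lower j ord i"
  have ki: "k i < ord i" using i(2) le_funD[OF lower_le, of j ord i] by simp
  have bi: "bump j l m k i < ord i" if "l \<in> {..3}" "m \<in> {..3}" for l m
  proof -
    have "k(i := Suc (k i)) \<le> lower j ord"
      using k i(2) by (auto simp: le_fun_def)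
    then have "bump j l m (k(i := Suc (k i))) \<le> ord"
      using bump_le_of_lower ord that by auto
    then have "bump j l m (k(i := Suc (k i))) i \<le> ord i" by (rule le_funD)
    then show ?thesis by (simp add: bump_def)
  qed
  have b': "bump j l m (k(i := Suc (k i))) \<le> ord" if "l \<in> {..3}" "m \<in> {..3}" for l m
    using b[OF that] bi[OF that] unfolding bump_Suc_upd[symmetric] by (auto simp: le_fun_def)
  have int: "((\<lambda>t. \<integral>v. kap l m v * H (bump j l m k) (?s v (w(i := t))) \<partial>lborel) has_vector_derivative
     (\<integral>v. kap l m v * H (bump j l m (k(i := Suc (k i)))) (?s v w) \<partial>lborel)) (at (w i))"
    if lm: "l \<in> {..3}" "m \<in> {..3}" for l m
  proof -
    let ?h = "\<lambda>v t. H (bump j l m (k(i := Suc (k i)))) (?s v (w(i := t)))"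
    let ?B = "max (N * (\<Prod>i\<in>K. wt i ^ bump j l m k i)) (N * (\<Prod>i'\<in>K. wt i' ^ bump j l m (k(i := Suc (k i))) i'))"
    have "((\<lambda>t. \<integral>v. kap l m v * H (bump j l m k) (?s v (w(i := t))) \<partial>lborel) has_vector_derivative
     (\<integral>v. kap l m v * ?h v (w i) \<partial>lborel)) (at (w i))"
    proof (rule has_vector_derivative_slab_integral[where C="c l m" and B="?B"])
      fix v :: "real \<times> real \<times> real" and t :: real
      define e where "e = (if i = (j, False) then lam * fst v else if i = (j, True) then mu * (snd (snd v) * fst (snd v)) else 0)"
      have s: "?s v (w(i := t)) = (?s v w)(i := t + e)" for t
        unfolding bump_fun_upd e_def ..
      have "((\<lambda>t. H (bump j l m k) ((?s v w)(i := t))) has_vector_derivative ?h v t) (at (t + e))"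
        using HD(3)[OF b[OF lm] i(1) bi[OF lm], of "(?s v w)(i := t + e)"] by (simp add: s bump_Suc_upd)
      then have "((\<lambda>t. H (bump j l m k) ((?s v w)(i := t))) \<circ> (\<lambda>t. t + e) has_vector_derivative 1 *\<^sub>R ?h v t) (at t)"
        by (intro vector_diff_chain_at) (auto intro!: derivative_eq_intros)
      then show "((\<lambda>t. H (bump j l m k) (?s v (w(i := t)))) has_vector_derivative ?h v t) (at t)"
        by (simp add: s comp_def)
      show "norm (H (bump j l m k) (?s v (w(i := t)))) \<le> ?B"
        using HD(2)[OF b[OF lm]] by (auto simp: le_max_iff_disj)
      show "norm (?h v t) \<le> ?B"
        using HD(2)[OF b'[OF lm]] by (auto simp: le_max_iff_disj)
    qed (intro kap meas b[OF lm] b'[OF lm])+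
    then show ?thesis by simp
  qed
  show "((\<lambda>t. block_op lam mu kap j H k (w(i := t))) has_vector_derivative block_op lam mu kap j H (k(i := Suc (k i))) w) (at (w i))"
    unfolding block_op_def
    by (intro has_vector_derivative_add has_vector_derivative_sum has_vector_derivative_mult_right int HD k' i ki)
qed

lemma tendsto_block_op:
  fixes H :: "nat \<Rightarrow> 'b::countable jet"
  assumes H: "\<And>n. jet_family K wt ord N (H n)"
    and lim: "\<And>k w. k \<le> ord \<Longrightarrow> (\<lambda>n. H n k w) \<longlonglongrightarrow> H' k w"
    and kap: "\<And>n l m. kap n l m \<in> borel_measurable borel" "\<And>n l m v. norm (kap n l m v) \<le> c * slab_weight v"
      "\<And>l m v. (\<lambda>n. kap n l m v) \<longlonglongrightarrow> kap' l m v"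
    and ord: "3 \<le> ord (j, False)" "3 \<le> ord (j, True)"
    and k: "k \<le> lower j ord"
  shows "(\<lambda>n. block_op lam mu (kap n) j (H n) k w) \<longlonglongrightarrow> block_op lam mu kap' j H' k w"
  unfolding block_op_def
proof (intro tendsto_intros lim)
  show "k \<le> ord" using k lower_le by (rule order_trans)
  let ?s = "\<lambda>v::real \<times> real \<times> real. bump j (lam * fst v) (mu * (snd (snd v) * fst (snd v)))"
  fix l m :: nat assume "l \<in> {..3}" "m \<in> {..3}"
  then have b: "bump j l m k \<le> ord"
    using bump_le_of_lower[OF k ord] by auto
  note HD = jet_familyD[OF H b]
  show "(\<lambda>n. \<integral>v. kap n l m v * H n (bump j l m k) (?s v w) \<partial>lborel) \<longlonglongrightarrow>
    (\<integral>v. kap' l m v * H' (bump j l m k) (?s v w) \<partial>lborel)"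
  proof (rule tendsto_slab_integral)
    fix n v
    have "(\<lambda>v. H n (bump j l m k) (?s v w)) \<in> borel_measurable borel"
      by (intro borel_measurable_continuous_onI continuous_on_compose2[OF HD(1)] continuous_intros) auto
    then show "(\<lambda>v. kap n l m v * H n (bump j l m k) (?s v w)) \<in> borel_measurable borel"
      using kap(1) by measurable
    have "norm (kap n l m v * H n (bump j l m k) (?s v w)) \<le> (c * slab_weight v) * (N * (\<Prod>i\<in>K. wt i ^ bump j l m k i))"
      unfolding norm_mult using order_trans[OF norm_ge_zero kap(2)[of n l m v]]
      by (intro mult_mono kap HD) auto
    then show "norm (kap n l m v * H n (bump j l m k) (?s v w)) \<le> (c * (N * (\<Prod>i\<in>K. wt i ^ bump j l m k i))) * slab_weight v"
      by (simp add: mult_ac)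
  next
    fix v
    show "(\<lambda>n. kap n l m v * H n (bump j l m k) (?s v w)) \<longlonglongrightarrow> kap' l m v * H' (bump j l m k) (?s v w)"
      by (intro tendsto_intros kap lim b)
  qed
qed

text \<open>
  The integral over one block, in rescaled variables. The Gaussian damps the original variables
  \<open>lam * a\<close> and \<open>mu * b\<close>, hence the squares of the scales in the exponents.
\<close>
definition block_integral :: "real \<Rightarrow> real \<Rightarrow> real \<Rightarrow> 'b \<Rightarrow> (('b \<times> bool \<Rightarrow> real) \<Rightarrow> complex) \<Rightarrow>
    ('b \<times> bool \<Rightarrow> real) \<Rightarrow> complex" where
  "block_integral lam mu e j G w = (\<integral>v. (case v of (a, b) \<Rightarrow>
     osc a b * of_real (exp (- (e * lam\<^sup>2) * a\<^sup>2) * exp (- (e * mu\<^sup>2) * b\<^sup>2)) *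
     G (bump j (lam * a) (mu * b) w)) \<partial>lborel) / of_real pi"

text \<open>
  For fixed \<open>w\<close> and \<open>k\<close>, the restriction of the jet to the two coordinates of block \<open>j\<close> is a bounded
  family, with the powers of \<open>lam\<close> and \<open>mu\<close> from the chain rule.
\<close>
lemma block_integral_eq_block_op:
  fixes H :: "'b::countable jet"
  assumes H: "jet_family K wt ord N H" and K: "(j, False) \<in> K" "(j, True) \<in> K"
    and ord: "3 \<le> ord (j, False)" "3 \<le> ord (j, True)"
    and k: "k \<le> lower j ord"
    and lam: "lam \<noteq> 0" "mu \<noteq> 0" and e: "e > 0" "e * lam\<^sup>2 \<le> 1" "e * mu\<^sup>2 \<le> 1"
  shows "block_integral lam mu e j (H k) w = block_op lam mu (damped_kernel (e * lam\<^sup>2) (e * mu\<^sup>2)) j H k w"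
proof -
  have b: "bump j l m k \<le> ord" if "l \<le> 3" "m \<le> 3" for l m
    using bump_le_of_lower[OF k ord that] .
  note HD = jet_familyD[OF H b]
  define f where "f = (\<lambda>l m a b. of_real (lam ^ l * mu ^ m) * H (bump j l m k) (bump j (lam * a) (mu * b) w))"
  define c where "c = (\<lambda>l m. \<bar>lam ^ l * mu ^ m\<bar> * \<bar>N * (\<Prod>i\<in>K. wt i ^ bump j l m k i)\<bar>)"
  interpret f: bounded_family f "\<Sum>l\<le>3. \<Sum>m\<le>3. c l m"
  proof
    fix l m :: nat and a b :: real assume lm: "l \<le> 3" "m \<le> 3"
    show "continuous_on UNIV (\<lambda>(a, b). f l m a b)"
      unfolding f_def case_prod_unfold
      by (intro continuous_intros continuous_on_compose2[OF HD(1)[OF lm]]) auto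
    have "norm (f l m a b) \<le> c l m"
      unfolding f_def c_def norm_mult norm_of_real
      using order_trans[OF HD(2)[OF lm] abs_ge_self] by (intro mult_left_mono) auto
    also have "\<dots> \<le> (\<Sum>m\<le>3. c l m)"
      using lm by (intro member_le_sum) (auto simp: c_def)
    also have "\<dots> \<le> (\<Sum>l\<le>3. \<Sum>m\<le>3. c l m)"
      using lm by (intro member_le_sum[of _ _ "\<lambda>l. \<Sum>m\<le>3. c l m"]) (auto simp: c_def intro!: sum_nonneg)
    finally show "norm (f l m a b) \<le> (\<Sum>l\<le>3. \<Sum>m\<le>3. c l m)" .
  next
    fix l m :: nat and a b :: real assume lm: "l < 3" "m \<le> 3"
    let ?w = "bump j (lam * a) (mu * b) w"
    have lt: "bump j l m k (j, False) < ord (j, False)"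
      using le_funD[OF b[of "Suc l" m], of "(j, False)"] lm by (simp add: bump_def)
    have s: "bump j (lam * x) (mu * b) w = ?w((j, False) := w (j, False) + lam * x)" for x
      by (auto simp: bump_def)
    have "((\<lambda>t. H (bump j l m k) (?w((j, False) := t))) has_vector_derivative H (bump j (Suc l) m k) ?w) (at (w (j, False) + lam * a))"
      using HD(3)[of l m "(j, False)" ?w] lm K lt by (simp add: bump_Suc_fst) (simp add: bump_def)
    then have "((\<lambda>t. H (bump j l m k) (?w((j, False) := t))) \<circ> (\<lambda>x. w (j, False) + lam * x) has_vector_derivative
        lam *\<^sub>R H (bump j (Suc l) m k) ?w) (at a)"
      by (intro vector_diff_chain_at) (auto intro!: derivative_eq_intros)
    then have "((\<lambda>x. H (bump j l m k) (bump j (lam * x) (mu * b) w)) has_vector_derivative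
        lam *\<^sub>R H (bump j (Suc l) m k) ?w) (at a)"
      by (simp add: s[symmetric] comp_def)
    from has_vector_derivative_mult_right[OF this, of "of_real (lam ^ l * mu ^ m)"]
    show "((\<lambda>a. f l m a b) has_vector_derivative f (Suc l) m a b) (at a)"
      by (simp add: f_def scaleR_conv_of_real mult_ac)
  next
    fix l m :: nat and a b :: real assume lm: "l \<le> 3" "m < 3"
    let ?w = "bump j (lam * a) (mu * b) w"
    have lt: "bump j l m k (j, True) < ord (j, True)"
      using le_funD[OF b[of l "Suc m"], of "(j, True)"] lm by (simp add: bump_def)
    have s: "bump j (lam * a) (mu * x) w = ?w((j, True) := w (j, True) + mu * x)" for x
      by (auto simp: bump_def)
    have "((\<lambda>t. H (bump j l m k) (?w((j, True) := t))) has_vector_derivative H (bump j l (Suc m) k) ?w) (at (w (j, True) + mu * b))"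
      using HD(3)[of l m "(j, True)" ?w] lm K lt by (simp add: bump_Suc_snd) (simp add: bump_def)
    then have "((\<lambda>t. H (bump j l m k) (?w((j, True) := t))) \<circ> (\<lambda>x. w (j, True) + mu * x) has_vector_derivative
        mu *\<^sub>R H (bump j l (Suc m) k) ?w) (at b)"
      by (intro vector_diff_chain_at) (auto intro!: derivative_eq_intros)
    then have "((\<lambda>x. H (bump j l m k) (bump j (lam * a) (mu * x) w)) has_vector_derivative
        mu *\<^sub>R H (bump j l (Suc m) k) ?w) (at b)"
      by (simp add: s[symmetric] comp_def)
    from has_vector_derivative_mult_right[OF this, of "of_real (lam ^ l * mu ^ m)"]
    show "((\<lambda>b. f l m a b) has_vector_derivative f l (Suc m) a b) (at b)"
      by (simp add: f_def scaleR_conv_of_real mult_ac)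
  qed
  have "block_integral lam mu e j (H k) w = (\<integral>v. (case v of (a, b) \<Rightarrow>
     osc a b * of_real (exp (- (e * lam\<^sup>2) * a\<^sup>2) * exp (- (e * mu\<^sup>2) * b\<^sup>2)) * f 0 0 a b) \<partial>lborel) / of_real pi"
    by (simp add: block_integral_def f_def)
  also have "\<dots> = f 0 0 0 0 + (\<Sum>l\<le>3. \<Sum>m\<le>3. \<integral>v. damped_kernel (e * lam\<^sup>2) (e * mu\<^sup>2) l m v *
      f l m (fst v) (snd (snd v) * fst (snd v)) \<partial>lborel)"
    using lam e by (intro f.damped_osc_expansion) auto
  also have "\<dots> = block_op lam mu (damped_kernel (e * lam\<^sup>2) (e * mu\<^sup>2)) j H k w"
    by (simp add: block_op_def f_def mult.left_commute[of "damped_kernel _ _ _ _ _"] del: of_real_mult of_real_power)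
  finally show ?thesis .
qed

section \<open>Iteration over the blocks and removal of the damping\<close>

lemma jet_family_N_nonneg:
  assumes "jet_family K wt ord N H" shows "N \<ge> 0"
proof -
  have "(\<lambda>_. 0) \<le> ord" by (simp add: le_fun_def)
  from jet_familyD(2)[OF assms this, of undefined] have "norm (H (\<lambda>_. 0) undefined) \<le> N"
    by simp
  then show ?thesis using norm_ge_zero order_trans by blast
qed

lemma jet_family_mono:
  assumes H: "jet_family K wt ord N H" and wt: "\<And>i. i \<in> K \<Longrightarrow> 0 \<le> wt i" and N: "N \<le> N'"
  shows "jet_family K wt ord N' H"
  unfolding jet_family_def
proof (intro allI impI conjI ballI)
  fix k w assume k: "k \<le> ord"
  show "norm (H k w) \<le> N' * (\<Prod>i\<in>K. wt i ^ k i)"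
    using jet_familyD(2)[OF H k] mult_right_mono[OF N] wt
    by (meson order_trans prod_nonneg zero_le_power)
qed (use jet_familyD[OF H] in auto)

lemma slab_mass_nonneg: "slab_mass \<ge> 0"
  by (intro Bochner_Integration.integral_nonneg) simp

text \<open>
  There are 16 orders \<open>(l, m)\<close>, and 7603200 is the constant of \<open>norm_damped_kernel\<close>.
\<close>
definition block_const :: real where "block_const = 16 * 7603200 * slab_mass"

lemma block_const_nonneg: "block_const \<ge> 0"
  using slab_mass_nonneg by (simp add: block_const_def)

lemma block_factor_le:
  assumes p: "0 \<le> p" "p \<le> 1" and q: "0 \<le> q" "q \<le> 1"
  shows "block_factor (\<lambda>l m. if l = 0 \<or> m = 0 then 0 else 7603200) p q \<le> 1 + block_const * (p * q)"
    and "block_factor (\<lambda>l m. 7603200) p q \<le> 1 + block_const"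
proof -
  have pw: "x ^ Suc n \<le> x" if "0 \<le> x" "x \<le> 1" for x :: real and n
    using power_decreasing[of 1 "Suc n" x] that by simp
  have "(\<Sum>l\<le>3::nat. \<Sum>m\<le>3::nat. (if l = 0 \<or> m = 0 then 0 else 7603200) * slab_mass * p ^ l * q ^ m)
      \<le> (\<Sum>l\<le>3::nat. \<Sum>m\<le>3::nat. 7603200 * slab_mass * (p * q))"
  proof (intro sum_mono)
    fix l m :: nat
    show "(if l = 0 \<or> m = 0 then 0 else 7603200) * slab_mass * p ^ l * q ^ m \<le> 7603200 * slab_mass * (p * q)"
    proof (cases "l = 0 \<or> m = 0")
      case False
      then obtain l' m' where lm: "l = Suc l'" "m = Suc m'" by (metis not0_implies_Suc)
      have "p ^ l * q ^ m \<le> p * q"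
        unfolding lm using p q by (intro mult_mono pw) auto
      from mult_left_mono[OF this, of "7603200 * slab_mass"] show ?thesis
        using False slab_mass_nonneg by (simp add: mult.assoc)
    qed (use p q slab_mass_nonneg in auto)
  qed
  then show "block_factor (\<lambda>l m. if l = 0 \<or> m = 0 then 0 else 7603200) p q \<le> 1 + block_const * (p * q)"
    by (simp add: block_factor_def block_const_def)
  have "(\<Sum>l\<le>3::nat. \<Sum>m\<le>3::nat. 7603200 * slab_mass * p ^ l * q ^ m) \<le> (\<Sum>l\<le>3::nat. \<Sum>m\<le>3::nat. 7603200 * slab_mass * 1 * 1)"
    using p q slab_mass_nonneg by (intro sum_mono mult_mono power_le_one) auto
  then show "block_factor (\<lambda>l m. 7603200) p q \<le> 1 + block_const"
    by (simp add: block_factor_def block_const_def)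
qed

lemma fold_lower:
  "distinct js \<Longrightarrow> fold lower js ord = (\<lambda>i. if fst i \<in> set js then ord i - 3 else ord i)"
  by (induction js arbitrary: ord) (auto simp: lower_def)

lemma fold_lower_le: "fold lower js ord \<le> ord"
proof (induction js arbitrary: ord)
  case (Cons j js)
  then show ?case using order_trans[OF Cons.IH lower_le] by simp
qed simp

text \<open>
  The scales \<open>lam j\<close> and \<open>mu j\<close> are such that a derivative in a rescaled variable of block \<open>j\<close> costs
  at most a factor 1.
\<close>
locale weyl_blocks =
  fixes J :: "'b::countable set" and wt :: "'b \<times> bool \<Rightarrow> real" and lam mu :: "'b \<Rightarrow> real"
  assumes finite_J: "finite J"
    and wt_nonneg: "j \<in> J \<Longrightarrow> 0 \<le> wt (j, d)"
    and nonzero: "j \<in> J \<Longrightarrow> lam j \<noteq> 0" "j \<in> J \<Longrightarrow> mu j \<noteq> 0"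
    and scale_le: "j \<in> J \<Longrightarrow> \<bar>lam j\<bar> * wt (j, False) \<le> 1" "j \<in> J \<Longrightarrow> \<bar>mu j\<bar> * wt (j, True) \<le> 1"
begin

abbreviation "jets \<equiv> jet_family (J \<times> UNIV) wt"

definition step :: "real \<Rightarrow> 'b \<Rightarrow> 'b jet \<Rightarrow>
    'b jet" where
  "step e j = block_op (lam j) (mu j) (damped_kernel (e * (lam j)\<^sup>2) (e * (mu j)\<^sup>2)) j"

definition integral_step :: "real \<Rightarrow> 'b \<Rightarrow> (('b \<times> bool \<Rightarrow> real) \<Rightarrow> complex) \<Rightarrow> ('b \<times> bool \<Rightarrow> real) \<Rightarrow> complex" where
  "integral_step e j = block_integral (lam j) (mu j) e j"

text \<open>
  The range of damping parameters for which the bounds on the damped kernels are uniform.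
\<close>
definition small :: "real \<Rightarrow> bool" where
  "small e \<longleftrightarrow> 0 \<le> e \<and> (\<forall>j\<in>J. e * (lam j)\<^sup>2 \<le> 1 \<and> e * (mu j)\<^sup>2 \<le> 1)"

text \<open>
  The cost of one derivative in each rescaled variable of block \<open>j\<close>. For the Weyl composition this
  is \<open>h \<rho>\<^sub>j \<delta>\<^sub>j\<close>.
\<close>
definition coupling :: "'b \<Rightarrow> real" where
  "coupling j = \<bar>lam j\<bar> * wt (j, False) * (\<bar>mu j\<bar> * wt (j, True))"

lemma wt_nonneg': "i \<in> J \<times> UNIV \<Longrightarrow> 0 \<le> wt i"
  using wt_nonneg by (cases i) auto

text \<open>
  With damping the bound is merely uniform in \<open>e\<close>, as dominated convergence requires. The factor of the
  limit tends to 1 with the coupling, because the kernels of order \<open>(0, m)\<close> and \<open>(l, 0)\<close> are gone.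
\<close>
lemma jets_step:
  assumes "jets ord N H" "j \<in> J" "\<And>d. 3 \<le> ord (j, d)" "small e"
  shows "jets (lower j ord) (N * (1 + block_const)) (step e j H)"
    and "jets (lower j ord) (N * (1 + block_const * coupling j)) (step 0 j H)"
proof -
  have pq: "0 \<le> \<bar>lam j\<bar> * wt (j, False)" "\<bar>lam j\<bar> * wt (j, False) \<le> 1"
     "0 \<le> \<bar>mu j\<bar> * wt (j, True)" "\<bar>mu j\<bar> * wt (j, True) \<le> 1"
    using assms(2) wt_nonneg scale_le by auto
  note factor = block_factor_le[OF pq]
  have N: "N \<ge> 0" using assms(1) by (rule jet_family_N_nonneg)
  have K: "finite (J \<times> (UNIV::bool set))" "(j, False) \<in> J \<times> UNIV" "(j, True) \<in> J \<times> UNIV"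
    using assms(2) finite_J by auto
  have "jets (lower j ord) (N * block_factor (\<lambda>l m. 7603200) (\<bar>lam j\<bar> * wt (j, False)) (\<bar>mu j\<bar> * wt (j, True))) (step e j H)"
    unfolding step_def using assms
    by (intro jet_family_block_op K measurable_damped_kernel norm_damped_kernel) (auto simp: small_def)
  then show "jets (lower j ord) (N * (1 + block_const)) (step e j H)"
    by (rule jet_family_mono) (use wt_nonneg' mult_left_mono[OF factor(2) N] in auto)
  have "norm (damped_kernel 0 0 l m v) \<le> (if l = 0 \<or> m = 0 then 0 else 7603200) * slab_weight v" for l m v
    using norm_damped_kernel[of 0 0 l m v] damped_kernel_0_eq_0[of l m v] by auto
  then have "jets (lower j ord) (N * block_factor (\<lambda>l m. if l = 0 \<or> m = 0 then 0 else 7603200) (\<bar>lam j\<bar> * wt (j, False)) (\<bar>mu j\<bar> * wt (j, True))) (step 0 j H)"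
    unfolding step_def using assms
    by (intro jet_family_block_op K) auto
  then show "jets (lower j ord) (N * (1 + block_const * coupling j)) (step 0 j H)"
    unfolding coupling_def
    by (rule jet_family_mono) (use wt_nonneg' mult_left_mono[OF factor(1) N] in auto)
qed

lemma small_0: "small 0"
  by (simp add: small_def)

lemma integral_step_eq:
  assumes "jets ord N H" "j \<in> J" "\<And>d. 3 \<le> ord (j, d)" "small e" "e > 0" "k \<le> lower j ord"
  shows "integral_step e j (H k) w = step e j H k w"
  unfolding integral_step_def step_def using assms nonzero[of j]
  by (intro block_integral_eq_block_op[OF assms(1)]) (auto simp: small_def)

text \<open>
  After one block integral has been expanded, the result is again a jet family, with unchanged orders
  in the coordinates of the other blocks. So the next one can be expanded as well.
\<close>
lemma fold_integral_step_eq: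
  assumes "jets ord N H" "distinct js" "set js \<subseteq> J" "\<And>j d. j \<in> set js \<Longrightarrow> 3 \<le> ord (j, d)"
    "small e" "e > 0" "k \<le> fold lower js ord"
  shows "fold (integral_step e) js (H k) w = fold (step e) js H k w"
  using assms
proof (induction js arbitrary: ord N H)
  case (Cons j js)
  have jJ: "j \<in> J" and j: "\<And>d. 3 \<le> ord (j, d)" using Cons.prems by auto
  have k: "k \<le> lower j ord"
    using Cons.prems(7) order_trans[OF _ fold_lower_le] by simp
  have "integral_step e j (H k) = step e j H k"
    using integral_step_eq[OF Cons.prems(1) jJ j Cons.prems(5,6) k] by blast
  moreover have "fold (integral_step e) js (step e j H k) w = fold (step e) js (step e j H) k w"
  proof (rule Cons.IH[OF jets_step(1)[OF Cons.prems(1) jJ j Cons.prems(5)]])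
    show "3 \<le> lower j ord (j', d)" if "j' \<in> set js" for j' d
      using Cons.prems that by (auto simp: lower_def)
  qed (use Cons.prems in auto)
  ultimately show ?case by simp
qed simp

lemma jets_fold_step:
  assumes "jets ord N H" "distinct js" "set js \<subseteq> J" "\<And>j d. j \<in> set js \<Longrightarrow> 3 \<le> ord (j, d)"
  shows "jets (fold lower js ord) (N * (\<Prod>j\<leftarrow>js. 1 + block_const * coupling j)) (fold (step 0) js H)"
  using assms
proof (induction js arbitrary: ord N H)
  case (Cons j js)
  have "jets (fold lower js (lower j ord)) (N * (1 + block_const * coupling j) * (\<Prod>j\<leftarrow>js. 1 + block_const * coupling j))
     (fold (step 0) js (step 0 j H))"
  proof (rule Cons.IH[OF jets_step(2)[OF Cons.prems(1) _ _ small_0]])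
    show "3 \<le> lower j ord (j', d)" if "j' \<in> set js" for j' d
      using Cons.prems that by (auto simp: lower_def)
  qed (use Cons.prems in auto)
  then show ?case by (simp add: mult.assoc)
qed simp

lemma tendsto_fold_step:
  assumes "\<And>n. jets ord N (H n)" "distinct js" "set js \<subseteq> J" "\<And>j d. j \<in> set js \<Longrightarrow> 3 \<le> ord (j, d)"
    "\<And>n. small (X n)" "X \<longlonglongrightarrow> 0"
    "\<And>k w. k \<le> ord \<Longrightarrow> (\<lambda>n. H n k w) \<longlonglongrightarrow> H' k w"
    "k \<le> fold lower js ord"
  shows "(\<lambda>n. fold (step (X n)) js (H n) k w) \<longlonglongrightarrow> fold (step 0) js H' k w"
  using assms
proof (induction js arbitrary: ord N H H')
  case (Cons j js)
  have jJ: "j \<in> J" and j: "\<And>d. 3 \<le> ord (j, d)" using Cons.prems by auto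
  have "(\<lambda>n. fold (step (X n)) js (step (X n) j (H n)) k w) \<longlonglongrightarrow> fold (step 0) js (step 0 j H') k w"
  proof (rule Cons.IH[OF jets_step(1)[OF Cons.prems(1) jJ j Cons.prems(5)]])
    show "3 \<le> lower j ord (j', d)" if "j' \<in> set js" for j' d
      using Cons.prems that by (auto simp: lower_def)
    fix k w assume k: "k \<le> lower j ord"
    have lims: "(\<lambda>n. X n * (lam j)\<^sup>2) \<longlonglongrightarrow> 0" "(\<lambda>n. X n * (mu j)\<^sup>2) \<longlonglongrightarrow> 0"
      using tendsto_mult_right[OF Cons.prems(6), of "(lam j)\<^sup>2"]
        tendsto_mult_right[OF Cons.prems(6), of "(mu j)\<^sup>2"] by simp_all
    show "(\<lambda>n. step (X n) j (H n) k w) \<longlonglongrightarrow> step 0 j H' k w"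
      unfolding step_def using Cons.prems(5) jJ
      by (intro tendsto_block_op[OF Cons.prems(1) Cons.prems(7) _ _ _ j j k, where c=7603200])
         (auto simp: small_def intro!: norm_damped_kernel tendsto_damped_kernel lims)
  qed (use Cons.prems in auto)
  then show ?case by simp
qed simp

lemma small_eventually: "\<exists>e0>0. \<forall>e. 0 \<le> e \<and> e \<le> e0 \<longrightarrow> small e"
proof -
  define S where "S = (\<Sum>j\<in>J. (lam j)\<^sup>2 + (mu j)\<^sup>2)"
  have S: "(lam j)\<^sup>2 + (mu j)\<^sup>2 \<le> S" if "j \<in> J" for j
    unfolding S_def using finite_J that by (intro member_le_sum) auto
  have S0: "S \<ge> 0" unfolding S_def by (intro sum_nonneg) auto
  have "small e" if e: "0 \<le> e" "e \<le> 1 / (1 + S)" for e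
    unfolding small_def
  proof (intro conjI ballI)
    fix j assume j: "j \<in> J"
    have "e * x \<le> 1" if "0 \<le> x" "x \<le> 1 + S" for x
      using mult_mono[OF e(2) that(2)] e that S0 by simp
    moreover have "(lam j)\<^sup>2 \<le> 1 + S" "(mu j)\<^sup>2 \<le> 1 + S"
      using S[OF j] zero_le_power2[of "lam j"] zero_le_power2[of "mu j"] by linarith+
    ultimately show "e * (lam j)\<^sup>2 \<le> 1" "e * (mu j)\<^sup>2 \<le> 1" by auto
  qed (use e in auto)
  then show ?thesis using S0 by (intro exI[of _ "1 / (1 + S)"]) auto
qed

text \<open>
  Along a sequence of damping parameters, which may be taken small, the block integrals are block
  operators, and these converge one block at a time.
\<close>
theorem tendsto_fold_integral_step:
  assumes H: "jets ord N H" "distinct js" "set js \<subseteq> J" "\<And>j d. j \<in> set js \<Longrightarrow> 3 \<le> ord (j, d)"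
    and k: "k \<le> fold lower js ord"
  shows "((\<lambda>e. fold (integral_step e) js (H k) w) \<longlongrightarrow> fold (step 0) js H k w) (at_right 0)"
  unfolding tendsto_at_iff_sequentially
proof (intro allI impI)
  fix X :: "nat \<Rightarrow> real" assume X: "\<forall>i. X i \<in> {0<..} - {0}" "X \<longlonglongrightarrow> 0"
  obtain e0 where e0: "e0 > 0" "\<And>e. 0 \<le> e \<Longrightarrow> e \<le> e0 \<Longrightarrow> small e"
    using small_eventually by blast
  have pos: "X n > 0" for n using X(1) by auto
  obtain n0 where n0: "\<And>n. n \<ge> n0 \<Longrightarrow> X n < e0"
    using order_tendstoD(2)[OF X(2) e0(1)] by (auto simp: eventually_sequentially)
  have sm: "small (X (n + n0))" for n
    using e0(2) pos n0 by (simp add: less_imp_le)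
  have "(\<lambda>n. fold (step (X (n + n0))) js H k w) \<longlonglongrightarrow> fold (step 0) js H k w"
    by (rule tendsto_fold_step[OF H sm _ _ k]) (auto intro!: LIMSEQ_ignore_initial_segment X)
  then have "(\<lambda>n. fold (integral_step (X (n + n0))) js (H k) w) \<longlonglongrightarrow> fold (step 0) js H k w"
    using fold_integral_step_eq[OF H sm pos k] by simp
  then show "((\<lambda>e. fold (integral_step e) js (H k) w) \<circ> X) \<longlonglongrightarrow> fold (step 0) js H k w"
    unfolding comp_def by (rule LIMSEQ_offset)
qed

end

section \<open>Product integrals as iterated block integrals\<close>

lemma integrable_gaussian:
  assumes "s > 0" shows "integrable lborel (\<lambda>x::real. exp (- s * x\<^sup>2))"
  using integrable_norm[OF gaussian_osc_integral(1)[OF assms, of 0]] by (simp add: norm_mult)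

interpretation lborel_PiM: product_sigma_finite "\<lambda>_. lborel :: real measure"
  by standard

lemma measurable_PiM_insert_two:
  assumes K: "a \<notin> K" "b \<notin> K" "a \<noteq> b"
  shows "(\<lambda>((p, q), x). x(a := p, b := q)) \<in>
    measurable ((lborel \<Otimes>\<^sub>M lborel) \<Otimes>\<^sub>M PiM K (\<lambda>_. lborel))
      (PiM (insert a (insert b K)) (\<lambda>_. lborel :: real measure))" (is "?f \<in> measurable ?M ?N")
proof (rule measurable_PiM_single')
  fix i assume i: "i \<in> insert a (insert b K)"
  have "(\<lambda>v. (snd v) i) \<in> measurable ?M lborel" if "i \<in> K"
    using that by (intro measurable_compose[OF measurable_snd] measurable_component_singleton)
  moreover have "(\<lambda>v. fst (fst v)) \<in> measurable ?M lborel" "(\<lambda>v. snd (fst v)) \<in> measurable ?M lborel"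
    by measurable
  ultimately show "(\<lambda>v. ?f v i) \<in> measurable ?M lborel"
    using i K by (cases "i = a"; cases "i = b") (auto simp: case_prod_unfold)
next
  show "?f \<in> space ?M \<rightarrow> (\<Pi>\<^sub>E i\<in>insert a (insert b K). space lborel)"
    by (auto simp: space_pair_measure space_PiM PiE_iff extensional_def split: if_splits)
qed

text \<open>
  It suffices to compare boxes, and the preimage of a box is a box.
\<close>
lemma distr_PiM_insert_two:
  fixes K :: "'i set"
  assumes K: "finite K" "a \<notin> K" "b \<notin> K" "a \<noteq> b"
  shows "distr ((lborel \<Otimes>\<^sub>M lborel) \<Otimes>\<^sub>M PiM K (\<lambda>_. lborel)) (PiM (insert a (insert b K)) (\<lambda>_. lborel :: real measure))
      (\<lambda>((p, q), x). x(a := p, b := q)) = PiM (insert a (insert b K)) (\<lambda>_. lborel)" (is "distr ?M ?N ?f = _")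
proof (rule lborel_PiM.PiM_eqI)
  note [measurable] = measurable_PiM_insert_two[OF K(2-4)]
  fix A :: "'i \<Rightarrow> real set" assume A: "\<And>i. i \<in> insert a (insert b K) \<Longrightarrow> A i \<in> sets lborel"
  have pre: "?f -` Pi\<^sub>E (insert a (insert b K)) A \<inter> space ?M = (A a \<times> A b) \<times> Pi\<^sub>E K A"
  proof (intro set_eqI iffI)
    fix v assume v: "v \<in> ?f -` Pi\<^sub>E (insert a (insert b K)) A \<inter> space ?M"
    obtain p q x where [simp]: "v = ((p, q), x)" by (cases v) auto
    have x: "x \<in> extensional K" using v by (auto simp: space_pair_measure space_PiM PiE_iff)
    have *: "(x(a := p, b := q)) i \<in> A i" if "i \<in> insert a (insert b K)" for i
      using v that by (auto simp: PiE_iff)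
    have "x i \<in> A i" if "i \<in> K" for i
      using *[of i] that K by (metis fun_upd_other insert_iff)
    then show "v \<in> (A a \<times> A b) \<times> Pi\<^sub>E K A"
      using *[of a] *[of b] K x by (auto simp: PiE_iff)
  next
    fix v assume "v \<in> (A a \<times> A b) \<times> Pi\<^sub>E K A"
    then show "v \<in> ?f -` Pi\<^sub>E (insert a (insert b K)) A \<inter> space ?M"
      using K by (auto simp: space_pair_measure space_PiM PiE_iff extensional_def)
  qed
  interpret K: finite_product_sigma_finite "\<lambda>_. lborel :: real measure" K by standard fact
  have "emeasure (distr ?M ?N ?f) (Pi\<^sub>E (insert a (insert b K)) A) = emeasure ?M ((A a \<times> A b) \<times> Pi\<^sub>E K A)"
    using A K by (subst emeasure_distr) (auto simp: pre intro!: sets_PiM_I_finite)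
  also have "\<dots> = emeasure lborel (A a) * emeasure lborel (A b) * (\<Prod>i\<in>K. emeasure lborel (A i))"
    using A K by (subst K.emeasure_pair_measure_Times)
      (auto simp: lborel.emeasure_pair_measure_Times lborel_PiM.emeasure_PiM intro!: sets_PiM_I_finite)
  also have "\<dots> = (\<Prod>i\<in>insert a (insert b K). emeasure lborel (A i))"
    using K by (simp add: mult.assoc)
  finally show "emeasure (distr ?M ?N ?f) (Pi\<^sub>E (insert a (insert b K)) A) = (\<Prod>i\<in>insert a (insert b K). emeasure lborel (A i))" .
qed (use K in auto)

definition shifted :: "'b set \<Rightarrow> ('b \<times> bool \<Rightarrow> real) \<Rightarrow> ('b \<times> bool \<Rightarrow> real) \<Rightarrow> 'b \<times> bool \<Rightarrow> real" where
  "shifted S w x = (\<lambda>i. if fst i \<in> S then w i + x i else w i)"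

abbreviation "box_measure S \<equiv> PiM (S \<times> (UNIV :: bool set)) (\<lambda>_. lborel :: real measure)"

context weyl_blocks
begin

text \<open>
  The factor that block \<open>j\<close> contributes to the Weyl integrand, in the original variables. With
  \<open>p = lam j * a\<close> and \<open>q = mu j * b\<close> the phase becomes \<open>2 a b\<close>.
\<close>
definition block_weight :: "real \<Rightarrow> 'b \<Rightarrow> real \<Rightarrow> real \<Rightarrow> complex" where
  "block_weight e j p q = cis (2 * p * q / (lam j * mu j)) * of_real (exp (- e * p\<^sup>2) * exp (- e * q\<^sup>2))"

lemma norm_block_weight: "norm (block_weight e j p q) = exp (- e * p\<^sup>2) * exp (- e * q\<^sup>2)"
  by (simp add: block_weight_def norm_mult)

lemma continuous_block_weight [continuous_intros]:
  "continuous_on S p \<Longrightarrow> continuous_on S q \<Longrightarrow> continuous_on S (\<lambda>x. block_weight e j (p x) (q x))"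
  unfolding block_weight_def divide_inverse by (intro continuous_intros)

lemma integrable_block:
  assumes e: "e > 0" and G: "continuous_on UNIV G" "\<And>w. norm (G w) \<le> B" and c: "c \<noteq> 0" "d \<noteq> 0"
  shows "integrable lborel (\<lambda>(a, b). block_weight e j (c * a) (d * b) * G (bump j (c * a) (d * b) w))"
proof (rule integrable_product_bound)
  have "continuous_on UNIV (\<lambda>(a, b). block_weight e j (c * a) (d * b) * G (bump j (c * a) (d * b) w))"
    unfolding case_prod_unfold
    by (intro continuous_intros continuous_on_compose2[OF G(1)]) auto
  then show "(\<lambda>(a, b). block_weight e j (c * a) (d * b) * G (bump j (c * a) (d * b) w)) \<in> borel_measurable borel"
    by (rule borel_measurable_continuous_onI)
  show "integrable lborel (\<lambda>a. exp (- (e * c\<^sup>2) * a\<^sup>2))" "integrable lborel (\<lambda>b. exp (- (e * d\<^sup>2) * b\<^sup>2) * B)"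
    using e c integrable_gaussian[of "e * c\<^sup>2"] integrable_gaussian[of "e * d\<^sup>2"] by auto
  show "norm (case (a, b) of (a, b) \<Rightarrow> block_weight e j (c * a) (d * b) * G (bump j (c * a) (d * b) w))
     \<le> exp (- (e * c\<^sup>2) * a\<^sup>2) * (exp (- (e * d\<^sup>2) * b\<^sup>2) * B)" for a b
    using mult_left_mono[OF G(2), of "exp (- (e * c\<^sup>2) * a\<^sup>2) * exp (- (e * d\<^sup>2) * b\<^sup>2)"]
    by (simp add: norm_mult norm_block_weight power_mult_distrib mult_ac)
qed

lemma block_weight_scaled:
  assumes "j \<in> J"
  shows "block_weight e j (lam j * a) (mu j * b) =
    osc a b * of_real (exp (- (e * (lam j)\<^sup>2) * a\<^sup>2) * exp (- (e * (mu j)\<^sup>2) * b\<^sup>2))"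
  using nonzero[OF assms] by (simp add: block_weight_def power_mult_distrib mult_ac)

lemma integral_block:
  assumes e: "e > 0" and G: "continuous_on UNIV G" "\<And>w. norm (G w) \<le> B" and j: "j \<in> J"
  shows "(\<integral>v. (case v of (p, q) \<Rightarrow> block_weight e j p q * G (bump j p q w)) \<partial>lborel) =
    of_real (pi * \<bar>lam j * mu j\<bar>) * integral_step e j G w"
proof -
  let ?f = "\<lambda>p q. block_weight e j p q * G (bump j p q w)"
  have int: "integrable (lborel \<Otimes>\<^sub>M lborel) (\<lambda>(a, b). ?f (c * a) (d * b))" if "c \<noteq> 0" "d \<noteq> 0" for c d
    using integrable_block[OF e G that] by (simp add: lborel_prod)
  have "(\<integral>v. (case v of (p, q) \<Rightarrow> ?f p q) \<partial>lborel) = (\<integral>p. (\<integral>q. ?f p q \<partial>lborel) \<partial>lborel)"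
    using lborel_pair.integral_fst[OF int[of 1 1]] by (simp add: lborel_prod)
  also have "\<dots> = \<bar>lam j\<bar> *\<^sub>R (\<integral>a. (\<integral>q. ?f (0 + lam j * a) q \<partial>lborel) \<partial>lborel)"
    by (rule lborel_integral_real_affine) (rule nonzero[OF j])
  also have "(\<lambda>a. \<integral>q. ?f (0 + lam j * a) q \<partial>lborel) = (\<lambda>a. \<bar>mu j\<bar> *\<^sub>R (\<integral>b. ?f (0 + lam j * a) (0 + mu j * b) \<partial>lborel))"
    by (intro ext lborel_integral_real_affine) (rule nonzero[OF j])
  also have "\<bar>lam j\<bar> *\<^sub>R (\<integral>a. \<bar>mu j\<bar> *\<^sub>R (\<integral>b. ?f (0 + lam j * a) (0 + mu j * b) \<partial>lborel) \<partial>lborel) =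
     of_real \<bar>lam j * mu j\<bar> * (\<integral>a. (\<integral>b. ?f (lam j * a) (mu j * b) \<partial>lborel) \<partial>lborel)"
    by (simp add: scaleR_conv_of_real abs_mult)
  also have "(\<integral>a. (\<integral>b. ?f (lam j * a) (mu j * b) \<partial>lborel) \<partial>lborel) = 
     (\<integral>v. (case v of (a, b) \<Rightarrow> ?f (lam j * a) (mu j * b)) \<partial>lborel)"
    using lborel_pair.integral_fst[OF int[OF nonzero[OF j]]] by (simp add: lborel_prod)
  also have "\<dots> = of_real pi * integral_step e j G w"
    by (simp add: integral_step_def block_integral_def block_weight_scaled[OF j] case_prod_unfold)
  finally show ?thesis by simp
qed

lemma integral_step_continuous_bounded:
  assumes e: "e > 0" and G: "continuous_on UNIV G" "\<And>w. norm (G w) \<le> B" and j: "j \<in> J"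
  shows "continuous_on UNIV (integral_step e j G)" "\<exists>B. \<forall>w. norm (integral_step e j G w) \<le> B"
proof -
  define f where "f = (\<lambda>w (a, b). block_weight e j (lam j * a) (mu j * b) * G (bump j (lam j * a) (mu j * b) w))"
  have step: "integral_step e j G w = integral\<^sup>L lborel (f w) / of_real pi" for w
    by (simp add: integral_step_def block_integral_def f_def block_weight_scaled[OF j] case_prod_unfold)
  define g where "g = (\<lambda>(a, b). exp (- (e * (lam j)\<^sup>2) * a\<^sup>2) * exp (- (e * (mu j)\<^sup>2) * b\<^sup>2) :: real)"
  have g: "integrable lborel g"
    unfolding g_def using e nonzero[OF j]
    by (intro integrable_mult_pair integrable_gaussian) auto
  have int: "integrable lborel (f w)" for w
    unfolding f_def by (rule integrable_block[OF e G nonzero[OF j]])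
  have le: "norm (f w v) \<le> g v * B" for w v
    using mult_left_mono[OF G(2), of "g v"]
    by (cases v) (simp add: f_def g_def norm_mult norm_block_weight power_mult_distrib mult_ac)
  have "continuous_on UNIV (\<lambda>w. integral\<^sup>L lborel (f w))"
  proof (rule continuous_on_sequentiallyI)
    fix u :: "nat \<Rightarrow> 'b \<times> bool \<Rightarrow> real" and x assume u: "u \<longlonglongrightarrow> x"
    show "(\<lambda>n. integral\<^sup>L lborel (f (u n))) \<longlonglongrightarrow> integral\<^sup>L lborel (f x)"
    proof (rule integral_dominated_convergence[where w="\<lambda>v. g v * B"])
      show "AE v in lborel. (\<lambda>n. f (u n) v) \<longlonglongrightarrow> f x v"
      proof (rule always_eventually, rule allI)
        fix v :: "real \<times> real"
        have "continuous_on UNIV (\<lambda>w. f w v)"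
          unfolding f_def case_prod_unfold
          by (intro continuous_intros continuous_on_compose2[OF G(1)]) auto
        from continuous_on_tendsto_compose[OF this u]
        show "(\<lambda>n. f (u n) v) \<longlonglongrightarrow> f x v" by simp
      qed
    qed (use int g le in auto)
  qed
  then show "continuous_on UNIV (integral_step e j G)"
    unfolding step[abs_def] divide_inverse by (intro continuous_intros)
  have "norm (integral\<^sup>L lborel (f w)) \<le> (\<integral>v. g v * B \<partial>lborel)" for w
    using int g le by (intro Bochner_Integration.integral_norm_bound_integral) auto
  then show "\<exists>B. \<forall>w. norm (integral_step e j G w) \<le> B"
    unfolding step norm_divide by (intro exI[of _ "(\<integral>v. g v * B \<partial>lborel) / pi"]) (auto intro: divide_right_mono)
qed

lemma integrable_box:
  assumes S: "finite S" and e: "e > 0" and G: "continuous_on UNIV G" "\<And>w. norm (G w) \<le> B"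
  shows "integrable (box_measure S) (\<lambda>x. (\<Prod>j\<in>S. block_weight e j (x (j, False)) (x (j, True))) * G (shifted S w x))"
proof (rule Bochner_Integration.integrable_bound)
  have "integrable (box_measure S) (\<lambda>x. \<Prod>i\<in>S \<times> UNIV. exp (- e * (x i)\<^sup>2) :: real)"
    using S e by (intro lborel_PiM.product_integrable_prod integrable_gaussian) auto
  then show "integrable (box_measure S) (\<lambda>x. B * (\<Prod>i\<in>S \<times> UNIV. exp (- e * (x i)\<^sup>2)))"
    by simp
  have [measurable]: "(\<lambda>x. x i) \<in> borel_measurable (box_measure S)" if "fst i \<in> S" for i
    using measurable_component_singleton[of i "S \<times> (UNIV::bool set)" "\<lambda>_. lborel :: real measure"] that
    by (cases i) auto
  have "shifted S w \<in> borel_measurable (box_measure S)"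
  proof (rule measurable_coordinatewise_then_product)
    fix i
    show "(\<lambda>x. shifted S w x i) \<in> borel_measurable (box_measure S)"
      unfolding shifted_def by (cases "fst i \<in> S") auto
  qed
  then have [measurable]: "(\<lambda>x. G (shifted S w x)) \<in> borel_measurable (box_measure S)"
    by (rule measurable_compose[OF _ borel_measurable_continuous_onI[OF G(1)]])
  have [measurable]: "(\<lambda>x. block_weight e j (x (j, False)) (x (j, True))) \<in> borel_measurable (box_measure S)"
    if "j \<in> S" for j
  proof -
    have "(\<lambda>x. (x (j, False), x (j, True))) \<in> measurable (box_measure S) (borel \<Otimes>\<^sub>M borel)"
      using that by (intro measurable_Pair) auto
    moreover have "continuous_on UNIV (\<lambda>v. block_weight e j (fst v) (snd v))"
      by (intro continuous_intros)
    ultimately have "(\<lambda>v. block_weight e j (fst v) (snd v)) \<circ> (\<lambda>x. (x (j, False), x (j, True))) \<in> borel_measurable (box_measure S)"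
      unfolding borel_prod by (rule measurable_comp[OF _ borel_measurable_continuous_onI])
    then show ?thesis by (simp add: comp_def)
  qed
  show "(\<lambda>x. (\<Prod>j\<in>S. block_weight e j (x (j, False)) (x (j, True))) * G (shifted S w x)) \<in> borel_measurable (box_measure S)"
    by measurable
  have "(\<Prod>j\<in>S. exp (- e * (x (j, False))\<^sup>2) * exp (- e * (x (j, True))\<^sup>2)) = (\<Prod>i\<in>S \<times> UNIV. exp (- e * (x i)\<^sup>2) :: real)" for x :: "'b \<times> bool \<Rightarrow> real"
    using prod.cartesian_product[of "\<lambda>j d. exp (- e * (x (j, d))\<^sup>2)" "UNIV :: bool set" S]
    by (simp add: UNIV_bool case_prod_unfold mult.commute)
  then have "norm ((\<Prod>j\<in>S. block_weight e j (x (j, False)) (x (j, True))) * G (shifted S w x)) 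
     \<le> B * (\<Prod>i\<in>S \<times> UNIV. exp (- e * (x i)\<^sup>2))" for x
    using mult_right_mono[OF G(2)[of "shifted S w x"], of "\<Prod>i\<in>S \<times> UNIV. exp (- e * (x i)\<^sup>2)"]
    by (simp add: norm_mult prod_norm[symmetric] norm_block_weight prod_nonneg mult.commute)
  then show "AE x in box_measure S. norm ((\<Prod>j\<in>S. block_weight e j (x (j, False)) (x (j, True))) * G (shifted S w x))
     \<le> norm (B * (\<Prod>i\<in>S \<times> UNIV. exp (- e * (x i)\<^sup>2)))"
    using order_trans[OF _ abs_ge_self] by (intro always_eventually allI) auto
qed

text \<open>
  Fubini's theorem, one block at a time. The block that is integrated first leaves a continuous bounded
  function of the other coordinates, to which the induction hypothesis applies. The substitution
  \<open>p = lam j * a\<close>, \<open>q = mu j * b\<close> and the normalization of \<open>block_integral\<close> give the prefactor.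
\<close>
theorem integral_box_eq_fold:
  assumes "distinct js" "set js \<subseteq> J" and e: "e > 0" and "continuous_on UNIV G" "\<And>w. norm (G w) \<le> B"
  shows "(\<integral>x. (\<Prod>j\<in>set js. block_weight e j (x (j, False)) (x (j, True))) * G (shifted (set js) w x) \<partial>box_measure (set js))
    = of_real (\<Prod>j\<in>set js. pi * \<bar>lam j * mu j\<bar>) * fold (integral_step e) js G w"
  using assms(1,2,4,5)
proof (induction js arbitrary: G B)
  case Nil
  have "measure (PiM {} (\<lambda>_::'b \<times> bool. lborel :: real measure)) {\<lambda>_. undefined} = 1"
    by (simp add: measure_def)
  then show ?case by (simp add: shifted_def space_PiM_empty)
next
  case (Cons j js)
  let ?S = "set js" and ?S' = "set (j # js)"
  have j: "j \<in> J" "j \<notin> ?S" using Cons.prems by auto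
  let ?f = "\<lambda>S G x. (\<Prod>j\<in>S. block_weight e j (x (j, False)) (x (j, True))) * G (shifted S w x)"
  have K: "?S' \<times> UNIV = insert (j, False) (insert (j, True) (?S \<times> (UNIV :: bool set)))"
    by (auto simp: UNIV_bool)
  let ?ins = "\<lambda>((p, q), x). x((j, False) := p, (j, True) := q)"
  let ?M = "(lborel \<Otimes>\<^sub>M lborel) \<Otimes>\<^sub>M box_measure ?S"
  have distr: "distr ?M (box_measure ?S') ?ins = box_measure ?S'"
    unfolding K using j(2) by (intro distr_PiM_insert_two) auto
  have meas: "?ins \<in> measurable ?M (box_measure ?S')"
    unfolding K using j(2) by (intro measurable_PiM_insert_two) auto
  have int: "integrable (box_measure ?S') (?f ?S' G)"
    by (rule integrable_box[OF _ e Cons.prems(3,4)]) simp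
  have int2: "integrable ?M (\<lambda>v. ?f ?S' G (?ins v))"
  proof (rule integrable_distr[OF meas])
    show "integrable (distr ?M (box_measure ?S') ?ins) (?f ?S' G)"
      unfolding distr by (rule int)
  qed
  interpret pair_sigma_finite "lborel \<Otimes>\<^sub>M lborel :: (real \<times> real) measure" "box_measure ?S"
    unfolding lborel_prod using lborel_PiM.sigma_finite[of "?S \<times> (UNIV :: bool set)"]
    by (intro pair_sigma_finite.intro sigma_finite_lborel) auto
  have eq: "?f ?S' G (?ins ((p, q), x)) = (\<Prod>j\<in>?S. block_weight e j (x (j, False)) (x (j, True))) *
     (block_weight e j p q * G (bump j p q (shifted ?S w x)))" for p q x
  proof -
    have "shifted ?S' w (x((j, False) := p, (j, True) := q)) = bump j p q (shifted ?S w x)"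
      using j(2) by (auto simp: shifted_def bump_def)
    moreover have "(\<Prod>j'\<in>?S. block_weight e j' ((x((j, False) := p, (j, True) := q)) (j', False)) ((x((j, False) := p, (j, True) := q)) (j', True))) =
      (\<Prod>j'\<in>?S. block_weight e j' (x (j', False)) (x (j', True)))"
      using j(2) by (intro prod.cong) auto
    ultimately show ?thesis
      using j(2) by simp
  qed
  have "integral\<^sup>L (box_measure ?S') (?f ?S' G) = (\<integral>v. ?f ?S' G (?ins v) \<partial>?M)"
    using integral_distr[OF meas borel_measurable_integrable[OF int]] unfolding distr .
  also have "\<dots> = (\<integral>x. (\<integral>v. ?f ?S' G (?ins (v, x)) \<partial>(lborel \<Otimes>\<^sub>M lborel)) \<partial>box_measure ?S)"
    using integral_snd[of "\<lambda>v x. ?f ?S' G (?ins (v, x))"] int2 by (simp add: case_prod_unfold)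
  also have "(\<lambda>x. \<integral>v. ?f ?S' G (?ins (v, x)) \<partial>(lborel \<Otimes>\<^sub>M lborel)) =
     (\<lambda>x. of_real (pi * \<bar>lam j * mu j\<bar>) * ?f ?S (integral_step e j G) x)"
  proof
    fix x
    have "(\<integral>v. ?f ?S' G (?ins (v, x)) \<partial>(lborel \<Otimes>\<^sub>M lborel)) = (\<integral>v. (\<Prod>j\<in>?S. block_weight e j (x (j, False)) (x (j, True))) *
       (case v of (p, q) \<Rightarrow> block_weight e j p q * G (bump j p q (shifted ?S w x))) \<partial>lborel)"
      unfolding lborel_prod
    proof (rule Bochner_Integration.integral_cong[OF refl])
      fix v :: "real \<times> real"
      show "?f ?S' G (?ins (v, x)) = (\<Prod>j\<in>?S. block_weight e j (x (j, False)) (x (j, True))) *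
       (case v of (p, q) \<Rightarrow> block_weight e j p q * G (bump j p q (shifted ?S w x)))"
        using eq[of "fst v" "snd v" x] by (simp only: prod.collapse case_prod_unfold)
    qed
    also have "\<dots> = (\<Prod>j\<in>?S. block_weight e j (x (j, False)) (x (j, True))) *
       (of_real (pi * \<bar>lam j * mu j\<bar>) * integral_step e j G (shifted ?S w x))"
      by (simp only: integral_mult_right_zero integral_block[OF e Cons.prems(3,4) j(1)])
    finally show "(\<integral>v. ?f ?S' G (?ins (v, x)) \<partial>(lborel \<Otimes>\<^sub>M lborel)) = of_real (pi * \<bar>lam j * mu j\<bar>) * ?f ?S (integral_step e j G) x"
      by (simp only: mult.left_commute)
  qed
  also have "(\<integral>x. of_real (pi * \<bar>lam j * mu j\<bar>) * ?f ?S (integral_step e j G) x \<partial>box_measure ?S) =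
     of_real (pi * \<bar>lam j * mu j\<bar>) * (of_real (\<Prod>j\<in>?S. pi * \<bar>lam j * mu j\<bar>) * fold (integral_step e) js (integral_step e j G) w)"
  proof -
    obtain B' where "\<And>w. norm (integral_step e j G w) \<le> B'"
      using integral_step_continuous_bounded(2)[OF e Cons.prems(3,4) j(1)] by blast
    note IH = Cons.IH[OF _ _ integral_step_continuous_bounded(1)[OF e Cons.prems(3,4) j(1)] this]
    show ?thesis
      by (subst IH[symmetric]) (use Cons.prems(1,2) in \<open>simp_all only: integral_mult_right_zero distinct.simps set_simps insert_subset\<close>)
  qed
  finally show ?case
    using j(2) by simp
qed

end

section \<open>The Weyl integrand in block coordinates\<close>

text \<open>
  For \<open>Y = (y, \<eta>)\<close> and \<open>Z = (z, \<zeta>)\<close>, block \<open>(j, True)\<close> consists of \<open>y\<^sub>j\<close> and \<open>\<zeta>\<^sub>j\<close>, block \<open>(j, False)\<close> of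
  \<open>z\<^sub>j\<close> and \<open>\<eta>\<^sub>j\<close>, each time in the order position, momentum. Thus \<open>left_part\<close> below collects the
  coordinates of \<open>Y\<close>, on which \<open>A\<close> depends, and \<open>right_part\<close> those of \<open>Z\<close>, on which \<open>B\<close> depends.
\<close>
definition blocks :: "nat \<Rightarrow> (nat \<times> bool) set" where
  "blocks n = {1..n} \<times> UNIV"

definition left_part :: "nat \<Rightarrow> ((nat \<times> bool) \<times> bool \<Rightarrow> 'a) \<Rightarrow> (nat \<Rightarrow> 'a) \<times> (nat \<Rightarrow> 'a)" where
  "left_part n w = ((\<lambda>j\<in>{1..n}. w ((j, True), False)), (\<lambda>j\<in>{1..n}. w ((j, False), True)))"

definition right_part :: "nat \<Rightarrow> ((nat \<times> bool) \<times> bool \<Rightarrow> 'a) \<Rightarrow> (nat \<Rightarrow> 'a) \<times> (nat \<Rightarrow> 'a)" where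
  "right_part n w = ((\<lambda>j\<in>{1..n}. w ((j, False), False)), (\<lambda>j\<in>{1..n}. w ((j, True), True)))"

definition merge_phase :: "nat \<Rightarrow> phase_point \<times> phase_point \<Rightarrow> (nat \<times> bool) \<times> bool \<Rightarrow> real" where
  "merge_phase n = (\<lambda>(Y, Z). \<lambda>((j, c), d)\<in>blocks n \<times> UNIV.
     if c then (if d then snd Z j else fst Y j) else (if d then snd Y j else fst Z j))"

text \<open>
  \<open>X\<close> takes the place of both \<open>Y\<close> and \<open>Z\<close>: in the doubled coordinates, \<open>(X + Y, X + Z)\<close> is the
  translate of \<open>diag n X\<close> by \<open>merge_phase n (Y, Z)\<close>.
\<close>
definition diag :: "nat \<Rightarrow> phase_point \<Rightarrow> (nat \<times> bool) \<times> bool \<Rightarrow> real" where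
  "diag n X = (\<lambda>((j, c), d). if j \<in> {1..n} then (if d then snd X j else fst X j) else 0)"

lemma finite_blocks [simp]: "finite (blocks n)"
  by (simp add: blocks_def)

lemma prod_blocks:
  fixes f :: "(nat \<times> bool) \<times> bool \<Rightarrow> 'a::comm_monoid_mult"
  shows "(\<Prod>i\<in>blocks n \<times> UNIV. f i) = (\<Prod>j=1..n. f ((j, True), False) * f ((j, False), True)) *
     (\<Prod>j=1..n. f ((j, False), False) * f ((j, True), True))"
proof -
  have "(\<Prod>i\<in>blocks n \<times> UNIV. f i) = (\<Prod>j=1..n. \<Prod>c\<in>UNIV. \<Prod>d\<in>UNIV. f ((j, c), d))"
    unfolding blocks_def
    using prod.cartesian_product[of "\<lambda>p d. f (p, d)" "UNIV :: bool set" "{1..n} \<times> (UNIV :: bool set)"]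
      prod.cartesian_product[of "\<lambda>j c. \<Prod>d\<in>UNIV. f ((j, c), d)" "UNIV :: bool set" "{1..n}"]
    by (simp add: case_prod_unfold)
  also have "\<dots> = (\<Prod>j=1..n. (f ((j, True), False) * f ((j, False), True)) * (f ((j, False), False) * f ((j, True), True)))"
    by (intro prod.cong) (auto simp: UNIV_bool mult_ac)
  finally show ?thesis by (simp only: prod.distrib)
qed

lemma left_part_phase [simp]: "left_part n w \<in> phase n" "right_part n w \<in> phase n"
  by (auto simp: left_part_def right_part_def phase_def config_space_def)

lemma shifted_parts:
  "left_part n (shifted (blocks n) (diag n X) (merge_phase n (Y, Z))) = phase_add n X Y"
  "right_part n (shifted (blocks n) (diag n X) (merge_phase n (Y, Z))) = phase_add n X Z"
  by (auto simp: left_part_def right_part_def shifted_def diag_def merge_phase_def phase_add_def blocks_def restrict_def)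

lemma measurable_phase_coord:
  assumes "j \<in> {1..n}"
  shows "(\<lambda>X. fst X j) \<in> measurable (phase_measure n) lborel" "(\<lambda>X. snd X j) \<in> measurable (phase_measure n) lborel"
  unfolding phase_measure_def using assms
  by (auto intro!: measurable_compose[OF measurable_fst] measurable_compose[OF measurable_snd] measurable_component_singleton)

lemma measurable_merge_phase:
  "merge_phase n \<in> measurable (phase_measure n \<Otimes>\<^sub>M phase_measure n) (box_measure (blocks n))"
proof (rule measurable_PiM_single')
  fix i assume i: "i \<in> blocks n \<times> (UNIV :: bool set)"
  obtain j c d where [simp]: "i = ((j, c), d)" by (cases i) auto
  have j: "j \<in> {1..n}" using i by (simp add: blocks_def)
  note m = measurable_phase_coord[OF j]
  show "(\<lambda>v. merge_phase n v i) \<in> measurable (phase_measure n \<Otimes>\<^sub>M phase_measure n) lborel"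
    using i measurable_compose[OF measurable_fst m(1)] measurable_compose[OF measurable_fst m(2)]
      measurable_compose[OF measurable_snd m(1)] measurable_compose[OF measurable_snd m(2)]
    by (cases c; cases d) (auto simp: merge_phase_def case_prod_unfold)
next
  show "merge_phase n \<in> space (phase_measure n \<Otimes>\<^sub>M phase_measure n) \<rightarrow> (\<Pi>\<^sub>E i\<in>blocks n \<times> UNIV. space lborel)"
    by (rule funcsetI) (simp add: merge_phase_def case_prod_unfold)
qed

text \<open>
  The map is a reordering of coordinates; as before, it suffices to compare boxes.
\<close>
lemma distr_merge_phase:
  "distr (phase_measure n \<Otimes>\<^sub>M phase_measure n) (box_measure (blocks n)) (merge_phase n) = box_measure (blocks n)"
proof (rule lborel_PiM.PiM_eqI)
  interpret I: finite_product_sigma_finite "\<lambda>_. lborel :: real measure" "{1..n}" by standard simp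
  let ?P = "PiM {1..n} (\<lambda>_. lborel :: real measure)"
  have "sigma_finite_measure (?P \<Otimes>\<^sub>M ?P)"
    by (intro sigma_finite_pair_measure I.sigma_finite_measure_axioms)
  note times = sigma_finite_measure.emeasure_pair_measure_Times[OF this]
  fix A :: "(nat \<times> bool) \<times> bool \<Rightarrow> real set"
  assume A: "\<And>i. i \<in> blocks n \<times> UNIV \<Longrightarrow> A i \<in> sets lborel"
  define B where "B = (\<lambda>c d. \<Pi>\<^sub>E j\<in>{1..n}. A ((j, c), d))"
  have A': "A ((j, c), d) \<in> sets borel" if "j \<in> {1..n}" for j c d
    using A[of "((j, c), d)"] that by (simp add: blocks_def)
  have B: "B c d \<in> sets ?P" "emeasure ?P (B c d) = (\<Prod>j=1..n. emeasure lborel (A ((j, c), d)))" for c d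
    unfolding B_def using A' by (auto intro!: sets_PiM_I_finite lborel_PiM.emeasure_PiM)
  have pre: "merge_phase n -` (\<Pi>\<^sub>E i\<in>blocks n \<times> UNIV. A i) \<inter> space (phase_measure n \<Otimes>\<^sub>M phase_measure n) =
    (B True False \<times> B False True) \<times> (B False False \<times> B True True)" (is "?L = ?R")
  proof (rule set_eqI)
    fix v :: "phase_point \<times> phase_point"
    obtain y \<eta> z \<zeta> where v: "v = ((y, \<eta>), (z, \<zeta>))" by (cases v) auto
    have "v \<in> ?L \<longleftrightarrow> (\<forall>i\<in>blocks n \<times> UNIV. merge_phase n v i \<in> A i) \<and>
       y \<in> extensional {1..n} \<and> \<eta> \<in> extensional {1..n} \<and> z \<in> extensional {1..n} \<and> \<zeta> \<in> extensional {1..n}"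
      by (auto simp: v space_pair_measure space_phase_measure phase_def config_space_def PiE_iff merge_phase_def)
    also have "(\<forall>i\<in>blocks n \<times> UNIV. merge_phase n v i \<in> A i) \<longleftrightarrow>
      (\<forall>j\<in>{1..n}. y j \<in> A ((j, True), False) \<and> \<eta> j \<in> A ((j, False), True) \<and> z j \<in> A ((j, False), False) \<and> \<zeta> j \<in> A ((j, True), True))"
      by (auto simp: v merge_phase_def blocks_def all_bool_eq)
    finally show "v \<in> ?L \<longleftrightarrow> v \<in> ?R"
      by (auto simp: v B_def PiE_iff)
  qed
  have "emeasure (distr (phase_measure n \<Otimes>\<^sub>M phase_measure n) (box_measure (blocks n)) (merge_phase n)) (\<Pi>\<^sub>E i\<in>blocks n \<times> UNIV. A i)
    = emeasure (phase_measure n \<Otimes>\<^sub>M phase_measure n) ((B True False \<times> B False True) \<times> (B False False \<times> B True True))"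
    using A by (subst emeasure_distr[OF measurable_merge_phase]) (auto simp: pre intro!: sets_PiM_I_finite)
  also have "\<dots> = (emeasure ?P (B True False) * emeasure ?P (B False True)) * (emeasure ?P (B False False) * emeasure ?P (B True True))"
    by (simp only: phase_measure_def times[OF pair_measureI[OF B(1) B(1)] pair_measureI[OF B(1) B(1)]]
        I.emeasure_pair_measure_Times[OF B(1) B(1)])
  also have "\<dots> = (\<Prod>i\<in>blocks n \<times> UNIV. emeasure lborel (A i))"
    unfolding B(2) prod_blocks by (simp add: prod.distrib mult_ac)
  finally show "emeasure (distr (phase_measure n \<Otimes>\<^sub>M phase_measure n) (box_measure (blocks n)) (merge_phase n)) (\<Pi>\<^sub>E i\<in>blocks n \<times> UNIV. A i)
    = (\<Prod>i\<in>blocks n \<times> UNIV. emeasure lborel (A i))" .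
qed auto

definition coord_weight :: "(nat \<Rightarrow> real) \<Rightarrow> (nat \<Rightarrow> real) \<Rightarrow> (nat \<times> bool) \<times> bool \<Rightarrow> real" where
  "coord_weight \<rho> \<delta> = (\<lambda>((j, c), d). if d then \<delta> j else \<rho> j)"

text \<open>
  The derivatives of \<open>A(Y) B(Z)\<close>, as a jet in the doubled coordinates.
\<close>
definition tensor :: "nat \<Rightarrow> ((nat \<Rightarrow> nat) \<Rightarrow> (nat \<Rightarrow> nat) \<Rightarrow> phase_point \<Rightarrow> complex) \<Rightarrow>
    ((nat \<Rightarrow> nat) \<Rightarrow> (nat \<Rightarrow> nat) \<Rightarrow> phase_point \<Rightarrow> complex) \<Rightarrow>
    (nat \<times> bool) jet" where
  "tensor n DA DB k w = case_prod DA (left_part n k) (left_part n w) * case_prod DB (right_part n k) (right_part n w)"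

text \<open>
  Membership in a symbol class with a chosen family of derivatives and pointwise bounds.
\<close>
definition symbol_jet :: "nat \<Rightarrow> nat \<Rightarrow> real \<Rightarrow> (nat \<Rightarrow> real) \<Rightarrow> (nat \<Rightarrow> real) \<Rightarrow> (phase_point \<Rightarrow> complex) \<Rightarrow>
    ((nat \<Rightarrow> nat) \<Rightarrow> (nat \<Rightarrow> nat) \<Rightarrow> phase_point \<Rightarrow> complex) \<Rightarrow> bool" where
  "symbol_jet n m M \<rho> \<delta> F D \<longleftrightarrow> mixed_partials n m F D \<and>
     (\<forall>\<alpha>\<in>multi_indices n m. \<forall>\<beta>\<in>multi_indices n m. continuous_on (phase n) (D \<alpha> \<beta>) \<and>
       (\<forall>X\<in>phase n. norm (D \<alpha> \<beta> X) \<le> M * (\<Prod>j=1..n. \<rho> j ^ \<alpha> j * \<delta> j ^ \<beta> j)))"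

lemma symbol_jetI:
  assumes "F \<in> symbol_class n m M \<rho> \<delta>"
  shows "\<exists>D. symbol_jet n m M \<rho> \<delta> F D"
proof -
  obtain D where D: "mixed_partials n m F D" "\<And>\<alpha> \<beta>. \<alpha> \<in> multi_indices n m \<Longrightarrow> \<beta> \<in> multi_indices n m \<Longrightarrow>
      continuous_on (phase n) (D \<alpha> \<beta>) \<and> bounded (D \<alpha> \<beta> ` phase n) \<and>
      (SUP X\<in>phase n. cmod (D \<alpha> \<beta> X)) \<le> M * (\<Prod>j=1..n. \<rho> j ^ \<alpha> j * \<delta> j ^ \<beta> j)"
    using assms unfolding symbol_class_def by auto
  have "norm (D \<alpha> \<beta> X) \<le> M * (\<Prod>j=1..n. \<rho> j ^ \<alpha> j * \<delta> j ^ \<beta> j)"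
    if "\<alpha> \<in> multi_indices n m" "\<beta> \<in> multi_indices n m" "X \<in> phase n" for \<alpha> \<beta> X
  proof -
    have "bdd_above ((\<lambda>X. cmod (D \<alpha> \<beta> X)) ` phase n)"
      using D(2)[OF that(1,2)] by (auto simp: bounded_iff bdd_above_def)
    then have "cmod (D \<alpha> \<beta> X) \<le> (SUP X\<in>phase n. cmod (D \<alpha> \<beta> X))"
      using that(3) by (intro cSUP_upper)
    then show ?thesis using D(2)[OF that(1,2)] by linarith
  qed
  then show ?thesis using D by (auto simp: symbol_jet_def)
qed

lemma has_partial_xD:
  "has_partial_x n j F G \<Longrightarrow> X \<in> phase n \<Longrightarrow>
     ((\<lambda>t. F ((fst X)(j := t), snd X)) has_vector_derivative G X) (at (fst X j))"
  by (cases X) (auto simp: has_partial_x_def phase_def)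

lemma has_partial_xiD:
  "has_partial_xi n j F G \<Longrightarrow> X \<in> phase n \<Longrightarrow>
     ((\<lambda>t. F (fst X, (snd X)(j := t))) has_vector_derivative G X) (at (snd X j))"
  by (cases X) (auto simp: has_partial_xi_def phase_def)

lemma symbol_jet_partials:
  assumes "symbol_jet n m M \<rho> \<delta> F D" "\<alpha> \<in> multi_indices n m" "\<beta> \<in> multi_indices n m" "j \<in> {1..n}"
  shows "\<alpha> j < m \<Longrightarrow> has_partial_x n j (D \<alpha> \<beta>) (D (\<alpha>(j := Suc (\<alpha> j))) \<beta>)"
    "\<beta> j < m \<Longrightarrow> has_partial_xi n j (D \<alpha> \<beta>) (D \<alpha> (\<beta>(j := Suc (\<beta> j))))"
proof -
  have "\<forall>\<alpha>\<in>multi_indices n m. \<forall>\<beta>\<in>multi_indices n m. \<forall>j\<in>{1..n}.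
        (\<alpha> j < m \<longrightarrow> has_partial_x n j (D \<alpha> \<beta>) (D (\<alpha>(j := Suc (\<alpha> j))) \<beta>)) \<and>
        (\<beta> j < m \<longrightarrow> has_partial_xi n j (D \<alpha> \<beta>) (D \<alpha> (\<beta>(j := Suc (\<beta> j)))))"
    using assms(1) unfolding symbol_jet_def mixed_partials_def by (elim conjE)
  note * = bspec[OF bspec[OF bspec[OF this assms(2)] assms(3)] assms(4)]
  show "\<alpha> j < m \<Longrightarrow> has_partial_x n j (D \<alpha> \<beta>) (D (\<alpha>(j := Suc (\<alpha> j))) \<beta>)"
    "\<beta> j < m \<Longrightarrow> has_partial_xi n j (D \<alpha> \<beta>) (D \<alpha> (\<beta>(j := Suc (\<beta> j))))"
    using * by (simp_all only: simp_thms)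
qed

lemma parts_multi_indices:
  assumes "k \<le> (\<lambda>_. m)"
  shows "fst (left_part n k) \<in> multi_indices n m" "snd (left_part n k) \<in> multi_indices n m"
    "fst (right_part n k) \<in> multi_indices n m" "snd (right_part n k) \<in> multi_indices n m"
  using assms by (auto simp: left_part_def right_part_def multi_indices_def le_fun_def)

lemma continuous_parts:
  "continuous_on UNIV (left_part n :: _ \<Rightarrow> phase_point)" "continuous_on UNIV (right_part n :: _ \<Rightarrow> phase_point)"
proof -
  have c: "continuous_on UNIV (\<lambda>w. (\<lambda>j\<in>{1..n}. w (g j)) :: nat \<Rightarrow> real)" for g :: "nat \<Rightarrow> (nat \<times> bool) \<times> bool"
  proof (rule continuous_on_coordinatewise_then_product)
    fix j show "continuous_on UNIV (\<lambda>w. (\<lambda>j\<in>{1..n}. w (g j)) j :: real)"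
      by (cases "j \<in> {1..n}") auto
  qed
  show "continuous_on UNIV (left_part n :: _ \<Rightarrow> phase_point)" "continuous_on UNIV (right_part n :: _ \<Rightarrow> phase_point)"
    unfolding left_part_def[abs_def] right_part_def[abs_def] by (intro continuous_intros c)+
qed

lemma part_upd:
  assumes "j \<in> {1..n}"
  shows "left_part n (w(((j, True), False) := t)) = ((fst (left_part n w))(j := t), snd (left_part n w))"
    "left_part n (w(((j, False), True) := t)) = (fst (left_part n w), (snd (left_part n w))(j := t))"
    "left_part n (w(((j, False), False) := t)) = left_part n w"
    "left_part n (w(((j, True), True) := t)) = left_part n w"
    "right_part n (w(((j, False), False) := t)) = ((fst (right_part n w))(j := t), snd (right_part n w))"
    "right_part n (w(((j, True), True) := t)) = (fst (right_part n w), (snd (right_part n w))(j := t))"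
    "right_part n (w(((j, True), False) := t)) = right_part n w"
    "right_part n (w(((j, False), True) := t)) = right_part n w"
  using assms by (auto simp: left_part_def right_part_def fun_eq_iff)

lemma part_coord:
  assumes "j \<in> {1..n}"
  shows "fst (left_part n w) j = w ((j, True), False)" "snd (left_part n w) j = w ((j, False), True)"
    "fst (right_part n w) j = w ((j, False), False)" "snd (right_part n w) j = w ((j, True), True)"
  using assms by (auto simp: left_part_def right_part_def)

text \<open>
  Each coordinate occurs in only one of the two factors, so a derivative of the product is a single
  product of derivatives.
\<close>
lemma jet_family_tensor:
  assumes A: "symbol_jet n m M \<rho> \<delta> A DA" and B: "symbol_jet n m M' \<rho> \<delta> B DB" and M: "M \<ge> 0"
    and pos: "\<And>j. j \<in> {1..n} \<Longrightarrow> 0 \<le> \<rho> j \<and> 0 \<le> \<delta> j"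
  shows "jet_family (blocks n \<times> UNIV) (coord_weight \<rho> \<delta>) (\<lambda>_. m) (M * M') (tensor n DA DB)"
  unfolding jet_family_def
proof (intro allI impI conjI ballI)
  fix k :: "(nat \<times> bool) \<times> bool \<Rightarrow> nat" assume k: "k \<le> (\<lambda>_. m)"
  note idx = parts_multi_indices[OF k]
  have cA: "continuous_on (phase n) (case_prod DA (left_part n k))"
    and cB: "continuous_on (phase n) (case_prod DB (right_part n k))"
    using A B idx by (auto simp: symbol_jet_def case_prod_unfold)
  show "continuous_on UNIV (tensor n DA DB k)"
    unfolding tensor_def
    by (intro continuous_on_mult continuous_on_compose2[OF cA continuous_parts(1)] continuous_on_compose2[OF cB continuous_parts(2)]) auto
  fix w :: "(nat \<times> bool) \<times> bool \<Rightarrow> real"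
  have "norm (case_prod DA (left_part n k) (left_part n w)) \<le> M * (\<Prod>j=1..n. \<rho> j ^ fst (left_part n k) j * \<delta> j ^ snd (left_part n k) j)"
    using A idx by (auto simp: symbol_jet_def case_prod_unfold)
  moreover have "norm (case_prod DB (right_part n k) (right_part n w)) \<le> M' * (\<Prod>j=1..n. \<rho> j ^ fst (right_part n k) j * \<delta> j ^ snd (right_part n k) j)"
    using B idx by (auto simp: symbol_jet_def case_prod_unfold)
  ultimately have "norm (tensor n DA DB k w) \<le>
     (M * (\<Prod>j=1..n. \<rho> j ^ fst (left_part n k) j * \<delta> j ^ snd (left_part n k) j)) *
     (M' * (\<Prod>j=1..n. \<rho> j ^ fst (right_part n k) j * \<delta> j ^ snd (right_part n k) j))"
    unfolding tensor_def norm_mult using M pos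
    by (intro mult_mono mult_nonneg_nonneg prod_nonneg) auto
  also have "\<dots> = M * M' * (\<Prod>i\<in>blocks n \<times> UNIV. coord_weight \<rho> \<delta> i ^ k i)"
    unfolding prod_blocks by (simp add: coord_weight_def part_coord)
  finally show "norm (tensor n DA DB k w) \<le> M * M' * (\<Prod>i\<in>blocks n \<times> UNIV. coord_weight \<rho> \<delta> i ^ k i)" .
next
  fix k :: "(nat \<times> bool) \<times> bool \<Rightarrow> nat" and i :: "(nat \<times> bool) \<times> bool" and w :: "(nat \<times> bool) \<times> bool \<Rightarrow> real"
  assume k: "k \<le> (\<lambda>_. m)" and i: "i \<in> blocks n \<times> UNIV" and lt: "k i < m"
  note idx = parts_multi_indices[OF k]
  obtain j c d where icd: "i = ((j, c), d)" by (cases i) auto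
  have j: "j \<in> {1..n}" using i by (simp add: icd blocks_def)
  note pA = symbol_jet_partials[OF A _ _ j] and pB = symbol_jet_partials[OF B _ _ j]
  consider "c" "\<not> d" | "\<not> c" "d" | "\<not> c" "\<not> d" | "c" "d" by blast
  then show "((\<lambda>t. tensor n DA DB k (w(i := t))) has_vector_derivative tensor n DA DB (k(i := Suc (k i))) w) (at (w i))"
  proof cases
    case 1
    have "((\<lambda>t. DA (fst (left_part n k)) (snd (left_part n k)) ((fst (left_part n w))(j := t), snd (left_part n w)))
       has_vector_derivative DA ((fst (left_part n k))(j := Suc (fst (left_part n k) j))) (snd (left_part n k)) (left_part n w)) (at (fst (left_part n w) j))"
    proof (rule has_partial_xD[OF pA(1)[OF idx(1,2)] left_part_phase(1)])
      show "fst (left_part n k) j < m" using lt 1 by (simp add: part_coord[OF j] icd)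
    qed
    from has_vector_derivative_mult_left[OF this] show ?thesis
      using 1 by (simp add: tensor_def icd part_upd[OF j] part_coord[OF j] case_prod_unfold)
  next
    case 2
    have "((\<lambda>t. DA (fst (left_part n k)) (snd (left_part n k)) (fst (left_part n w), (snd (left_part n w))(j := t)))
       has_vector_derivative DA (fst (left_part n k)) ((snd (left_part n k))(j := Suc (snd (left_part n k) j))) (left_part n w)) (at (snd (left_part n w) j))"
    proof (rule has_partial_xiD[OF pA(2)[OF idx(1,2)] left_part_phase(1)])
      show "snd (left_part n k) j < m" using lt 2 by (simp add: part_coord[OF j] icd)
    qed
    from has_vector_derivative_mult_left[OF this] show ?thesis
      using 2 by (simp add: tensor_def icd part_upd[OF j] part_coord[OF j] case_prod_unfold)
  next
    case 3
    have "((\<lambda>t. DB (fst (right_part n k)) (snd (right_part n k)) ((fst (right_part n w))(j := t), snd (right_part n w)))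
       has_vector_derivative DB ((fst (right_part n k))(j := Suc (fst (right_part n k) j))) (snd (right_part n k)) (right_part n w)) (at (fst (right_part n w) j))"
    proof (rule has_partial_xD[OF pB(1)[OF idx(3,4)] left_part_phase(2)])
      show "fst (right_part n k) j < m" using lt 3 by (simp add: part_coord[OF j] icd)
    qed
    from has_vector_derivative_mult_right[OF this] show ?thesis
      using 3 by (simp add: tensor_def icd part_upd[OF j] part_coord[OF j] case_prod_unfold)
  next
    case 4
    have "((\<lambda>t. DB (fst (right_part n k)) (snd (right_part n k)) (fst (right_part n w), (snd (right_part n w))(j := t)))
       has_vector_derivative DB (fst (right_part n k)) ((snd (right_part n k))(j := Suc (snd (right_part n k) j))) (right_part n w)) (at (snd (right_part n w) j))"
    proof (rule has_partial_xiD[OF pB(2)[OF idx(3,4)] left_part_phase(2)])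
      show "snd (right_part n k) j < m" using lt 4 by (simp add: part_coord[OF j] icd)
    qed
    from has_vector_derivative_mult_right[OF this] show ?thesis
      using 4 by (simp add: tensor_def icd part_upd[OF j] part_coord[OF j] case_prod_unfold)
  qed
qed

text \<open>
  The scale \<open>l\<close> of a position variable and the scale \<open>h / l\<close> of the momentum variable in the same
  block. For \<open>r > 0\<close> the choice \<open>l = 1 / r\<close> turns the second condition into \<open>h r d \<le> 1\<close>. For \<open>r = 0\<close>
  one needs \<open>l \<ge> h d\<close> and \<open>l > 0\<close>, hence \<open>h (d + 1)\<close>.
\<close>
lemma scaling_exists:
  fixes r d h :: real
  assumes "h > 0" "r \<ge> 0" "d \<ge> 0" "h * r * d \<le> 1"
  shows "\<exists>l>0. l * r \<le> 1 \<and> h / l * d \<le> 1"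
proof (cases "r = 0")
  case True
  have "0 < h * (d + 1)" "h / (h * (d + 1)) * d = d / (d + 1)"
    using assms by auto
  moreover have "d / (d + 1) \<le> 1"
    using assms by simp
  ultimately show ?thesis
    using True by (intro exI[of _ "h * (d + 1)"]) simp
next
  case False
  then show ?thesis
    using assms by (intro exI[of _ "1 / r"]) auto
qed

locale weyl_setup =
  fixes n :: nat and h :: real and \<rho> \<delta> l :: "nat \<Rightarrow> real"
  assumes h: "h > 0"
    and pos: "j \<in> {1..n} \<Longrightarrow> 0 \<le> \<rho> j" "j \<in> {1..n} \<Longrightarrow> 0 \<le> \<delta> j"
    and l: "j \<in> {1..n} \<Longrightarrow> 0 < l j" "j \<in> {1..n} \<Longrightarrow> l j * \<rho> j \<le> 1" "j \<in> {1..n} \<Longrightarrow> h / l j * \<delta> j \<le> 1"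

text \<open>
  The phases of the blocks \<open>(j, True)\<close> and \<open>(j, False)\<close> have opposite signs. The sign is put into the
  scale of the momentum, so that the rescaled phase is \<open>2 a b\<close> in both cases.
\<close>
sublocale weyl_setup \<subseteq> weyl_blocks "blocks n" "coord_weight \<rho> \<delta>" "\<lambda>(j, c). l j" "\<lambda>(j, c). if c then h / l j else - (h / l j)"
proof -
  have "l j \<noteq> 0" "\<bar>l j\<bar> = l j" if "j \<in> {1..n}" for j
    using l(1)[OF that] by auto
  then show "weyl_blocks (blocks n) (coord_weight \<rho> \<delta>) (\<lambda>(j, c). l j) (\<lambda>(j, c). if c then h / l j else - (h / l j))"
    using h pos l by unfold_locales (auto simp: blocks_def coord_weight_def split: if_splits)
qed

context weyl_setup
begin

lemma coupling_eq: "j \<in> {1..n} \<Longrightarrow> coupling (j, c) = h * \<rho> j * \<delta> j"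
  using l(1)[of j] h unfolding coupling_def by (simp add: coord_weight_def)

lemma block_weight_eq_exp:
  assumes "j \<in> {1..n}"
  shows "block_weight e (j, c) p q = exp ((if c then 1 else - 1) * (2 * \<i> / of_real h) * of_real (p * q) + of_real (- e * (p\<^sup>2 + q\<^sup>2)))"
proof -
  have "2 * p * q / (l j * (if c then h / l j else - (h / l j))) = (if c then 1 else - 1) * (2 * (p * q) / h)"
    using l(1)[OF assms] by auto
  then have "cis (2 * p * q / (l j * (if c then h / l j else - (h / l j)))) =
      exp ((if c then 1 else - 1) * (2 * \<i> / of_real h) * of_real (p * q))"
    by (auto simp: cis_conv_exp mult_ac)
  moreover have "complex_of_real (exp (- e * p\<^sup>2) * exp (- e * q\<^sup>2)) = exp (of_real (- e * (p\<^sup>2 + q\<^sup>2)))"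
    unfolding exp_of_real exp_add[symmetric] by (simp add: algebra_simps)
  ultimately show ?thesis
    by (simp only: block_weight_def prod.case exp_add)
qed

lemma weyl_integrand_eq:
  assumes A: "symbol_jet n m M \<rho> \<delta> A DA" and B: "symbol_jet n m M' \<rho> \<delta> B DB"
  shows "weyl_integrand n h A B e X v =
    (\<Prod>j\<in>blocks n. block_weight e j (merge_phase n v (j, False)) (merge_phase n v (j, True))) *
     tensor n DA DB (\<lambda>_. 0) (shifted (blocks n) (diag n X) (merge_phase n v))"
proof -
  obtain Y Z where v: "v = (Y, Z)" by (cases v)
  have ph: "phase_add n X W \<in> phase n" for W
    by (auto simp: phase_add_def phase_def config_space_def)
  have t: "tensor n DA DB (\<lambda>_. 0) (shifted (blocks n) (diag n X) (merge_phase n v)) = A (phase_add n X Y) * B (phase_add n X Z)"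
    unfolding v tensor_def shifted_parts using A B ph
    by (simp add: left_part_def right_part_def symbol_jet_def mixed_partials_def)
  have "(\<Prod>j\<in>blocks n. block_weight e j (merge_phase n v (j, False)) (merge_phase n v (j, True))) =
    (\<Prod>j=1..n. \<Prod>c\<in>UNIV. block_weight e (j, c) (merge_phase n v ((j, c), False)) (merge_phase n v ((j, c), True)))"
    unfolding blocks_def by (simp add: prod.cartesian_product case_prod_unfold)
  also have "\<dots> = (\<Prod>j=1..n. exp (- (2 * \<i> / of_real h) * of_real (fst Z j * snd Y j - fst Y j * snd Z j)
      + of_real (- e * ((fst Y j)\<^sup>2 + (snd Y j)\<^sup>2 + (fst Z j)\<^sup>2 + (snd Z j)\<^sup>2))))"
  proof (intro prod.cong refl)
    fix j assume j: "j \<in> {1..n}"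
    have m: "merge_phase n v ((j, c), d) = (if c then (if d then snd Z j else fst Y j) else (if d then snd Y j else fst Z j))" for c d
      using j by (simp add: v merge_phase_def blocks_def)
    show "(\<Prod>c\<in>UNIV. block_weight e (j, c) (merge_phase n v ((j, c), False)) (merge_phase n v ((j, c), True))) =
      exp (- (2 * \<i> / of_real h) * of_real (fst Z j * snd Y j - fst Y j * snd Z j)
      + of_real (- e * ((fst Y j)\<^sup>2 + (snd Y j)\<^sup>2 + (fst Z j)\<^sup>2 + (snd Z j)\<^sup>2)))"
      unfolding UNIV_bool by (simp add: block_weight_eq_exp[OF j] m exp_add[symmetric]) (simp add: algebra_simps diff_divide_distrib)
  qed
  also have "\<dots> = exp (\<Sum>j=1..n. - (2 * \<i> / of_real h) * of_real (fst Z j * snd Y j - fst Y j * snd Z j)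
      + of_real (- e * ((fst Y j)\<^sup>2 + (snd Y j)\<^sup>2 + (fst Z j)\<^sup>2 + (snd Z j)\<^sup>2)))"
    by (simp add: exp_sum)
  also have "(\<Sum>j=1..n. - (2 * \<i> / of_real h) * of_real (fst Z j * snd Y j - fst Y j * snd Z j)
      + of_real (- e * ((fst Y j)\<^sup>2 + (snd Y j)\<^sup>2 + (fst Z j)\<^sup>2 + (snd Z j)\<^sup>2))) =
     - (2 * \<i> / of_real h) * of_real (symplectic n Y Z) + of_real (- e * (phase_norm_sq n Y + phase_norm_sq n Z))"
    unfolding symplectic_def phase_norm_sq_def sum.distrib sum_distrib_left[symmetric] of_real_sum[symmetric]
    by (simp add: sum_subtractf sum.distrib algebra_simps)
  finally show ?thesis
    unfolding t by (simp only: v weyl_integrand_def prod.case exp_add exp_of_real mult_ac)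
qed

text \<open>
  Some enumeration of the blocks; it fixes the order of the iterated integrals.
\<close>
definition block_list :: "(nat \<times> bool) list" where
  "block_list = (SOME js. set js = blocks n \<and> distinct js)"

lemma block_list: "set block_list = blocks n" "distinct block_list"
  using someI_ex[OF finite_distinct_list[OF finite_blocks[of n]]] unfolding block_list_def by auto

lemma weyl_integrand_integrable:
  assumes A: "symbol_jet n m M \<rho> \<delta> A DA" and B: "symbol_jet n m M' \<rho> \<delta> B DB" and M: "M \<ge> 0" and e: "e > 0"
  shows "integrable (phase_measure n \<Otimes>\<^sub>M phase_measure n) (weyl_integrand n h A B e X)"
    and "weyl_regularized n h A B e X = fold (integral_step e) block_list (tensor n DA DB (\<lambda>_. 0)) (diag n X)"
proof -
  have H: "jets (\<lambda>_. m) (M * M') (tensor n DA DB)"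
    by (rule jet_family_tensor[OF A B M]) (use pos in auto)
  let ?G = "tensor n DA DB (\<lambda>_. 0)"
  have G: "continuous_on UNIV ?G" "norm (?G w) \<le> M * M'" for w
    using jet_familyD[OF H, of "\<lambda>_. 0"] by (auto simp: le_fun_def)
  let ?f = "\<lambda>x. (\<Prod>j\<in>blocks n. block_weight e j (x (j, False)) (x (j, True))) * ?G (shifted (blocks n) (diag n X) x)"
  have int: "integrable (box_measure (blocks n)) ?f"
    by (rule integrable_box[OF finite_blocks e G])
  have eq: "weyl_integrand n h A B e X = (\<lambda>v. ?f (merge_phase n v))"
    using weyl_integrand_eq[OF A B] by blast
  show "integrable (phase_measure n \<Otimes>\<^sub>M phase_measure n) (weyl_integrand n h A B e X)"
    unfolding eq
  proof (rule integrable_distr[OF measurable_merge_phase])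
    show "integrable (distr (phase_measure n \<Otimes>\<^sub>M phase_measure n) (box_measure (blocks n)) (merge_phase n)) ?f"
      unfolding distr_merge_phase by (rule int)
  qed
  have "integral\<^sup>L (phase_measure n \<Otimes>\<^sub>M phase_measure n) (weyl_integrand n h A B e X) = integral\<^sup>L (box_measure (blocks n)) ?f"
    unfolding eq using integral_distr[OF measurable_merge_phase borel_measurable_integrable[OF int]]
    unfolding distr_merge_phase by simp
  also have "\<dots> = of_real (\<Prod>j\<in>blocks n. pi * \<bar>(case j of (j, c) \<Rightarrow> l j) * (case j of (j, c) \<Rightarrow> if c then h / l j else - (h / l j))\<bar>) *
      fold (integral_step e) block_list ?G (diag n X)"
    using integral_box_eq_fold[OF block_list(2) _ e G, of "diag n X"] by (simp only: block_list order_refl)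
  also have "(\<Prod>j\<in>blocks n. pi * \<bar>(case j of (j, c) \<Rightarrow> l j) * (case j of (j, c) \<Rightarrow> if c then h / l j else - (h / l j))\<bar>) =
     (\<Prod>j\<in>blocks n. pi * h)"
  proof (intro prod.cong refl)
    fix j assume "j \<in> blocks n"
    then obtain i c where "j = (i, c)" "i \<in> {1..n}" by (auto simp: blocks_def)
    then show "pi * \<bar>(case j of (j, c) \<Rightarrow> l j) * (case j of (j, c) \<Rightarrow> if c then h / l j else - (h / l j))\<bar> = pi * h"
      using l(1)[of i] h by (auto simp: abs_mult)
  qed
  also have "\<dots> = (pi * h) ^ (2 * n)"
    by (simp add: blocks_def card_cartesian_product mult.commute)
  finally show "weyl_regularized n h A B e X = fold (integral_step e) block_list ?G (diag n X)"
    unfolding weyl_regularized_def using h by simp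
qed

text \<open>
  The composition and its derivatives on the doubled phase space. The value of the Weyl composition at
  \<open>X\<close> is the entry of order 0 at \<open>diag n X\<close>.
\<close>
definition composed :: "_ \<Rightarrow> _ \<Rightarrow> (nat \<times> bool) jet" where
  "composed DA DB = fold (step 0) block_list (tensor n DA DB)"

text \<open>
  The square comes from the two blocks that belong to each \<open>j\<close>.
\<close>
lemma composed_jets:
  assumes A: "symbol_jet n m M \<rho> \<delta> A DA" and B: "symbol_jet n m M' \<rho> \<delta> B DB" and M: "M \<ge> 0" and m: "m \<ge> 6"
  shows "jets (fold lower block_list (\<lambda>_. m)) (M * M' * (\<Prod>j=1..n. (1 + block_const * (h * \<rho> j * \<delta> j)) ^ 2)) (composed DA DB)"
proof -
  have H: "jets (\<lambda>_. m) (M * M') (tensor n DA DB)"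
    by (rule jet_family_tensor[OF A B M]) (use pos in auto)
  have "(\<Prod>j\<leftarrow>block_list. 1 + block_const * coupling j) = (\<Prod>j\<in>blocks n. 1 + block_const * coupling j)"
    using prod.distinct_set_conv_list[OF block_list(2), of "\<lambda>j. 1 + block_const * coupling j"] block_list(1)
    by simp
  also have "\<dots> = (\<Prod>j=1..n. \<Prod>c\<in>UNIV. 1 + block_const * coupling (j, c))"
    unfolding blocks_def by (simp add: prod.cartesian_product case_prod_unfold)
  also have "\<dots> = (\<Prod>j=1..n. (1 + block_const * (h * \<rho> j * \<delta> j)) ^ 2)"
    by (intro prod.cong) (auto simp: coupling_eq UNIV_bool power2_eq_square)
  finally have prod: "(\<Prod>j\<leftarrow>block_list. 1 + block_const * coupling j) = \<dots>" .
  show ?thesis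
    unfolding composed_def prod[symmetric] using m block_list
    by (intro jets_fold_step H) auto
qed

lemma weyl_limit:
  assumes A: "symbol_jet n m M \<rho> \<delta> A DA" and B: "symbol_jet n m M' \<rho> \<delta> B DB" and M: "M \<ge> 0" and m: "m \<ge> 6"
  shows "((\<lambda>e. weyl_regularized n h A B e X) \<longlongrightarrow> composed DA DB (\<lambda>_. 0) (diag n X)) (at_right 0)"
proof -
  have H: "jets (\<lambda>_. m) (M * M') (tensor n DA DB)"
    by (rule jet_family_tensor[OF A B M]) (use pos in auto)
  have "((\<lambda>e. fold (integral_step e) block_list (tensor n DA DB (\<lambda>_. 0)) (diag n X)) \<longlongrightarrow> composed DA DB (\<lambda>_. 0) (diag n X)) (at_right 0)"
    unfolding composed_def using m block_list
    by (intro tendsto_fold_integral_step[OF H]) (auto simp: le_fun_def)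
  moreover have "\<forall>\<^sub>F e in at_right 0. weyl_regularized n h A B e X = fold (integral_step e) block_list (tensor n DA DB (\<lambda>_. 0)) (diag n X)"
    using weyl_integrand_integrable(2)[OF A B M]
    by (auto simp: eventually_at_filter intro!: always_eventually)
  ultimately show ?thesis
    by (simp add: tendsto_cong)
qed

end

section \<open>Derivatives along the diagonal\<close>

text \<open>
  Continuity of one of the partial derivatives makes \<open>f\<close> differentiable as a function of two
  variables, so that the chain rule applies.
\<close>
lemma has_vector_derivative_diagonal:
  fixes f f1 f2 :: "real \<Rightarrow> real \<Rightarrow> complex"
  assumes f1: "\<And>x y. ((\<lambda>x. f x y) has_vector_derivative f1 x y) (at x)"
    and f2: "\<And>x y. ((\<lambda>y. f x y) has_vector_derivative f2 x y) (at y)"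
    and cont: "continuous_on UNIV (\<lambda>(x, y). f2 x y)"
  shows "((\<lambda>t. f t t) has_vector_derivative f1 t t + f2 t t) (at t)"
proof -
  have "((\<lambda>(x, y). f x y) has_derivative (\<lambda>(tx, ty). tx *\<^sub>R f1 t t + blinfun_scaleR_left (f2 t t) ty)) (at (t, t) within UNIV \<times> UNIV)"
  proof (rule has_derivative_partialsI[where f=f and fx="\<lambda>h. h *\<^sub>R f1 t t" and
        fy="\<lambda>x y. blinfun_scaleR_left (f2 x y)" and x=t and y=t and X=UNIV and Y=UNIV])
    show "((\<lambda>x. f x t) has_derivative (\<lambda>h. h *\<^sub>R f1 t t)) (at t)"
      using f1 by (simp add: has_vector_derivative_def)
    show "((\<lambda>y. f x y) has_derivative blinfun_scaleR_left (f2 x y)) (at y)" for x y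
      using f2 by (simp add: has_vector_derivative_def)
    have "continuous_on UNIV (\<lambda>(x, y). blinfun_scaleR_left (f2 x y))"
      using cont by (auto simp: case_prod_unfold intro!: continuous_intros)
    then show "continuous (at (t, t) within UNIV \<times> UNIV) (\<lambda>(x, y). blinfun_scaleR_left (f2 x y))"
      by (simp add: continuous_on_eq_continuous_at)
  qed auto
  then have d: "((\<lambda>(x, y). f x y) has_derivative (\<lambda>(tx, ty). tx *\<^sub>R f1 t t + ty *\<^sub>R f2 t t)) (at (t, t))"
    by simp
  have "((\<lambda>t. (t, t)) has_derivative (\<lambda>h. (h, h))) (at t)"
    by (intro derivative_intros)
  from has_derivative_compose[OF this d] show ?thesis
    by (simp add: has_vector_derivative_def algebra_simps)
qed

text \<open>
  The coordinate \<open>(j, d)\<close> of \<open>X\<close> appears on the diagonal as the twin coordinates \<open>((j, True), d)\<close> and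
  \<open>((j, False), d)\<close>. By the chain rule, the derivative in it is the sum of these two partial
  derivatives.
\<close>
definition diag_deriv :: "nat \<times> bool \<Rightarrow> (nat \<times> bool) jet \<Rightarrow>
    (nat \<times> bool) jet" where
  "diag_deriv = (\<lambda>(j, d) H k w.
     H (k(((j, True), d) := Suc (k ((j, True), d)))) w + H (k(((j, False), d) := Suc (k ((j, False), d)))) w)"

definition lower_twins :: "nat \<times> bool \<Rightarrow> nat \<Rightarrow> ((nat \<times> bool) \<times> bool \<Rightarrow> nat) \<Rightarrow> (nat \<times> bool) \<times> bool \<Rightarrow> nat" where
  "lower_twins c p ord = (\<lambda>i. if (fst (fst i), snd i) = c then ord i - p else ord i)"

lemma prod_Suc_upd:
  fixes wt :: "'i \<Rightarrow> real"
  assumes "finite K" "i \<in> K"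
  shows "(\<Prod>x\<in>K. wt x ^ (k(i := Suc (k i))) x) = wt i * (\<Prod>x\<in>K. wt x ^ k x)"
proof -
  have "(\<Prod>x\<in>K. wt x ^ (k(i := Suc (k i))) x) = (\<Prod>x\<in>K. (if x = i then wt x else 1) * wt x ^ k x)"
    by (intro prod.cong) auto
  then show ?thesis using assms by (simp add: prod.distrib prod.delta)
qed

text \<open>
  Twin coordinates have the same weight \<open>x\<close>, so the sum of two terms costs \<open>2 x\<close>.
\<close>
lemma jet_family_diag_deriv:
  assumes H: "jet_family K wt ord N H" and K: "finite K" "\<And>c'. ((j, c'), d) \<in> K"
    and wt: "\<And>c'. wt ((j, c'), d) = x" and ord: "\<And>c'. 1 \<le> ord ((j, c'), d)"
  shows "jet_family K wt (lower_twins (j, d) 1 ord) (N * (2 * x)) (diag_deriv (j, d) H)"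
proof -
  define s where "s = (\<lambda>(c' :: bool) k. k(((j, c'), d) := Suc (k ((j, c'), d) :: nat)))"
  have dd: "diag_deriv (j, d) H k w = H (s True k) w + H (s False k) w" for k w
    by (simp add: diag_deriv_def s_def)
  have s: "s c' k \<le> ord" if k: "k \<le> lower_twins (j, d) 1 ord" for k c'
  proof (rule le_funI)
    fix i
    have "k i \<le> lower_twins (j, d) 1 ord i" using k by (rule le_funD)
    then show "s c' k i \<le> ord i"
      using ord[of c'] by (auto simp: s_def lower_twins_def split: if_splits)
  qed
  note HD = jet_familyD[OF H s]
  show ?thesis
    unfolding jet_family_def
  proof (intro allI impI conjI ballI)
    fix k w assume k: "k \<le> lower_twins (j, d) 1 ord"
    have le: "norm (H (s c' k) w) \<le> N * (x * (\<Prod>i\<in>K. wt i ^ k i))" for c'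
      using HD(2)[OF k, of c' w] prod_Suc_upd[OF K, of wt k] wt by (simp add: s_def)
    show "norm (diag_deriv (j, d) H k w) \<le> N * (2 * x) * (\<Prod>i\<in>K. wt i ^ k i)"
      unfolding dd using order_trans[OF norm_triangle_ineq add_mono[OF le le], of True False] by simp
  next
    fix k assume k: "k \<le> lower_twins (j, d) 1 ord"
    show "continuous_on UNIV (diag_deriv (j, d) H k)"
      unfolding dd[abs_def] by (intro continuous_intros HD k)
  next
    fix k i w assume k: "k \<le> lower_twins (j, d) 1 ord" and i: "i \<in> K" "k i < lower_twins (j, d) 1 ord i"
    have lt: "s c' k i < ord i" for c'
      using i(2) ord[of c'] by (auto simp: s_def lower_twins_def split: if_splits)
    have comm: "(s c' k)(i := Suc (s c' k i)) = s c' (k(i := Suc (k i)))" for c'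
      by (auto simp: s_def)
    show "((\<lambda>t. diag_deriv (j, d) H k (w(i := t))) has_vector_derivative diag_deriv (j, d) H (k(i := Suc (k i))) w) (at (w i))"
      unfolding dd comm[symmetric]
      by (intro has_vector_derivative_add HD(3)[OF k i(1) lt])
  qed
qed

lemma jet_family_diag_deriv_power:
  assumes H: "jet_family K wt ord N H" and K: "finite K" "\<And>c'. ((j, c'), d) \<in> K"
    and wt: "\<And>c'. wt ((j, c'), d) = x" and ord: "\<And>c'. p \<le> ord ((j, c'), d)"
  shows "jet_family K wt (lower_twins (j, d) p ord) (N * (2 * x) ^ p) ((diag_deriv (j, d) ^^ p) H)"
  using ord
proof (induction p)
  case 0
  have "lower_twins (j, d) 0 ord = ord" by (auto simp: lower_twins_def)
  then show ?case using H by simp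
next
  case (Suc p)
  have "jet_family K wt (lower_twins (j, d) p ord) (N * (2 * x) ^ p) ((diag_deriv (j, d) ^^ p) H)"
    using Suc.IH Suc.prems Suc_leD by blast
  from jet_family_diag_deriv[OF this K, of x] 
  have "jet_family K wt (lower_twins (j, d) 1 (lower_twins (j, d) p ord)) (N * (2 * x) ^ p * (2 * x)) (diag_deriv (j, d) ((diag_deriv (j, d) ^^ p) H))"
    using wt Suc.prems by (auto simp: lower_twins_def le_diff_conv2 Suc_le_eq)
  moreover have "lower_twins (j, d) 1 (lower_twins (j, d) p ord) = lower_twins (j, d) (Suc p) ord"
    by (auto simp: lower_twins_def)
  ultimately show ?case by (simp add: mult_ac)
qed

definition diag_derivs :: "(nat \<times> bool) list \<Rightarrow> (nat \<times> bool \<Rightarrow> nat) \<Rightarrow>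
    (nat \<times> bool) jet \<Rightarrow>
    (nat \<times> bool) jet" where
  "diag_derivs cs \<gamma> = fold (\<lambda>c. diag_deriv c ^^ \<gamma> c) cs"

lemma fold_lower_twins:
  "distinct cs \<Longrightarrow> fold (\<lambda>c. lower_twins c (\<gamma> c)) cs ord =
     (\<lambda>i. if (fst (fst i), snd i) \<in> set cs then ord i - \<gamma> (fst (fst i), snd i) else ord i)"
  by (induction cs arbitrary: ord) (auto simp: lower_twins_def fun_eq_iff)

lemma jet_family_diag_derivs:
  assumes "jet_family K wt ord N H" and K: "finite K" "\<And>j d c'. (j, d) \<in> set cs \<Longrightarrow> ((j, c'), d) \<in> K"
    and wt: "\<And>j d c'. (j, d) \<in> set cs \<Longrightarrow> wt ((j, c'), d) = x (j, d)"
    and "distinct cs"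
    and "\<And>j d c'. (j, d) \<in> set cs \<Longrightarrow> \<gamma> (j, d) \<le> ord ((j, c'), d)"
  shows "jet_family K wt (fold (\<lambda>c. lower_twins c (\<gamma> c)) cs ord) (N * (\<Prod>c\<leftarrow>cs. (2 * x c) ^ \<gamma> c)) (diag_derivs cs \<gamma> H)"
  using assms unfolding diag_derivs_def
proof (induction cs arbitrary: ord N H)
  case (Cons c cs)
  obtain j d where c: "c = (j, d)" by (cases c)
  have "jet_family K wt (lower_twins (j, d) (\<gamma> (j, d)) ord) (N * (2 * x (j, d)) ^ \<gamma> (j, d)) ((diag_deriv (j, d) ^^ \<gamma> (j, d)) H)"
    using Cons.prems by (intro jet_family_diag_deriv_power) (auto simp: c)
  note IH = Cons.IH[OF this]
  have "jet_family K wt (fold (\<lambda>c. lower_twins c (\<gamma> c)) cs (lower_twins (j, d) (\<gamma> (j, d)) ord))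
      (N * (2 * x (j, d)) ^ \<gamma> (j, d) * (\<Prod>c\<leftarrow>cs. (2 * x c) ^ \<gamma> c)) (fold (\<lambda>c. diag_deriv c ^^ \<gamma> c) cs ((diag_deriv (j, d) ^^ \<gamma> (j, d)) H))"
  proof (rule IH)
    show "\<gamma> (j', d') \<le> lower_twins (j, d) (\<gamma> (j, d)) ord ((j', c'), d')" if "(j', d') \<in> set cs" for j' d' c'
      using Cons.prems(5) Cons.prems(6)[of j' d' c'] that by (auto simp: lower_twins_def c)
  qed (use Cons.prems in auto)
  then show ?case by (simp add: c mult.assoc)
qed simp

lemma diag_deriv_commute: "diag_deriv c (diag_deriv c' H) = diag_deriv c' (diag_deriv c H)"
proof -
  obtain j d j' d' where c: "c = (j, d)" "c' = (j', d')" by (cases c; cases c')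
  define s where "s = (\<lambda>i k. k(i := Suc (k i :: nat)) :: (nat \<times> bool) \<times> bool \<Rightarrow> nat)"
  have comm: "s i (s i' k) = s i' (s i k)" for i i' k
    by (auto simp: s_def fun_eq_iff)
  have dd: "diag_deriv (j, d) H k w = H (s ((j, True), d) k) w + H (s ((j, False), d) k) w" for j d H k w
    by (simp add: diag_deriv_def s_def)
  have "diag_deriv c (diag_deriv c' H) k w = diag_deriv c' (diag_deriv c H) k w" for k w
    unfolding c dd
    by (simp only: comm[of "((j, True), d)" "((j', _), d')"] comm[of "((j, False), d)" "((j', _), d')"] ac_simps)
  then show ?thesis by blast
qed

lemma diag_deriv_power_commute: "diag_deriv c ((diag_deriv c' ^^ p) H) = (diag_deriv c' ^^ p) (diag_deriv c H)"
  by (induction p) (auto simp: diag_deriv_commute[of c c'])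

lemma diag_derivs_commute: "diag_derivs cs \<gamma> (diag_deriv c H) = diag_deriv c (diag_derivs cs \<gamma> H)"
  unfolding diag_derivs_def
  by (induction cs arbitrary: H) (auto simp: diag_deriv_power_commute[symmetric])

lemma diag_derivs_Cons:
  "diag_derivs (c # cs) \<gamma> H = diag_derivs cs \<gamma> ((diag_deriv c ^^ \<gamma> c) H)"
  by (simp add: diag_derivs_def)

text \<open>
  \<open>diag_derivs\<close> applies the derivatives in the order of the list. Since they commute, a further
  derivative in any coordinate can be put in front, which is the form in which the chain rule yields
  it.
\<close>
lemma diag_derivs_Suc:
  assumes "distinct cs" "c \<in> set cs"
  shows "diag_derivs cs (\<gamma>(c := Suc (\<gamma> c))) H = diag_deriv c (diag_derivs cs \<gamma> H)"
  using assms
proof (induction cs arbitrary: H)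
  case (Cons a cs)
  show ?case
  proof (cases "a = c")
    case True
    then have "diag_derivs cs (\<gamma>(c := Suc (\<gamma> c))) H' = diag_derivs cs \<gamma> H'" for H'
      using Cons.prems(1) unfolding diag_derivs_def by (intro fold_cong) auto
    then show ?thesis
      by (simp only: True diag_derivs_Cons fun_upd_same funpow.simps comp_apply diag_derivs_commute)
  next
    case False
    then show ?thesis
      using Cons.IH[of "(diag_deriv a ^^ \<gamma> a) H"] Cons.prems by (simp add: diag_derivs_Cons)
  qed
qed simp

lemma diag_family_derivative:
  assumes G: "jet_family K wt ord N G" and k: "k \<le> ord" and K: "\<And>c'. ((j, c'), d) \<in> K"
    and lt: "\<And>c'. k ((j, c'), d) < ord ((j, c'), d)" and w: "\<And>c'. w ((j, c'), d) = t"
  shows "((\<lambda>t. G k (w(((j, True), d) := t, ((j, False), d) := t))) has_vector_derivative diag_deriv (j, d) G k w) (at t)"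
proof -
  let ?a = "((j, True), d)" and ?b = "((j, False), d)"
  let ?w = "\<lambda>x y. w(?a := x, ?b := y)"
  have "((\<lambda>t. G k (?w t t)) has_vector_derivative
     G (k(?a := Suc (k ?a))) (?w t t) + G (k(?b := Suc (k ?b))) (?w t t)) (at t)"
  proof (rule has_vector_derivative_diagonal[where f="\<lambda>x y. G k (?w x y)" and
        ?f1.0="\<lambda>x y. G (k(?a := Suc (k ?a))) (?w x y)" and ?f2.0="\<lambda>x y. G (k(?b := Suc (k ?b))) (?w x y)"])
    fix x y
    have "(?w x y)(?a := u) = ?w u y" for u by (auto simp: fun_eq_iff)
    then show "((\<lambda>u. G k (?w u y)) has_vector_derivative G (k(?a := Suc (k ?a))) (?w x y)) (at x)"
      using jet_familyD(3)[OF G k K lt, of "?w x y" True] by simp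
    show "((\<lambda>u. G k (?w x u)) has_vector_derivative G (k(?b := Suc (k ?b))) (?w x y)) (at y)"
      using jet_familyD(3)[OF G k K lt, of "?w x y" False] by simp
  next
    have kb: "k(?b := Suc (k ?b)) \<le> ord"
      using k lt[of False] by (auto simp: le_fun_def)
    have "continuous_on UNIV (\<lambda>p. ?w (fst p) (snd p))"
    proof (rule continuous_on_coordinatewise_then_product)
      fix i show "continuous_on UNIV (\<lambda>p. ?w (fst p) (snd p) i)"
        by (cases "i = ?a"; cases "i = ?b") (auto intro!: continuous_intros)
    qed
    from continuous_on_compose2[OF jet_familyD(1)[OF G kb] this]
    show "continuous_on UNIV (\<lambda>(x, y). G (k(?b := Suc (k ?b))) (?w x y))"
      by (simp add: case_prod_unfold)
  qed
  moreover have "?w t t = w"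
    using w by (auto simp: fun_eq_iff)
  ultimately show ?thesis
    by (simp add: diag_deriv_def)
qed

lemma continuous_diag: "continuous_on S (diag n)"
proof (rule continuous_on_coordinatewise_then_product)
  fix i :: "(nat \<times> bool) \<times> bool"
  obtain j c d where i: "i = ((j, c), d)" by (cases i) auto
  have "continuous_on S (\<lambda>X::phase_point. fst X j)" "continuous_on S (\<lambda>X::phase_point. snd X j)"
    by (rule continuous_on_product_then_coordinatewise[OF continuous_on_fst[OF continuous_on_id]]
        continuous_on_product_then_coordinatewise[OF continuous_on_snd[OF continuous_on_id]])+
  note c = this
  have eq: "(\<lambda>X. diag n X i) = (if j \<in> {1..n} then (if d then (\<lambda>X. snd X j) else (\<lambda>X. fst X j)) else (\<lambda>_. 0))"
    by (auto simp: diag_def i)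
  show "continuous_on S (\<lambda>X. diag n X i)"
    unfolding eq using c by auto
qed

lemma diag_upd:
  assumes "j \<in> {1..n}"
  shows "diag n (x(j := t), \<xi>) = (diag n (x, \<xi>))(((j, True), False) := t, ((j, False), False) := t)"
    "diag n (x, \<xi>(j := t)) = (diag n (x, \<xi>))(((j, True), True) := t, ((j, False), True) := t)"
  using assms by (auto simp: diag_def fun_eq_iff)

lemma phase_nonempty: "phase n \<noteq> {}"
  by (auto simp: phase_def config_space_def PiE_eq_empty_iff)

context weyl_setup
begin

lemma weyl_comp_eq:
  assumes "symbol_jet n m M \<rho> \<delta> A DA" "symbol_jet n m M' \<rho> \<delta> B DB" "M \<ge> 0" "m \<ge> 6"
  shows "weyl_comp n h A B X = composed DA DB (\<lambda>_. 0) (diag n X)"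
  unfolding weyl_comp_def by (rule tendsto_Lim[OF _ weyl_limit[OF assms]]) simp

lemma weyl_definedI:
  assumes "symbol_jet n m M \<rho> \<delta> A DA" "symbol_jet n m M' \<rho> \<delta> B DB" "M \<ge> 0" "m \<ge> 6"
  shows "weyl_defined n h A B"
  unfolding weyl_defined_def
  using weyl_integrand_integrable(1)[OF assms(1-3)] weyl_limit[OF assms] by blast

text \<open>
  This is \<open>(1 + C s)\<^sup>2 \<le> 1 + (2 C + C\<^sup>2) s\<close> for \<open>s = h \<rho>\<^sub>j \<delta>\<^sub>j\<close> between 0 and 1. The additional summand 1
  makes the constant of the theorem positive.
\<close>
lemma bound_factor_le:
  assumes MM: "M \<ge> 0" "M' \<ge> 0" and s: "\<And>j. j \<in> {1..n} \<Longrightarrow> h * \<rho> j * \<delta> j \<le> 1"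
  shows "M * M' * (\<Prod>j=1..n. (1 + block_const * (h * \<rho> j * \<delta> j)) ^ 2)
     \<le> M * M' * (\<Prod>j=1..n. 1 + (2 * block_const + block_const\<^sup>2 + 1) * h * \<rho> j * \<delta> j)"
proof (intro mult_left_mono prod_mono conjI)
  fix j assume j: "j \<in> {1..n}"
  define s where "s = h * \<rho> j * \<delta> j"
  have s01: "0 \<le> s" "s \<le> 1" using s[OF j] h pos[OF j] by (auto simp: s_def)
  have "block_const\<^sup>2 * (s * s) \<le> block_const\<^sup>2 * s"
    using s01 by (intro mult_left_mono) (auto simp: mult_left_le_one_le)
  then have "(1 + block_const * s) ^ 2 \<le> 1 + (2 * block_const + block_const\<^sup>2 + 1) * s"
    using s01 by (simp add: power2_eq_square algebra_simps)
  then show "(1 + block_const * (h * \<rho> j * \<delta> j)) ^ 2 \<le> 1 + (2 * block_const + block_const\<^sup>2 + 1) * h * \<rho> j * \<delta> j"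
    by (simp add: s_def mult.assoc)
qed (use MM in auto)

text \<open>
  The derivative of order \<open>(\<alpha>, \<beta>)\<close> is obtained from \<open>composed\<close> by \<open>diag_derivs\<close>. The block operators have
  used three of the \<open>m\<close> orders of \<open>A\<close> and \<open>B\<close> in each coordinate, so orders up to \<open>m - 6\<close> are still
  available.
\<close>
lemma symbol_class_composed:
  assumes A: "symbol_jet n m M \<rho> \<delta> A DA" and B: "symbol_jet n m M' \<rho> \<delta> B DB" and M: "M \<ge> 0" and m: "m \<ge> 6"
    and N: "M * M' * (\<Prod>j=1..n. (1 + block_const * (h * \<rho> j * \<delta> j)) ^ 2) \<le> N"
  shows "weyl_comp n h A B \<in> symbol_class n (m - 6) N (\<lambda>j. 2 * \<rho> j) (\<lambda>j. 2 * \<delta> j)"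
proof -
  define ord where "ord = fold lower block_list (\<lambda>_. m)"
  have ord: "ord ((j, c), d) = m - 3" if "j \<in> {1..n}" for j c d
    using that block_list by (simp add: ord_def fold_lower blocks_def)
  have C: "jets ord N (composed DA DB)"
    unfolding ord_def by (rule jet_family_mono[OF composed_jets[OF A B M m] wt_nonneg' N])
  define \<gamma> :: "(nat \<Rightarrow> nat) \<Rightarrow> (nat \<Rightarrow> nat) \<Rightarrow> nat \<times> bool \<Rightarrow> nat" where "\<gamma> = (\<lambda>\<alpha> \<beta> (j, d). if d then \<beta> j else \<alpha> j)"
  define G where "G = (\<lambda>\<alpha> \<beta>. diag_derivs block_list (\<gamma> \<alpha> \<beta>) (composed DA DB))"
  define D where "D = (\<lambda>\<alpha> \<beta> X. G \<alpha> \<beta> (\<lambda>_. 0) (diag n X))"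
  have idx: "\<alpha> j \<le> m - 6" if "\<alpha> \<in> multi_indices n (m - 6)" "j \<in> {1..n}" for \<alpha> j
    using that by (auto simp: multi_indices_def)
  define ord' where "ord' = (\<lambda>\<alpha> \<beta>. fold (\<lambda>c. lower_twins c (\<gamma> \<alpha> \<beta> c)) block_list ord)"
  have ord': "ord' \<alpha> \<beta> ((j, c), d) = m - 3 - \<gamma> \<alpha> \<beta> (j, d)" if "j \<in> {1..n}" for \<alpha> \<beta> j c d
    using that ord[OF that] block_list by (simp add: ord'_def fold_lower_twins blocks_def)
  have G: "jets (ord' \<alpha> \<beta>) (N * (\<Prod>j=1..n. (2 * \<rho> j) ^ \<alpha> j * (2 * \<delta> j) ^ \<beta> j)) (G \<alpha> \<beta>)"
    if ab: "\<alpha> \<in> multi_indices n (m - 6)" "\<beta> \<in> multi_indices n (m - 6)" for \<alpha> \<beta>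
  proof -
    define x where "x = (\<lambda>(j, d). if d then \<delta> j else \<rho> j)"
    have "jets (ord' \<alpha> \<beta>) (N * (\<Prod>c\<leftarrow>block_list. (2 * x c) ^ \<gamma> \<alpha> \<beta> c)) (G \<alpha> \<beta>)"
      unfolding ord'_def G_def
    proof (rule jet_family_diag_derivs[OF C])
      fix j d c' assume "(j, d) \<in> set block_list"
      then have j: "j \<in> {1..n}" using block_list by (auto simp: blocks_def)
      show "((j, c'), d) \<in> blocks n \<times> UNIV" using j by (simp add: blocks_def)
      show "coord_weight \<rho> \<delta> ((j, c'), d) = x (j, d)" by (simp add: coord_weight_def x_def)
      show "\<gamma> \<alpha> \<beta> (j, d) \<le> ord ((j, c'), d)"
        using idx[OF ab(1) j] idx[OF ab(2) j] by (auto simp: ord[OF j] \<gamma>_def)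
    qed (use block_list in auto)
    also have "(\<Prod>c\<leftarrow>block_list. (2 * x c) ^ \<gamma> \<alpha> \<beta> c) = (\<Prod>c\<in>blocks n. (2 * x c) ^ \<gamma> \<alpha> \<beta> c)"
      using prod.distinct_set_conv_list[OF block_list(2), of "\<lambda>c. (2 * x c) ^ \<gamma> \<alpha> \<beta> c"] block_list(1) by simp
    also have "\<dots> = (\<Prod>j=1..n. \<Prod>d\<in>UNIV. (2 * x (j, d)) ^ \<gamma> \<alpha> \<beta> (j, d))"
      unfolding blocks_def by (simp add: prod.cartesian_product case_prod_unfold)
    also have "\<dots> = (\<Prod>j=1..n. (2 * \<rho> j) ^ \<alpha> j * (2 * \<delta> j) ^ \<beta> j)"
      by (simp add: UNIV_bool x_def \<gamma>_def mult.commute)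
    finally show ?thesis .
  qed
  have zero: "(\<lambda>_. 0) \<le> o'" for o' :: "(nat \<times> bool) \<times> bool \<Rightarrow> nat" by (simp add: le_fun_def)
  have D_cont: "continuous_on (phase n) (D \<alpha> \<beta>)"
    and D_le: "norm (D \<alpha> \<beta> X) \<le> N * (\<Prod>j=1..n. (2 * \<rho> j) ^ \<alpha> j * (2 * \<delta> j) ^ \<beta> j)"
    if ab: "\<alpha> \<in> multi_indices n (m - 6)" "\<beta> \<in> multi_indices n (m - 6)" for \<alpha> \<beta> X
    using jet_familyD(2)[OF G[OF ab] zero, of "diag n X"]
      continuous_on_compose2[OF jet_familyD(1)[OF G[OF ab] zero] continuous_diag]
    by (auto simp: D_def)
  have "\<gamma> (\<lambda>j\<in>{1..n}. 0) (\<lambda>j\<in>{1..n}. 0) c = 0" if "c \<in> set block_list" for c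
    using that block_list by (auto simp: \<gamma>_def blocks_def)
  then have "G (\<lambda>j\<in>{1..n}. 0) (\<lambda>j\<in>{1..n}. 0) = fold (\<lambda>_. id) block_list (composed DA DB)"
    unfolding G_def diag_derivs_def by (intro fold_cong) (auto simp: id_def)
  then have D0: "D (\<lambda>j\<in>{1..n}. 0) (\<lambda>j\<in>{1..n}. 0) = weyl_comp n h A B"
    by (simp add: D_def weyl_comp_eq[OF A B M m] fun_eq_iff fold_id)
  have zero_idx: "(\<lambda>j\<in>{1..n}. 0) \<in> multi_indices n (m - 6)"
    by (auto simp: multi_indices_def)
  have partials: "mixed_partials n (m - 6) (weyl_comp n h A B) D"
    unfolding mixed_partials_def
  proof (intro conjI ballI impI)
    fix \<alpha> \<beta> j assume ab: "\<alpha> \<in> multi_indices n (m - 6)" "\<beta> \<in> multi_indices n (m - 6)" and j: "j \<in> {1..n}"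
    have jl: "(j, d) \<in> set block_list" for d using j block_list by (simp add: blocks_def)
    have jK: "((j, c'), d) \<in> blocks n \<times> UNIV" for c' d using j by (simp add: blocks_def)
    show "has_partial_x n j (D \<alpha> \<beta>) (D (\<alpha>(j := Suc (\<alpha> j))) \<beta>)" if lt: "\<alpha> j < m - 6"
      unfolding has_partial_x_def
    proof (intro ballI)
      fix x \<xi>
      have "\<gamma> (\<alpha>(j := Suc (\<alpha> j))) \<beta> = (\<gamma> \<alpha> \<beta>)((j, False) := Suc (\<gamma> \<alpha> \<beta> (j, False)))"
        by (auto simp: \<gamma>_def fun_eq_iff)
      then have "G (\<alpha>(j := Suc (\<alpha> j))) \<beta> = diag_deriv (j, False) (G \<alpha> \<beta>)"
        unfolding G_def by (simp add: diag_derivs_Suc[OF block_list(2) jl])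
      moreover have "((\<lambda>t. G \<alpha> \<beta> (\<lambda>_. 0) ((diag n (x, \<xi>))(((j, True), False) := t, ((j, False), False) := t)))
        has_vector_derivative diag_deriv (j, False) (G \<alpha> \<beta>) (\<lambda>_. 0) (diag n (x, \<xi>))) (at (x j))"
        using lt j by (intro diag_family_derivative[OF G[OF ab] zero jK]) (auto simp: ord'[OF j] \<gamma>_def diag_def)
      ultimately show "((\<lambda>t. D \<alpha> \<beta> (x(j := t), \<xi>)) has_vector_derivative D (\<alpha>(j := Suc (\<alpha> j))) \<beta> (x, \<xi>)) (at (x j))"
        unfolding D_def by (simp only: diag_upd[OF j])
    qed
    show "has_partial_xi n j (D \<alpha> \<beta>) (D \<alpha> (\<beta>(j := Suc (\<beta> j))))" if lt: "\<beta> j < m - 6"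
      unfolding has_partial_xi_def
    proof (intro ballI)
      fix x \<xi>
      have "\<gamma> \<alpha> (\<beta>(j := Suc (\<beta> j))) = (\<gamma> \<alpha> \<beta>)((j, True) := Suc (\<gamma> \<alpha> \<beta> (j, True)))"
        by (auto simp: \<gamma>_def fun_eq_iff)
      then have "G \<alpha> (\<beta>(j := Suc (\<beta> j))) = diag_deriv (j, True) (G \<alpha> \<beta>)"
        unfolding G_def by (simp add: diag_derivs_Suc[OF block_list(2) jl])
      moreover have "((\<lambda>t. G \<alpha> \<beta> (\<lambda>_. 0) ((diag n (x, \<xi>))(((j, True), True) := t, ((j, False), True) := t)))
        has_vector_derivative diag_deriv (j, True) (G \<alpha> \<beta>) (\<lambda>_. 0) (diag n (x, \<xi>))) (at (\<xi> j))"
        using lt j by (intro diag_family_derivative[OF G[OF ab] zero jK]) (auto simp: ord'[OF j] \<gamma>_def diag_def)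
      ultimately show "((\<lambda>t. D \<alpha> \<beta> (x, \<xi>(j := t))) has_vector_derivative D \<alpha> (\<beta>(j := Suc (\<beta> j))) (x, \<xi>)) (at (\<xi> j))"
        unfolding D_def by (simp only: diag_upd[OF j])
    qed
  qed (simp only: D0)
  show ?thesis
    unfolding symbol_class_def
  proof (intro CollectI conjI exI[of _ D] ballI)
    show "continuous_on (phase n) (weyl_comp n h A B)"
      using D_cont[OF zero_idx zero_idx] unfolding D0 .
    fix \<alpha> \<beta> assume ab: "\<alpha> \<in> multi_indices n (m - 6)" "\<beta> \<in> multi_indices n (m - 6)"
    show "continuous_on (phase n) (D \<alpha> \<beta>)" by (rule D_cont[OF ab])
    show "bounded (D \<alpha> \<beta> ` phase n)"
      using D_le[OF ab] unfolding bounded_iff by blast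
    show "(SUP X\<in>phase n. cmod (D \<alpha> \<beta> X)) \<le> N * (\<Prod>j=1..n. (2 * \<rho> j) ^ \<alpha> j * (2 * \<delta> j) ^ \<beta> j)"
      by (intro cSUP_least phase_nonempty D_le[OF ab])
  qed (rule partials)
qed

end

lemma symbol_class_bounded:
  assumes "F \<in> symbol_class n m N \<rho> \<delta>"
  shows "bounded (F ` phase n) \<and> (SUP X\<in>phase n. cmod (F X)) \<le> N"
proof -
  obtain D where D: "symbol_jet n m N \<rho> \<delta> F D"
    using symbol_jetI[OF assms] by blast
  have z: "(\<lambda>j\<in>{1..n}. 0) \<in> multi_indices n m" by (auto simp: multi_indices_def)
  have "norm (F X) \<le> N" if "X \<in> phase n" for X
  proof -
    have "F X = D (\<lambda>j\<in>{1..n}. 0) (\<lambda>j\<in>{1..n}. 0) X"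
      using D that by (simp add: symbol_jet_def mixed_partials_def)
    also have "norm \<dots> \<le> N * (\<Prod>j=1..n. \<rho> j ^ (\<lambda>j\<in>{1..n}. 0) j * \<delta> j ^ (\<lambda>j\<in>{1..n}. 0) j)"
      using D z that unfolding symbol_jet_def by blast
    finally show ?thesis by simp
  qed
  then show ?thesis
    using phase_nonempty by (auto simp: bounded_iff intro!: cSUP_least exI[of _ N])
qed

section \<open>The composition estimate\<close>

theorem theorem1p2:
  "\<exists>K>0. \<forall>(n::nat) (h::real) (M::real) (M'::real) (\<rho>::nat \<Rightarrow> real) (\<delta>::nat \<Rightarrow> real).
     n \<ge> 1 \<longrightarrow> h > 0 \<longrightarrow> M \<ge> 0 \<longrightarrow> M' \<ge> 0 \<longrightarrow>
     (\<forall>j\<ge>1. \<rho> j \<ge> 0 \<and> \<delta> j \<ge> 0) \<longrightarrow>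
     (\<forall>j\<in>{1..n}. h * \<rho> j * \<delta> j \<le> 1) \<longrightarrow>
     (let M'' = M * M' * (\<Prod>j=1..n. 1 + K * h * \<rho> j * \<delta> j) in
        (\<forall>A B. A \<in> symbol_class n 6 M \<rho> \<delta> \<longrightarrow> B \<in> symbol_class n 6 M' \<rho> \<delta> \<longrightarrow>
           weyl_defined n h A B \<and>
           bounded (weyl_comp n h A B ` phase n) \<and>
           (SUP X\<in>phase n. cmod (weyl_comp n h A B X)) \<le> M'') \<and>
        (\<forall>(m::nat) A B. m \<ge> 6 \<longrightarrow> A \<in> symbol_class n m M \<rho> \<delta> \<longrightarrow> B \<in> symbol_class n m M' \<rho> \<delta> \<longrightarrow>
           weyl_comp n h A B \<in>
             symbol_class n (m - 6) M'' (\<lambda>j. 2 * \<rho> j) (\<lambda>j. 2 * \<delta> j)))"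
proof (intro exI[of _ "2 * block_const + block_const\<^sup>2 + 1"] conjI allI impI)
  show "0 < 2 * block_const + block_const\<^sup>2 + 1"
    using block_const_nonneg by (simp add: add_nonneg_pos)
next
  fix n :: nat and h M M' :: real and \<rho> \<delta> :: "nat \<Rightarrow> real"
  assume "1 \<le> n" and h: "0 < h" and M: "0 \<le> M" "0 \<le> M'"
    and pos: "\<forall>j\<ge>1. \<rho> j \<ge> 0 \<and> \<delta> j \<ge> 0" and small: "\<forall>j\<in>{1..n}. h * \<rho> j * \<delta> j \<le> 1"
  define N where "N = M * M' * (\<Prod>j=1..n. 1 + (2 * block_const + block_const\<^sup>2 + 1) * h * \<rho> j * \<delta> j)"
  have "\<forall>j\<in>{1..n}. \<exists>l>0. l * \<rho> j \<le> 1 \<and> h / l * \<delta> j \<le> 1"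
    using scaling_exists[OF h] pos small by auto
  then obtain l where l: "\<And>j. j \<in> {1..n} \<Longrightarrow> 0 < l j \<and> l j * \<rho> j \<le> 1 \<and> h / l j * \<delta> j \<le> 1"
    by metis
  interpret weyl_setup n h \<rho> \<delta> l
    by (rule weyl_setup.intro) (use h pos l in \<open>simp_all del: times_divide_eq_left\<close>)
  have N: "M * M' * (\<Prod>j=1..n. (1 + block_const * (h * \<rho> j * \<delta> j)) ^ 2) \<le> N"
    unfolding N_def using M small by (intro bound_factor_le) auto
  have part2: "weyl_defined n h A B \<and> weyl_comp n h A B \<in> symbol_class n (m - 6) N (\<lambda>j. 2 * \<rho> j) (\<lambda>j. 2 * \<delta> j)"
    if AB: "m \<ge> 6" "A \<in> symbol_class n m M \<rho> \<delta>" "B \<in> symbol_class n m M' \<rho> \<delta>" for m A B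
  proof -
    obtain DA where DA: "symbol_jet n m M \<rho> \<delta> A DA"
      using symbol_jetI[OF AB(2)] by blast
    obtain DB where DB: "symbol_jet n m M' \<rho> \<delta> B DB"
      using symbol_jetI[OF AB(3)] by blast
    then show ?thesis
      using weyl_definedI[OF DA DB M(1) AB(1)] symbol_class_composed[OF DA DB M(1) AB(1) N] by blast
  qed
  show "let M'' = M * M' * (\<Prod>j=1..n. 1 + (2 * block_const + block_const\<^sup>2 + 1) * h * \<rho> j * \<delta> j) in
        (\<forall>A B. A \<in> symbol_class n 6 M \<rho> \<delta> \<longrightarrow> B \<in> symbol_class n 6 M' \<rho> \<delta> \<longrightarrow>
           weyl_defined n h A B \<and>
           bounded (weyl_comp n h A B ` phase n) \<and>
           (SUP X\<in>phase n. cmod (weyl_comp n h A B X)) \<le> M'') \<and>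
        (\<forall>(m::nat) A B. m \<ge> 6 \<longrightarrow> A \<in> symbol_class n m M \<rho> \<delta> \<longrightarrow> B \<in> symbol_class n m M' \<rho> \<delta> \<longrightarrow>
           weyl_comp n h A B \<in>
             symbol_class n (m - 6) M'' (\<lambda>j. 2 * \<rho> j) (\<lambda>j. 2 * \<delta> j))"
    unfolding Let_def N_def[symmetric]
    using part2 symbol_class_bounded by blast
qed

end
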